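(* Let $\Omega\subset\mathbb{R}^2$ be the unit disk centered at $0$, let $n\ge1$, and let $d_{ij}$ ($1\le i,j\le n$) be fixed real numbers independent of $\varepsilon$ with $|d_{ij}|>2$ for $i\neq j$. For small $\varepsilon>0$ let $\partial\Omega_i\subset\partial\Omega$, $i=1,\dots,n$, be the arcs parameterized by $x(t)=(\cos t,\sin t)$, $t\in(s_i-\varepsilon,s_i+\varepsilon)$, with $s_i-s_j=d_{ij}\varepsilon$. Let $\partial\Omega_a=\bigcup_{i=1}^n\partial\Omega_i$, $\partial\Omega_r=\partial\Omega\setminus\overline{\partial\Omega_a}$, and let $u$ be the solution of $$\Delta u=-1\ \text{in }\Omega,\qquad u=0\ \text{on }\partial\Omega_a,\qquad \frac{\partial u}{\partial\nu}=0\ \text{on }\partial\Omega_r .$$ Then, as $\varepsilon\to0$, $$u(x)=-\ln\varepsilon-\frac{1}{\alpha_1+\cdots+\alpha_n}+\frac1n\sum_{i=1}^n\Phi_\Omega(x,x(s_i))+O(\varepsilon),$$ where the remainder $O(\varepsilon)$ is uniform in $x\in\Omega$ with $\mathrm{dist}(x,\bigcup_{i=1}^n\partial\Omega_i)\ge c$ for some constant $c>0$; the constants $\alpha_i$ and the function $\Phi_\Omega$ are defined in the context.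
   Context: $\nu$ denotes the outward unit normal on $\partial\Omega$. For the unit disk $\Omega$ and $x^*\in\partial\Omega$, $$\Phi_\Omega(x,x^* )=\ln|x-x^*|+\frac14(1-|x|^2).$$ Let $\mathbf{X}_1$ be the Hilbert space of functions $\varphi$ on $(-1,1)$ with $\|\varphi\|_{\mathbf{X}_1}=\big(\int_{-1}^1\sqrt{1-x^2}\,|\varphi(x)|^2dx\big)^{1/2}<\infty$, and $\mathbf{Y}_1=\{\psi\in\mathcal{C}^0([-1,1]):\psi'\in\mathbf{X}_1\}$ (distributional derivative) with norm $(\|\psi\|_{\mathbf{X}_1}^2+\|\psi'\|_{\mathbf{X}_1}^2)^{1/2}$. With $d_{ij}=(s_i-s_j)/\varepsilon$ define $$\mathcal{L}_{ij}[\varphi](s)=\int_{-1}^1\ln|d_{ij}+s-t|\,\varphi(t)\,dt,\qquad \mathcal{A}=(\mathcal{L}_{ij})_{n\times n}:\mathbf{X}_1^n\to\mathbf{Y}_1^n,$$ which is invertible, and $$\begin{pmatrix}\alpha_1\\ \vdots\\ \alpha_n\end{pmatrix}=\int_{-1}^1\mathcal{A}^{-1}\begin{pmatrix}1\\ \vdots\\ 1\end{pmatrix}(t)\,dt .$$ *)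

theory Defs
  imports "HOL-Analysis.Analysis"
begin

text \<open>The plane is \<^typ>\<open>real \<times> real\<close> with its Euclidean norm.\<close>

definition partial_deriv :: "'a::euclidean_space \<Rightarrow> ('a \<Rightarrow> real) \<Rightarrow> 'a \<Rightarrow> real" where
  "partial_deriv b f x = deriv (\<lambda>t. f (x + t *\<^sub>R b)) 0"

definition C1_on :: "('a::euclidean_space \<Rightarrow> real) \<Rightarrow> 'a set \<Rightarrow> bool" where
  "C1_on f S \<longleftrightarrow> f differentiable_on S \<and> (\<forall>b\<in>Basis. continuous_on S (partial_deriv b f))"

definition C2_on :: "('a::euclidean_space \<Rightarrow> real) \<Rightarrow> 'a set \<Rightarrow> bool" where
  "C2_on f S \<longleftrightarrow> C1_on f S \<and> (\<forall>b\<in>Basis. C1_on (partial_deriv b f) S)"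

definition laplacian :: "('a::euclidean_space \<Rightarrow> real) \<Rightarrow> 'a \<Rightarrow> real" where
  "laplacian f x = (\<Sum>b\<in>Basis. partial_deriv b (partial_deriv b f) x)"

text \<open>The derivative is one-sided because the functions it is applied to are only meaningful
  on the closed domain, which \<open>x + t *\<^sub>R \<nu>\<close> enters for \<open>t < 0\<close> when \<open>\<nu>\<close> is outward.\<close>

definition has_normal_derivative ::
    "('a::real_normed_vector \<Rightarrow> real) \<Rightarrow> 'a \<Rightarrow> real \<Rightarrow> 'a \<Rightarrow> bool" where
  "has_normal_derivative u \<nu> D x \<longleftrightarrow>
     ((\<lambda>t. u (x + t *\<^sub>R \<nu>)) has_real_derivative D) (at_left 0)"

text \<open>Classical solutions, continuous up to the boundary: continuity at the endpoints of the arcs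
  is what makes the solution unique. The outward unit normal of the unit disk at \<open>x\<close> is \<open>x\<close>.
  The values of \<open>u\<close> outside the closed disk play no role.\<close>

definition mixed_solution :: "(real \<times> real) set \<Rightarrow> (real \<times> real \<Rightarrow> real) \<Rightarrow> bool" where
  "mixed_solution \<Gamma> u \<longleftrightarrow>
     continuous_on (cball 0 1) u \<and> C2_on u (ball 0 1) \<and>
     (\<forall>x\<in>ball 0 1. laplacian u x = -1) \<and>
     (\<forall>x\<in>\<Gamma>. u x = 0) \<and>
     (\<forall>x\<in>sphere 0 1 - closure \<Gamma>. has_normal_derivative u x 0 x)"

definition circle_point :: "real \<Rightarrow> real \<times> real" where
  "circle_point t = (cos t, sin t)"

definition boundary_arc :: "real \<Rightarrow> real \<Rightarrow> (real \<times> real) set" where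
  "boundary_arc s \<epsilon> = circle_point ` {s - \<epsilon><..<s + \<epsilon>}"

definition absorbing_part :: "real \<Rightarrow> real ^ 'n \<Rightarrow> (real \<times> real) set" where
  "absorbing_part \<epsilon> s = (\<Union>i. boundary_arc (s $ i) \<epsilon>)"

definition Phi_disk :: "real \<times> real \<Rightarrow> real \<times> real \<Rightarrow> real" where
  "Phi_disk x y = ln (norm (x - y)) + (1 - (norm x)\<^sup>2) / 4"

text \<open>Elements of the weighted \<open>L\<^sup>2\<close> space are represented by functions, not by classes modulo
  null sets; their values outside \<open>(-1, 1)\<close> are irrelevant.\<close>

definition X1 :: "(real \<Rightarrow> real) set" where
  "X1 = {\<phi>. set_borel_measurable lebesgue {-1<..<1} \<phi> \<and>
            set_integrable lebesgue {-1<..<1} (\<lambda>x. sqrt (1 - x\<^sup>2) * \<bar>\<phi> x\<bar>\<^sup>2)}"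

definition X1_vec :: "(real \<Rightarrow> real ^ 'n) set" where
  "X1_vec = {\<phi>. \<forall>i. (\<lambda>t. \<phi> t $ i) \<in> X1}"

text \<open>For \<open>\<phi> \<in> X1\<close> and \<open>-1 \<le> s \<le> 1\<close> the integrand is Lebesgue integrable.\<close>

definition log_op :: "real \<Rightarrow> (real \<Rightarrow> real) \<Rightarrow> real \<Rightarrow> real" where
  "log_op \<delta> \<phi> s = (LINT t:{-1<..<1}|lebesgue. ln \<bar>\<delta> + s - t\<bar> * \<phi> t)"

definition log_matrix_op ::
    "real ^ 'n ^ 'n \<Rightarrow> (real \<Rightarrow> real ^ 'n) \<Rightarrow> real \<Rightarrow> real ^ 'n" where
  "log_matrix_op d \<phi> =
     (\<lambda>s\<in>{-1..1}. \<chi> i. \<Sum>j\<in>UNIV. log_op (d $ i $ j) (\<lambda>t. \<phi> t $ j) s)"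

text \<open>The preimage picked by \<^const>\<open>inv_into\<close> is unique only up to a null set, so its integral
  does not depend on the choice.\<close>

definition log_alpha :: "real ^ 'n ^ 'n \<Rightarrow> real ^ 'n" where
  "log_alpha d =
     (LINT t:{-1<..<1}|lebesgue.
        inv_into X1_vec (log_matrix_op d) (\<lambda>s\<in>{-1..1}. \<chi> i. 1) t)"

end

theory Submission
  imports Defs "HOL-Complex_Analysis.Complex_Analysis"
begin

text \<open>Put \<open>E = \<Union>\<^sub>i [p\<^sub>i - 1, p\<^sub>i + 1]\<close> with \<open>p\<^sub>i - p\<^sub>j = d\<^sub>i\<^sub>j\<close>. The system \<open>A \<psi> = 1\<close> asks for a density on \<open>E\<close> whose
  logarithmic potential is \<open>1\<close> on \<open>E\<close>. Candidates are the boundary values of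
  \<open>q(z) / \<Prod>\<^sub>j sqrt ((z - p\<^sub>j)\<^sup>2 - 1)\<close> with \<open>q\<close> of degree less than \<open>n\<close>: by Cauchy's theorem their potentials are
  constant on each interval. If all these constants agree, \<open>q\<close> has a zero in every gap, so the density
  has one sign, and a comparison with the Green function of the complement of two of the intervals
  (of the single interval if \<open>n = 1\<close>) shows that the constant is not \<open>0\<close>. Hence the linear map from \<open>q\<close>
  to the \<open>n\<close> constants is injective, thus bijective. As \<open>A\<close> is symmetric, \<open>\<Sum>\<^sub>i \<alpha>\<^sub>i\<close> is the total mass \<open>M\<close> of
  this particular solution.

  On the disk, the logarithmic potential \<open>P\<close> of \<open>\<psi> / M\<close> carried by the arcs has normal derivative \<open>1/2\<close>
  on the rest of the circle, so \<open>u - (1 - \<bar>x\<bar>\<^sup>2) / 4 - P\<close> is harmonic with vanishing normal derivative there. On the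
  arcs it equals \<open>- ln \<epsilon> - 1 / M + O(\<epsilon>)\<close>, because chords and arc lengths agree up to a factor \<open>1 + O(\<epsilon>\<^sup>2)\<close>, and a minimum
  principle extends this to the disk. Away from the arcs \<open>P\<close> is within \<open>O(\<epsilon>)\<close> of
  \<open>ln \<bar>x - x(s\<^sub>i)\<bar>\<close> for every \<open>i\<close>, hence of their mean.\<close>


section \<open>Integrable singularities\<close>

text \<open>It is phrased with second difference quotients instead of the Laplacian: potentials
  satisfy it by a uniform remainder estimate, without differentiation under the integral. Two
  exponents run through everything: logarithms are dominated by the power -1/4, densities by the
  power -1/2, and 1/4 + 1/2 < 1 keeps products integrable. The set \<open>E\<close> is put on the
  imaginary axis because one half plane then suffices: the boundary values of the algebraic function
  are real on \<open>E\<close> and imaginary off it, and integrals of the imaginary part are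
  differences of the potential divided by pi. The constant cannot vanish for a capacity reason: one
  interval of length 2 has logarithmic capacity 1/2, two touching ones would have capacity exactly
  1, and the separation of more than 2 between centres pushes it above 1.\<close>

lemma powr_quarter_power:
  fixes x :: real
  shows "(x powr (1/4)) ^ 3 = x powr (3/4)" "(x powr (-1/4)) ^ 3 = x powr (-3/4)"
    "(x powr (-1/4))\<^sup>2 = x powr (-1/2)"
  by (cases "x = 0"; simp add: powr_power)+

text \<open>In HOL \<open>root 4\<close> is continued to negative arguments as an odd function, so
  \<open>4 * root 4 (t - a)\<close> is a single antiderivative, continuous across the
  singularity.\<close>

lemma sing_has_integral:
  fixes a u v :: real
  assumes "u \<le> v"
  shows "((\<lambda>t. \<bar>t - a\<bar> powr (-3/4)) has_integral (4 * root 4 (v - a) - 4 * root 4 (u - a))) {u..v}"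
proof (rule fundamental_theorem_of_calculus_interior_strong[where S = "{a}"])
  show "finite {a}" "u \<le> v" using assms by auto
  show "continuous_on {u..v} (\<lambda>t. 4 * root 4 (t - a))" by (intro continuous_intros)
next
  fix x assume x: "x \<in> {u<..<v} - {a}"
  have e: "inverse (\<bar>root 4 (x - a)\<bar> ^ 3) = \<bar>x - a\<bar> powr (-3/4)"
  proof -
    have "\<bar>root 4 (x - a)\<bar> = \<bar>x - a\<bar> powr (1/4)"
      using x by (simp add: real_root_abs[symmetric] root_powr_inverse)
    then have "\<bar>root 4 (x - a)\<bar> ^ 3 = \<bar>x - a\<bar> powr (3/4)"
      by (simp only: powr_quarter_power)
    then show ?thesis by (simp add: powr_minus)
  qed
  have "((root 4) has_real_derivative (1/4) * inverse (\<bar>root 4 (x - a)\<bar> ^ 3)) (at (x - a))"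
  proof (cases "x > a")
    case True
    then have "root 4 (x - a) > 0" by simp
    with True DERIV_real_root[of 4 "x - a"] show ?thesis by simp
  next
    case False
    then have "x - a < 0" using x by auto
    moreover from this have "root 4 (x - a) < 0" by simp
    ultimately show ?thesis using DERIV_even_real_root[of 4 "x - a"] by simp
  qed
  then have "((\<lambda>t. root 4 (t - a)) has_real_derivative (1/4) * inverse (\<bar>root 4 (x - a)\<bar> ^ 3) * 1) (at x)"
    by (rule DERIV_chain2[where f = "root 4" and g = "\<lambda>t. t - a"]) (auto intro!: derivative_eq_intros)
  from DERIV_cmult[OF this, of 4]
  show "((\<lambda>t. 4 * root 4 (t - a)) has_vector_derivative \<bar>x - a\<bar> powr (-3/4)) (at x)"
    unfolding e has_real_derivative_iff_has_vector_derivative by simp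
qed

lemma sing_integrable:
  fixes a u v :: real
  shows "(\<lambda>t. \<bar>t - a\<bar> powr (-3/4)) absolutely_integrable_on {u..v}"
proof (cases "u \<le> v")
  case True
  then show ?thesis
    by (intro nonnegative_absolutely_integrable_1) (use sing_has_integral in blast, auto)
qed (auto simp: absolutely_integrable_on_def)

lemma abs_root_4_le: "\<bar>root 4 (y::real)\<bar> \<le> 1 + \<bar>y\<bar>"
proof -
  have "root 4 \<bar>y\<bar> \<le> root 4 ((1 + \<bar>y\<bar>) ^ 4)"
    using self_le_power[of "1 + \<bar>y\<bar>" 4] by (subst real_root_le_iff) auto
  also have "\<dots> = 1 + \<bar>y\<bar>" by (subst real_root_power_cancel) auto
  finally show ?thesis by (simp add: real_root_abs)
qed

lemma sing_integral_le:
  fixes a B :: real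
  assumes "\<bar>a\<bar> \<le> B"
  shows "integral {-1..1} (\<lambda>t. \<bar>t - a\<bar> powr (-3/4)) \<le> 16 + 8 * B"
proof -
  have "integral {-1..1} (\<lambda>t. \<bar>t - a\<bar> powr (-3/4)) = 4 * root 4 (1 - a) - 4 * root 4 (-1 - a)"
    using sing_has_integral[of "-1" 1 a] by (simp add: integral_unique)
  also have "\<dots> \<le> 4 * (1 + \<bar>1 - a\<bar>) + 4 * (1 + \<bar>-1 - a\<bar>)"
    using abs_le_D1[OF abs_root_4_le[of "1 - a"]] abs_le_D2[OF abs_root_4_le[of "-1 - a"]]
    by (simp only: mult_left_mono distrib_left) argo
  also have "\<dots> \<le> 16 + 8 * B" using assms by (auto simp: abs_if split: if_splits)
  finally show ?thesis .
qed

lemma mult_power2_le_power3: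
  fixes u v :: real
  assumes "0 \<le> u" "0 \<le> v"
  shows "u * v\<^sup>2 \<le> u ^ 3 + v ^ 3"
proof (cases "u \<le> v")
  case True
  then have "u * v\<^sup>2 \<le> v * v\<^sup>2" by (intro mult_right_mono) auto
  moreover have "0 \<le> u ^ 3" using assms by simp
  ultimately show ?thesis by (simp add: power3_eq_cube power2_eq_square)
next
  case False
  then have "u * v\<^sup>2 \<le> u * u\<^sup>2" using assms by (intro mult_left_mono power_mono) auto
  moreover have "0 \<le> v ^ 3" using assms by simp
  ultimately show ?thesis by (simp add: power3_eq_cube power2_eq_square)
qed

text \<open>Applied to \<open>x powr (-1/4)\<close> and \<open>y powr (-1/4)\<close>, the cubic
  inequality takes the place of Hoelder's: a product of two singularities becomes a sum of single
  ones of order 3/4, integrable even when both sit at the same point.\<close>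

lemma powr_quarter_half_le:
  fixes x y :: real
  assumes "0 \<le> x" "0 \<le> y"
  shows "x powr (-1/4) * y powr (-1/2) \<le> x powr (-3/4) + y powr (-3/4)"
proof -
  have "x powr (-1/4) * (y powr (-1/4))\<^sup>2 \<le> (x powr (-1/4)) ^ 3 + (y powr (-1/4)) ^ 3"
    by (rule mult_power2_le_power3) auto
  then show ?thesis unfolding powr_quarter_power .
qed

text \<open>The factor \<open>1 - t\<^sup>2\<close> is at least the distance from \<open>t\<close>
  to the nearer endpoint, so the weight can be split off like any other singularity.\<close>

lemma weighted_sing_le:
  fixes t a :: real
  assumes "\<bar>t\<bar> < 1"
  shows "\<bar>t - a\<bar> powr (-1/4) / sqrt (1 - t\<^sup>2)
    \<le> \<bar>t - a\<bar> powr (-3/4) + \<bar>t - 1\<bar> powr (-3/4) + \<bar>t - (-1)\<bar> powr (-3/4)"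
proof -
  let ?w = "1 - t\<^sup>2"
  have w: "?w > 0" using assms by (simp add: abs_square_less_1)
  have s: "1 / sqrt ?w = ?w powr (-1/2)"
    using w by (simp add: powr_half_sqrt[symmetric] powr_minus_divide)
  have "?w powr (-3/4) \<le> \<bar>t - 1\<bar> powr (-3/4) + \<bar>t - (-1)\<bar> powr (-3/4)"
  proof (cases "t \<ge> 0")
    case True
    have "?w \<ge> \<bar>t - 1\<bar>" using True assms mult_left_mono[of t 1 t] by (simp add: power2_eq_square)
    then have "?w powr (-3/4) \<le> \<bar>t - 1\<bar> powr (-3/4)"
      using assms by (intro powr_mono2') auto
    then show ?thesis by (smt (verit) powr_ge_zero)
  next
    case False
    have "?w \<ge> \<bar>t - (-1)\<bar>" using False assms mult_left_mono[of "-t" 1 "-t"]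
      by (simp add: power2_eq_square)
    then have "?w powr (-3/4) \<le> \<bar>t - (-1)\<bar> powr (-3/4)"
      using assms by (intro powr_mono2') auto
    then show ?thesis by (smt (verit) powr_ge_zero)
  qed
  moreover have "\<bar>t - a\<bar> powr (-1/4) * ?w powr (-1/2) \<le> \<bar>t - a\<bar> powr (-3/4) + ?w powr (-3/4)"
    using w by (intro powr_quarter_half_le) auto
  moreover have "\<bar>t - a\<bar> powr (-1/4) / sqrt ?w = \<bar>t - a\<bar> powr (-1/4) * ?w powr (-1/2)"
    unfolding s[symmetric] by simp
  ultimately show ?thesis by linarith
qed

text \<open>The model is the arcsine law, the equilibrium density of one interval, which blows up
  exactly like this at the ends. The explicit densities constructed below all belong to this
  class.\<close>

definition arcsine_bounded :: "real \<Rightarrow> (real \<Rightarrow> real) \<Rightarrow> bool" where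
  "arcsine_bounded C \<psi> \<longleftrightarrow> \<psi> \<in> borel_measurable (lebesgue_on {-1<..<1}) \<and> 0 \<le> C \<and>
     (\<forall>t\<in>{-1<..<1}. \<bar>\<psi> t\<bar> \<le> C / sqrt (1 - t\<^sup>2))"

text \<open>A finite set \<open>N\<close> is excluded because \<open>0 powr (-1/4) = 0\<close>, so
  the bound on \<open>k\<close> may fail at the singularity itself. The constant
  \<open>64 + 8 * B\<close> adds the bounds \<open>16 + 8 * B\<close>, 24 and 24 for the
  singularities at \<open>a\<close>, 1 and -1.\<close>

lemma arcsine_weighted:
  fixes k \<psi> :: "real \<Rightarrow> real"
  assumes \<psi>: "arcsine_bounded C \<psi>"
    and k: "k \<in> borel_measurable (lebesgue_on {-1<..<1})"
    and bd: "\<And>t. t \<in> {-1<..<1} - N \<Longrightarrow> \<bar>k t\<bar> \<le> K * \<bar>t - a\<bar> powr (-1/4)"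
    and N: "finite N" and aB: "\<bar>a\<bar> \<le> B" and K: "0 \<le> K"
  shows "(\<lambda>t. k t * \<psi> t) absolutely_integrable_on {-1<..<1}" (is ?int)
    and "(LINT t:{-1<..<1}|lebesgue. \<bar>k t * \<psi> t\<bar>) \<le> K * C * (64 + 8 * B)" (is ?le)
proof -
  let ?I = "{-1<..<1::real}"
  define g where "g t = K * C * (\<bar>t - a\<bar> powr (-3/4) + \<bar>t - 1\<bar> powr (-3/4) + \<bar>t - (-1)\<bar> powr (-3/4))"
    for t :: real
  have C: "0 \<le> C" using \<psi> by (simp add: arcsine_bounded_def)
  have gI: "g absolutely_integrable_on {-1..1}"
    unfolding g_def by (intro set_integrable_mult_right set_integral_add sing_integrable)
  have gI': "g absolutely_integrable_on ?I"
    using gI by (rule set_integrable_subset) auto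
  have le: "\<bar>k t * \<psi> t\<bar> \<le> g t" if "t \<in> ?I - N" for t
  proof -
    have "\<bar>k t * \<psi> t\<bar> \<le> (K * \<bar>t - a\<bar> powr (-1/4)) * (C / sqrt (1 - t\<^sup>2))"
      unfolding abs_mult using bd[OF that] \<psi> that K
      by (intro mult_mono) (auto simp: arcsine_bounded_def)
    also have "\<dots> = K * C * (\<bar>t - a\<bar> powr (-1/4) / sqrt (1 - t\<^sup>2))" by simp
    also have "\<dots> \<le> g t" unfolding g_def
      using that K C by (intro mult_left_mono weighted_sing_le) auto
    finally show ?thesis .
  qed
  have m: "(\<lambda>t. k t * \<psi> t) \<in> borel_measurable (lebesgue_on ?I)"
    using \<psi> k by (auto simp: arcsine_bounded_def)
  have Nn: "negligible N" using N by (simp add: negligible_finite)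
  have NL: "?I - N \<in> sets lebesgue"
    by (intro sets.Diff) (use N in \<open>auto intro!: lmeasurable_compact fmeasurableD finite_imp_compact\<close>)
  have "(\<lambda>t. k t * \<psi> t) absolutely_integrable_on (?I - N)"
  proof (rule measurable_bounded_by_integrable_imp_absolutely_integrable[OF _ NL])
    show "(\<lambda>t. k t * \<psi> t) \<in> borel_measurable (lebesgue_on (?I - N))"
      using m by (rule measurable_restrict_mono) auto
    show "g integrable_on ?I - N"
      by (rule integrable_spike_set[OF set_lebesgue_integral_eq_integral(1)[OF gI']])
        (auto intro!: negligible_subset[OF Nn])
  qed (use le in auto)
  then show i: ?int
    by (rule absolutely_integrable_spike_set) (auto intro!: negligible_subset[OF Nn])
  have "(LINT t:?I|lebesgue. \<bar>k t * \<psi> t\<bar>) = integral ?I (\<lambda>t. \<bar>k t * \<psi> t\<bar>)"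
    by (rule set_lebesgue_integral_eq_integral(2)[OF set_integrable_abs[OF i]])
  also have "\<dots> = integral ?I (\<lambda>t. if t \<in> N then 0 else \<bar>k t * \<psi> t\<bar>)"
    by (rule integral_spike[OF Nn]) auto
  also have "\<dots> \<le> integral ?I g"
  proof (rule integral_le)
    show "(\<lambda>t. if t \<in> N then 0 else \<bar>k t * \<psi> t\<bar>) integrable_on ?I"
      by (rule integrable_spike[OF set_lebesgue_integral_eq_integral(1)[OF set_integrable_abs[OF i]] Nn]) auto
    show "g integrable_on ?I" using gI' by (rule set_lebesgue_integral_eq_integral(1))
    show "(if t \<in> N then 0 else \<bar>k t * \<psi> t\<bar>) \<le> g t" if "t \<in> ?I" for t
      using le[of t] that K C by (auto simp: g_def)
  qed
  also have "\<dots> = integral {-1..1} g" by (simp add: integral_open_interval_real)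
  also have "\<dots> = K * C * (integral {-1..1} (\<lambda>t. \<bar>t - a\<bar> powr (-3/4))
      + integral {-1..1} (\<lambda>t. \<bar>t - 1\<bar> powr (-3/4)) + integral {-1..1} (\<lambda>t. \<bar>t - (-1)\<bar> powr (-3/4)))"
    using sing_integrable[THEN set_lebesgue_integral_eq_integral(1)]
    unfolding g_def by (simp add: integral_add integrable_add del: diff_minus_eq_add)
  also have "\<dots> \<le> K * C * ((16 + 8 * B) + (16 + 8 * 1) + (16 + 8 * 1))"
    by (intro mult_left_mono add_mono sing_integral_le) (use K C aB in auto)
  finally show ?le by (simp add: algebra_simps)
qed

text \<open>Up to 1, \<open>ln y \<le> y\<close> at \<open>y = r powr (-1/4)\<close> yields the
  factor 4. Beyond 1 the logarithm is at most \<open>B\<close>, and \<open>B\<^sup>2\<close>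
  compensates the decay of the power on \<open>r \<le> B\<close>.\<close>

lemma abs_ln_le_powr:
  fixes r B :: real
  assumes "0 < r" "r \<le> B" "1 \<le> B"
  shows "\<bar>ln r\<bar> \<le> (4 + B\<^sup>2) * r powr (-1/4)"
proof (cases "r \<le> 1")
  case True
  have "- ln r = 4 * ln (r powr (-1/4))" using assms by (simp add: ln_powr)
  also have "\<dots> \<le> 4 * (r powr (-1/4))"
    using ln_le_minus_one[of "r powr (-1/4)"] assms by simp
  also have "\<dots> \<le> (4 + B\<^sup>2) * r powr (-1/4)" by (intro mult_right_mono) auto
  finally show ?thesis using True assms by simp
next
  case False
  have "B powr (-1) \<le> B powr (-1/4)" using assms by (intro powr_mono) auto
  also have "\<dots> \<le> r powr (-1/4)" using assms by (intro powr_mono2') auto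
  finally have "B\<^sup>2 * B powr (-1) \<le> B\<^sup>2 * r powr (-1/4)" by (rule mult_left_mono) simp
  then have "B \<le> B\<^sup>2 * r powr (-1/4)" using assms by (simp add: powr_minus power2_eq_square)
  moreover have "ln r \<le> B" using ln_le_minus_one[of r] assms by simp
  moreover have "0 \<le> 4 * r powr (-1/4)" by simp
  moreover have "\<bar>ln r\<bar> = ln r" using False by simp
  ultimately show ?thesis unfolding distrib_right by linarith
qed

section \<open>A minimum principle for the mixed problem\<close>

text \<open>The five-point difference behind the discrete Laplacian, left undivided. Its quotient by
  \<open>t\<^sup>2\<close> tends to the Laplacian of a C2 function, it can be estimated directly for
  functions given by integrals, and it is nonnegative at a minimum.\<close>

definition cross_diff :: "(real \<times> real \<Rightarrow> real) \<Rightarrow> real \<times> real \<Rightarrow> real \<Rightarrow> real" where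
  "cross_diff w x t = w (x + t *\<^sub>R (1, 0)) + w (x - t *\<^sub>R (1, 0))
     + w (x + t *\<^sub>R (0, 1)) + w (x - t *\<^sub>R (0, 1)) - 4 * w x"

lemma cross_diff_add: "cross_diff (\<lambda>x. f x + g x) x t = cross_diff f x t + cross_diff g x t"
  by (simp add: cross_diff_def algebra_simps)

lemma cross_diff_diff: "cross_diff (\<lambda>x. f x - g x) x t = cross_diff f x t - cross_diff g x t"
  by (simp add: cross_diff_def algebra_simps)

lemma cross_diff_cmult: "cross_diff (\<lambda>x. c * f x) x t = c * cross_diff f x t"
  by (simp add: cross_diff_def algebra_simps)

lemma norm_Pair_power2: "(norm (a, b))\<^sup>2 = a\<^sup>2 + b\<^sup>2" for a b :: real
  by (simp add: norm_Pair)

lemma cross_diff_norm_power2: "cross_diff (\<lambda>x. (norm x)\<^sup>2) x t = 4 * t\<^sup>2"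
proof (cases x)
  case (Pair a b)
  have "cross_diff (\<lambda>x. (norm x)\<^sup>2) x t = ((a + t)\<^sup>2 + b\<^sup>2) + ((a - t)\<^sup>2 + b\<^sup>2) + (a\<^sup>2 + (b + t)\<^sup>2)
      + (a\<^sup>2 + (b - t)\<^sup>2) - 4 * (a\<^sup>2 + b\<^sup>2)"
    unfolding Pair cross_diff_def norm_Pair_power2[symmetric] by simp
  then show ?thesis by (simp add: power2_eq_square algebra_simps)
qed

lemma ln_norm: "ln (norm z) = ln ((norm z)\<^sup>2) / 2"
  by (cases "norm z = 0") (auto simp: ln_realpow)

text \<open>With \<open>\<zeta> = a + b i\<close> the product of the four translated factors is \<open>\<bar>\<zeta>\<^sup>4 - t\<^sup>4\<bar>\<^sup>2\<close>, so the terms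
  of order below \<open>t\<^sup>4\<close> cancel.\<close>

lemma cross_ln_bound:
  fixes a b t q :: real
  assumes q: "q = a\<^sup>2 + b\<^sup>2" "0 < q" and t: "3 * t\<^sup>2 \<le> q"
  shows "\<bar>ln ((a + t)\<^sup>2 + b\<^sup>2) + ln ((a - t)\<^sup>2 + b\<^sup>2) + ln (a\<^sup>2 + (b + t)\<^sup>2) + ln (a\<^sup>2 + (b - t)\<^sup>2) - 4 * ln q\<bar>
    \<le> 6 * t ^ 4 / q\<^sup>2"
proof -
  let ?T = "t\<^sup>2"
  let ?P1 = "(a + t)\<^sup>2 + b\<^sup>2" and ?P2 = "(a - t)\<^sup>2 + b\<^sup>2"
  let ?P3 = "a\<^sup>2 + (b + t)\<^sup>2" and ?P4 = "a\<^sup>2 + (b - t)\<^sup>2"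
  \<comment> \<open>Here \<open>\<bar>\<zeta>\<^sup>4 - t\<^sup>4\<bar>\<^sup>2 = q\<^sup>4 +
    E\<close>, since the real part of \<open>\<zeta>\<^sup>4\<close> is
    \<open>q\<^sup>2 - 8 * a\<^sup>2 * b\<^sup>2\<close>.\<close>
  define E where "E = ?T ^ 4 - 2 * ?T\<^sup>2 * (q\<^sup>2 - 8 * a\<^sup>2 * b\<^sup>2)"
  define z where "z = t ^ 4 / q\<^sup>2"
  define D where "D = E / q ^ 4"
  have P: "?P1 * ?P2 * ?P3 * ?P4 = q ^ 4 + E"
    unfolding E_def q by (simp add: power2_eq_square power4_eq_xxxx algebra_simps)
  \<comment> \<open>The hypothesis \<open>3 * t\<^sup>2 \<le> q\<close> enters here; with
    \<open>\<bar>D\<bar> \<le> 3 * z\<close> it keeps \<open>D\<close> within 1/2, the range of the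
    bound for \<open>ln (1 + D)\<close>.\<close>
  have z: "0 \<le> z" "z \<le> 1/9"
  proof -
    have "(3 * ?T)\<^sup>2 \<le> q\<^sup>2" using t by (intro power_mono) auto
    then have "9 * t ^ 4 \<le> q\<^sup>2" by (simp add: power2_eq_square power4_eq_xxxx)
    moreover have "0 < q\<^sup>2" using q(2) by simp
    ultimately show "z \<le> 1/9" unfolding z_def by (simp add: pos_divide_le_eq)
  qed (simp add: z_def)
  have ab: "\<bar>q\<^sup>2 - 8 * a\<^sup>2 * b\<^sup>2\<bar> \<le> q\<^sup>2"
  proof -
    have "0 \<le> (a\<^sup>2 - b\<^sup>2)\<^sup>2" by simp
    then have "4 * a\<^sup>2 * b\<^sup>2 \<le> q\<^sup>2" unfolding q by (simp add: power2_eq_square algebra_simps)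
    moreover have "0 \<le> a\<^sup>2 * b\<^sup>2" by simp
    ultimately show ?thesis by linarith
  qed
  have "\<bar>E\<bar> \<le> ?T ^ 4 + 2 * ?T\<^sup>2 * q\<^sup>2"
  proof -
    have "\<bar>E\<bar> \<le> \<bar>?T ^ 4\<bar> + \<bar>2 * ?T\<^sup>2 * (q\<^sup>2 - 8 * a\<^sup>2 * b\<^sup>2)\<bar>" unfolding E_def by (rule abs_triangle_ineq4)
    also have "\<dots> \<le> ?T ^ 4 + 2 * ?T\<^sup>2 * q\<^sup>2" using ab by (auto simp: abs_mult intro!: mult_left_mono)
    finally show ?thesis .
  qed
  then have "\<bar>D\<bar> \<le> (?T ^ 4 + 2 * ?T\<^sup>2 * q\<^sup>2) / q ^ 4"
    using q unfolding D_def by (simp add: abs_divide divide_right_mono)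
  also have "\<dots> = z\<^sup>2 + 2 * z"
    using q(2) unfolding z_def by (simp add: field_simps power2_eq_square power4_eq_xxxx)
  also have "\<dots> \<le> 3 * z" using z mult_left_mono[of z 1 z] by (simp add: power2_eq_square)
  finally have D: "\<bar>D\<bar> \<le> 3 * z" .
  then have D2: "\<bar>D\<bar> \<le> 1/2" using z by linarith
  have PD: "?P1 * ?P2 * ?P3 * ?P4 = q ^ 4 * (1 + D)" using P q(2) by (simp add: D_def field_simps)
  then have "?P1 * ?P2 * ?P3 * ?P4 > 0" using D2 q(2) by (simp add: abs_if split: if_splits)
  then have nz: "?P1 \<noteq> 0" "?P2 \<noteq> 0" "?P3 \<noteq> 0" "?P4 \<noteq> 0" by (metis mult_zero_left mult_zero_right less_irrefl)+
  have pos: "?P1 > 0" "?P2 > 0" "?P3 > 0" "?P4 > 0"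
    using nz by (metis add_nonneg_nonneg less_eq_real_def zero_le_power2)+
  have "ln ?P1 + ln ?P2 + ln ?P3 + ln ?P4 = ln (?P1 * ?P2 * ?P3 * ?P4)"
    using pos by (simp add: ln_mult_pos)
  also have "\<dots> = 4 * ln q + ln (1 + D)"
    unfolding PD using q(2) D2 by (subst ln_mult_pos) (auto simp: ln_realpow abs_if split: if_splits)
  finally have "\<bar>ln ?P1 + ln ?P2 + ln ?P3 + ln ?P4 - 4 * ln q\<bar> = \<bar>ln (1 + D)\<bar>" by simp
  also have "\<dots> \<le> 2 * \<bar>D\<bar>"
  proof -
    have "\<bar>ln (1 + D) - D\<bar> \<le> 2 * D\<^sup>2" using D2 by (rule abs_ln_one_plus_x_minus_x_bound)
    moreover have "2 * D\<^sup>2 \<le> \<bar>D\<bar>"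
      using D2 mult_left_mono[of "\<bar>D\<bar>" "1/2" "\<bar>D\<bar>"] by (simp add: power2_eq_square)
    ultimately show ?thesis by linarith
  qed
  also have "\<dots> \<le> 6 * t ^ 4 / q\<^sup>2" using D by (simp add: z_def)
  finally show ?thesis .
qed

lemma cross_diff_ln_bound:
  fixes x y :: "real \<times> real"
  assumes "x \<noteq> y" "3 * t\<^sup>2 \<le> (norm (x - y))\<^sup>2"
  shows "\<bar>cross_diff (\<lambda>x. ln (norm (x - y))) x t\<bar> \<le> 3 * t ^ 4 / (norm (x - y)) ^ 4"
proof -
  obtain a b where ab: "x - y = (a, b)" by (cases "x - y")
  define q where "q = a\<^sup>2 + b\<^sup>2"
  have q: "(norm (x - y))\<^sup>2 = q" by (simp add: ab norm_Pair q_def)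
  have q0: "q > 0" using assms(1) q by (metis norm_eq_zero right_minus_eq zero_less_power2)
  have sh: "x + u - y = (x - y) + u" "x - u - y = (x - y) - u" for u :: "real \<times> real"
    by (auto simp: algebra_simps)
  have "cross_diff (\<lambda>x. ln (norm (x - y))) x t =
    (ln ((a + t)\<^sup>2 + b\<^sup>2) + ln ((a - t)\<^sup>2 + b\<^sup>2) + ln (a\<^sup>2 + (b + t)\<^sup>2) + ln (a\<^sup>2 + (b - t)\<^sup>2) - 4 * ln q) / 2"
    unfolding cross_diff_def ln_norm sh ab by (simp add: norm_Pair q_def)
  moreover have "\<bar>ln ((a + t)\<^sup>2 + b\<^sup>2) + ln ((a - t)\<^sup>2 + b\<^sup>2) + ln (a\<^sup>2 + (b + t)\<^sup>2)
      + ln (a\<^sup>2 + (b - t)\<^sup>2) - 4 * ln q\<bar> \<le> 6 * t ^ 4 / q\<^sup>2"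
    by (rule cross_ln_bound) (use q q0 assms q_def in auto)
  moreover have "(norm (x - y)) ^ 4 = q\<^sup>2" unfolding q[symmetric] by (simp add: power_mult[symmetric])
  ultimately show ?thesis by simp
qed

lemma cross_diff_ln_tendsto:
  fixes x y :: "real \<times> real"
  assumes "x \<noteq> y"
  shows "((\<lambda>t. cross_diff (\<lambda>x. ln (norm (x - y))) x t / t\<^sup>2) \<longlongrightarrow> 0) (at_right 0)"
proof (rule Lim_null_comparison)
  let ?r = "norm (x - y)"
  have r: "?r > 0" using assms by simp
  have ev: "\<forall>\<^sub>F t in at_right 0. t < ?r / 2" by (rule eventually_at_rightI[of 0 "?r/2"]) (use r in auto)
  show "\<forall>\<^sub>F t in at_right 0. norm (cross_diff (\<lambda>x. ln (norm (x - y))) x t / t\<^sup>2) \<le> 3 * t\<^sup>2 / ?r ^ 4"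
    using ev eventually_at_right_less[of "0::real"]
  proof eventually_elim
    case (elim t)
    have "(2 * t)\<^sup>2 \<le> ?r\<^sup>2" using elim by (intro power_mono) auto
    then have "3 * t\<^sup>2 \<le> ?r\<^sup>2" by (simp add: power_mult_distrib) (smt (verit) zero_le_power2)
    from cross_diff_ln_bound[OF assms this]
    have "\<bar>cross_diff (\<lambda>x. ln (norm (x - y))) x t\<bar> / t\<^sup>2 \<le> (3 * t ^ 4 / ?r ^ 4) / t\<^sup>2"
      by (rule divide_right_mono) simp
    also have "\<dots> = 3 * t\<^sup>2 / ?r ^ 4" using elim by (simp add: power2_eq_square power4_eq_xxxx field_simps)
    finally show ?case by simp
  qed
  have "((\<lambda>t::real. 3 * t\<^sup>2 / ?r ^ 4) \<longlongrightarrow> 3 * 0\<^sup>2 / ?r ^ 4) (at_right 0)" using r by (intro tendsto_intros) auto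
  then show "((\<lambda>t::real. 3 * t\<^sup>2 / ?r ^ 4) \<longlongrightarrow> 0) (at_right 0)" by simp
qed

section \<open>Normal derivatives on the unit circle\<close>

lemma inner_diff_self_sphere:
  fixes x y :: "'a::real_inner"
  assumes "norm x = 1"
  shows "2 * ((x - y) \<bullet> x) = (norm (x - y))\<^sup>2 + 1 - (norm y)\<^sup>2"
proof -
  have "x \<bullet> x = 1" using assms by (simp add: dot_square_norm)
  then show ?thesis unfolding power2_norm_eq_inner
    by (simp add: inner_diff_left inner_diff_right inner_commute)
qed

text \<open>For \<open>norm y = 1\<close> the value is 1/2 whatever \<open>x\<close> and
  \<open>y\<close> are: a unit charge on the circle has constant normal derivative off its support.
  A pole slightly outside the disk keeps the value close to 1/2 and serves as a barrier.\<close>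

lemma has_normal_derivative_ln:
  fixes x y :: "'a::real_inner"
  assumes x: "norm x = 1" and "x \<noteq> y"
  shows "has_normal_derivative (\<lambda>x. ln (norm (x - y))) x ((1 + (1 - (norm y)\<^sup>2) / (norm (x - y))\<^sup>2) / 2) x"
proof -
  let ?q = "(norm (x - y))\<^sup>2"
  have q: "?q > 0" using assms by simp
  have e: "ln (norm (x + t *\<^sub>R x - y)) = ln (?q + 2 * t * ((x - y) \<bullet> x) + t\<^sup>2) / 2" for t
  proof -
    have "(norm (x + t *\<^sub>R x - y))\<^sup>2 = (norm ((x - y) + t *\<^sub>R x))\<^sup>2" by (simp add: algebra_simps)
    also have "\<dots> = ?q + 2 * t * ((x - y) \<bullet> x) + t\<^sup>2"
      using x unfolding power2_norm_eq_inner norm_eq_1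
      by (simp add: inner_add_left inner_add_right inner_commute[of x "x - y"] inner_commute[of y x]
          power2_eq_square algebra_simps)
    finally show ?thesis by (subst ln_norm) simp
  qed
  have "((\<lambda>t. ln (?q + 2 * t * ((x - y) \<bullet> x) + t\<^sup>2) / 2) has_real_derivative
      (2 * ((x - y) \<bullet> x) / ?q) / 2) (at 0 within {..<0})"
    using q by (auto intro!: derivative_eq_intros)
  also have "(2 * ((x - y) \<bullet> x) / ?q) / 2 = (1 + (1 - (norm y)\<^sup>2) / ?q) / 2"
    unfolding inner_diff_self_sphere[OF x] using q by (simp add: field_simps)
  finally show ?thesis unfolding has_normal_derivative_def e .
qed

lemma has_normal_derivative_norm_power2:
  fixes x :: "'a::real_inner"
  assumes "norm x = 1"
  shows "has_normal_derivative (\<lambda>x. (norm x)\<^sup>2) x 2 x"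
proof -
  have "(norm (x + t *\<^sub>R x))\<^sup>2 = (1 + t)\<^sup>2" for t
  proof -
    have "x + t *\<^sub>R x = (1 + t) *\<^sub>R x" by (simp add: algebra_simps)
    then show ?thesis using assms by simp
  qed
  then show ?thesis unfolding has_normal_derivative_def
    by (auto intro!: derivative_eq_intros)
qed

lemma has_normal_derivative_add:
  assumes "has_normal_derivative f n D x" "has_normal_derivative g n E x"
  shows "has_normal_derivative (\<lambda>x. f x + g x) n (D + E) x"
  using assms unfolding has_normal_derivative_def by (rule DERIV_add)

lemma has_normal_derivative_diff:
  assumes "has_normal_derivative f n D x" "has_normal_derivative g n E x"
  shows "has_normal_derivative (\<lambda>x. f x - g x) n (D - E) x"
  using assms unfolding has_normal_derivative_def by (rule DERIV_diff)

lemma has_normal_derivative_cmult: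
  assumes "has_normal_derivative f n D x"
  shows "has_normal_derivative (\<lambda>x. c * f x) n (c * D) x"
  using assms unfolding has_normal_derivative_def by (rule DERIV_cmult)

lemma normal_derivative_at_min_le_0:
  fixes f :: "real \<times> real \<Rightarrow> real"
  assumes "has_normal_derivative f x D x" "norm x = 1" "\<And>y. y \<in> cball 0 1 \<Longrightarrow> f x \<le> f y"
  shows "D \<le> 0"
proof -
  have "((\<lambda>t. (f (x + t *\<^sub>R x) - f (x + 0 *\<^sub>R x)) / (t - 0)) \<longlongrightarrow> D) (at 0 within {..<0})"
    using assms(1) unfolding has_normal_derivative_def has_field_derivative_iff .
  then show ?thesis
  proof (rule tendsto_upperbound)
    have "\<forall>\<^sub>F t in at_left (0::real). t \<in> {-1<..<0}" by (rule eventually_at_left_real) simp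
    then show "\<forall>\<^sub>F t in at_left 0. (f (x + t *\<^sub>R x) - f (x + 0 *\<^sub>R x)) / (t - 0) \<le> 0"
    proof eventually_elim
      case (elim t)
      have "x + t *\<^sub>R x = (1 + t) *\<^sub>R x" by (simp add: algebra_simps)
      then have "x + t *\<^sub>R x \<in> cball 0 1" using elim assms(2) by simp
      then have "f x \<le> f (x + t *\<^sub>R x)" by (rule assms(3))
      then show ?case using elim by (auto intro!: divide_nonneg_neg)
    qed
  qed auto
qed

text \<open>The pole of the barrier \<open>ln \<bar>x - (1 + \<eta>) e\<bar> - \<bar>x\<bar>\<^sup>2 / 16\<close> lies just outside the disk, next to an arc
  in \<open>G\<close>. This makes its normal derivative positive off \<open>G\<close>, where on the circle the normal derivative
  of \<open>ln \<bar>x - y\<bar>\<close> tends to \<open>1/2\<close> as \<open>\<bar>y\<bar> \<rightarrow> 1\<close>.\<close>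

lemma disk_minimum_principle:
  fixes w :: "real \<times> real \<Rightarrow> real"
  assumes cont: "continuous_on (cball 0 1) w"
    and harm: "\<And>x. x \<in> ball 0 1 \<Longrightarrow> ((\<lambda>t. cross_diff w x t / t\<^sup>2) \<longlongrightarrow> 0) (at_right 0)"
    and nd: "\<And>x. x \<in> sphere 0 1 - G \<Longrightarrow> has_normal_derivative w x 0 x"
    and arc: "norm e = 1" "r > 0" "\<And>x. x \<in> sphere 0 1 - G \<Longrightarrow> r \<le> norm (x - e)"
    and G: "\<And>x. x \<in> G \<Longrightarrow> m \<le> w x"
    and x: "x \<in> cball 0 1"
  shows "m \<le> w x"
proof -
  define \<rho> where "\<rho> = min r 1"
  have \<rho>: "0 < \<rho>" "\<rho> \<le> 1" "\<rho> \<le> r" using arc by (auto simp: \<rho>_def)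
  \<comment> \<open>Chosen so that \<open>6 * \<eta> = (\<rho> / 2)\<^sup>2\<close>. Then
    \<open>(norm y)\<^sup>2 - 1 \<le> 3 * \<eta>\<close> is at most half of
    \<open>(norm (z - y))\<^sup>2\<close> off \<open>G\<close>, and the logarithm has normal
    derivative at least 1/4 there, more than the 1/8 lost to the quadratic term.\<close>
  define \<eta> where "\<eta> = \<rho>\<^sup>2 / 24"
  have \<rho>2: "\<rho>\<^sup>2 \<le> \<rho>" using \<rho> by (simp add: power2_eq_square mult_left_le)
  have \<eta>: "0 < \<eta>" "\<eta> \<le> \<rho> / 2" "\<eta> \<le> 1" using \<rho> \<rho>2 by (auto simp: \<eta>_def)
  define y where "y = (1 + \<eta>) *\<^sub>R e"
  have ny: "norm y = 1 + \<eta>" using arc(1) \<eta> by (simp add: y_def)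
  have ne: "z \<noteq> y" if "z \<in> cball 0 1" for z using that ny \<eta> by auto
  \<comment> \<open>The quadratic term makes \<open>h\<close> strictly superharmonic: its difference
    quotient tends to -1/4, which excludes an interior minimum of
    \<open>w + \<delta> * h\<close>.\<close>
  define h where "h z = ln (norm (z - y)) - (1/16) * (norm z)\<^sup>2" for z
  have hcont: "continuous_on (cball 0 1) h" unfolding h_def using ne by (intro continuous_intros) auto
  have hcross: "((\<lambda>t. cross_diff h z t / t\<^sup>2) \<longlongrightarrow> - (1/4)) (at_right 0)" if "z \<in> ball 0 1" for z
  proof -
    have "((\<lambda>t. cross_diff (\<lambda>x. ln (norm (x - y))) z t / t\<^sup>2 - 1/4) \<longlongrightarrow> 0 - 1/4) (at_right 0)"
      using ne that by (intro tendsto_diff cross_diff_ln_tendsto tendsto_const) auto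
    moreover have "\<forall>\<^sub>F t in at_right (0::real). cross_diff (\<lambda>x. ln (norm (x - y))) z t / t\<^sup>2 - 1/4
        = cross_diff h z t / t\<^sup>2"
      using eventually_at_right_less[of "0::real"]
    proof eventually_elim
      case (elim t)
      then show ?case unfolding h_def cross_diff_diff cross_diff_cmult cross_diff_norm_power2
        by (simp add: field_simps)
    qed
    ultimately show ?thesis by (simp add: tendsto_cong)
  qed
  have hnd: "\<exists>D>0. has_normal_derivative h z D z" if z: "z \<in> sphere 0 1 - G" for z
  proof -
    let ?D = "(1 + (1 - (norm y)\<^sup>2) / (norm (z - y))\<^sup>2) / 2 - (1/16) * 2"
    have "norm (z - e) \<le> norm (z - y) + norm (y - e)"
      using norm_triangle_ineq[of "z - y" "y - e"] by simp
    moreover have "norm (y - e) = \<eta>" using arc(1) \<eta> by (simp add: y_def algebra_simps)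
    ultimately have "\<rho> / 2 \<le> norm (z - y)" using arc(3)[OF z] \<rho> \<eta> by linarith
    then have "(\<rho> / 2)\<^sup>2 \<le> (norm (z - y))\<^sup>2" using \<rho> by (intro power_mono) auto
    then have 1: "6 * \<eta> \<le> (norm (z - y))\<^sup>2" by (simp add: \<eta>_def power2_eq_square)
    have "(norm y)\<^sup>2 - 1 \<le> 3 * \<eta>" unfolding ny using \<eta> mult_left_mono[of \<eta> 1 \<eta>]
      by (simp add: power2_eq_square algebra_simps)
    then have "(norm y)\<^sup>2 - 1 \<le> (norm (z - y))\<^sup>2 / 2" using 1 by linarith
    moreover have zp: "(norm (z - y))\<^sup>2 > 0" using 1 \<eta> by linarith
    ultimately have "((norm y)\<^sup>2 - 1) / (norm (z - y))\<^sup>2 \<le> 1/2" by (simp add: divide_le_eq)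
    moreover have "(1 - (norm y)\<^sup>2) / (norm (z - y))\<^sup>2 = - (((norm y)\<^sup>2 - 1) / (norm (z - y))\<^sup>2)"
      by (simp add: diff_divide_distrib)
    ultimately have "?D > 0" by argo
    moreover have "has_normal_derivative h z ?D z" unfolding h_def using z ne[of z]
      by (intro has_normal_derivative_diff has_normal_derivative_ln has_normal_derivative_cmult
          has_normal_derivative_norm_power2) auto
    ultimately show ?thesis by blast
  qed
  obtain H where H: "\<And>z. z \<in> cball 0 1 \<Longrightarrow> \<bar>h z\<bar> \<le> H"
  proof -
    have "bounded (h ` cball 0 1)" by (intro compact_imp_bounded compact_continuous_image hcont) auto
    then obtain a where "\<forall>x\<in>cball 0 1. \<bar>h x\<bar> \<le> a" by (auto simp: bounded_iff simp del: mem_cball)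
    then show ?thesis by (intro that) blast
  qed
  \<comment> \<open>The strict inequalities satisfied by \<open>h\<close> force the minimum of
    \<open>w + \<delta> * h\<close> into \<open>G\<close>; the perturbation costs at most
    \<open>\<delta> * (2 * H)\<close>, which disappears as \<open>\<delta>\<close> tends to
    0.\<close>
  have main: "m - \<delta> * (2 * H) \<le> w x" if \<delta>: "\<delta> > 0" for \<delta>
  proof -
    define v where "v z = w z + \<delta> * h z" for z
    have "continuous_on (cball 0 1) v" unfolding v_def by (intro continuous_intros cont hcont)
    then obtain z where z: "z \<in> cball 0 1" and min: "\<And>x. x \<in> cball 0 1 \<Longrightarrow> v z \<le> v x"
      using continuous_attains_inf[of "cball (0::real\<times>real) 1" v] by auto
    have "z \<notin> ball 0 1"
    proof
      assume zb: "z \<in> ball 0 1"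
      have "((\<lambda>t. cross_diff w z t / t\<^sup>2 + \<delta> * (cross_diff h z t / t\<^sup>2)) \<longlongrightarrow> 0 + \<delta> * (- (1/4))) (at_right 0)"
        by (intro tendsto_intros harm hcross zb)
      then have "0 \<le> 0 + \<delta> * (- (1/4))"
      proof (rule tendsto_lowerbound)
        let ?d = "1 - norm z"
        have "\<forall>\<^sub>F t in at_right (0::real). t \<in> {0<..<?d}" by (rule eventually_at_right_real) (use zb in auto)
        then show "\<forall>\<^sub>F t in at_right 0. 0 \<le> cross_diff w z t / t\<^sup>2 + \<delta> * (cross_diff h z t / t\<^sup>2)"
        proof eventually_elim
          case (elim t)
          have "z + u \<in> cball 0 1" if "norm u = t" for u
            using elim that norm_triangle_ineq[of z u] by auto
          from this[of "t *\<^sub>R (1,0)"] this[of "t *\<^sub>R (-1,0)"] this[of "t *\<^sub>R (0,1)"] this[of "t *\<^sub>R (0,-1)"]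
          have "z + t *\<^sub>R (1,0) \<in> cball 0 1" "z - t *\<^sub>R (1,0) \<in> cball 0 1"
            "z + t *\<^sub>R (0,1) \<in> cball 0 1" "z - t *\<^sub>R (0,1) \<in> cball 0 1"
            using elim by (auto simp: norm_Pair minus_prod_def plus_prod_def)
          from this[THEN min] have "0 \<le> cross_diff v z t" unfolding cross_diff_def by linarith
          then have "0 \<le> cross_diff v z t / t\<^sup>2" by simp
          also have "\<dots> = cross_diff w z t / t\<^sup>2 + \<delta> * (cross_diff h z t / t\<^sup>2)"
            unfolding v_def cross_diff_add cross_diff_cmult by (simp add: add_divide_distrib)
          finally show ?case .
        qed
      qed simp
      then show False using \<delta> by simp
    qed
    then have zs: "norm z = 1" using z by auto
    have "z \<in> G"
    proof (rule ccontr)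
      assume "z \<notin> G"
      then have zG: "z \<in> sphere 0 1 - G" using zs by auto
      then obtain D where D: "D > 0" "has_normal_derivative h z D z" using hnd by blast
      have "has_normal_derivative v z (0 + \<delta> * D) z" unfolding v_def
        by (intro has_normal_derivative_add has_normal_derivative_cmult nd zG D)
      from normal_derivative_at_min_le_0[OF this zs min] show False using \<delta> D
        by (simp add: mult_le_0_iff)
    qed
    then have "m \<le> w z" by (rule G)
    moreover have "v z \<le> v x" by (rule min[OF x])
    moreover have "\<delta> * (h x - h z) \<le> \<delta> * (2 * H)" using H[OF x] H[OF z] \<delta> by (intro mult_left_mono) auto
    ultimately show ?thesis unfolding v_def by (simp add: algebra_simps)
  qed
  have "((\<lambda>\<delta>. m - \<delta> * (2 * H)) \<longlongrightarrow> m - 0 * (2 * H)) (at_right 0)" by (intro tendsto_intros)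
  then have "m - 0 * (2 * H) \<le> w x"
    by (rule tendsto_upperbound)
      (use main in \<open>auto intro: eventually_mono[OF eventually_at_right_less[of "0::real"]]\<close>)
  then show ?thesis by simp
qed

section \<open>Cauchy's theorem on the boundary of the right half plane\<close>

text \<open>Cauchy's theorem on a rectangle whose left side is the given segment. The other three
  sides have total length \<open>4 * T\<close> and stay at distance at least \<open>T\<close> from
  0, where \<open>h\<close> is bounded by \<open>C / T\<^sup>2\<close>.\<close>

lemma half_plane_integral_bound:
  assumes h: "h holomorphic_on {z. Re z > 0}"
    and decay: "\<And>z. 0 < Re z \<Longrightarrow> R \<le> norm z \<Longrightarrow> norm (h z) \<le> C / (norm z)\<^sup>2"
    and T: "R \<le> T" "0 < T" and \<eta>: "0 < \<eta>"
  shows "norm (integral {-T..T} (\<lambda>t. h (Complex \<eta> t))) \<le> 4 * C / T"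
proof -
  let ?H = "{z. Re z > 0}"
  define a1 a2 a3 a4 where "a1 = Complex \<eta> (-T)" "a2 = Complex (\<eta> + T) (-T)"
    "a3 = Complex (\<eta> + T) T" "a4 = Complex \<eta> T"
  note a = this
  have cvx: "convex ?H" by (rule convex_halfspace_Re_gt)
  have op: "open ?H" by (rule open_halfspace_Re_gt)
  have aH: "a1 \<in> ?H" "a2 \<in> ?H" "a3 \<in> ?H" "a4 \<in> ?H" using \<eta> T by (auto simp: a)
  have seg: "closed_segment u v \<subseteq> ?H" if "u \<in> ?H" "v \<in> ?H" for u v
    using closed_segment_subset[OF that cvx] .
  have hc: "continuous_on ?H h" using h by (rule holomorphic_on_imp_continuous_on)
  have ci: "h contour_integrable_on linepath u v" if "u \<in> ?H" "v \<in> ?H" for u v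
    using continuous_on_subset[OF hc seg[OF that]] by (rule contour_integrable_continuous_linepath)
  let ?g = "linepath a1 a2 +++ linepath a2 a3 +++ linepath a3 a4 +++ linepath a4 a1"
  have "(h has_contour_integral 0) ?g"
    by (rule Cauchy_theorem_convex_simple[OF h cvx]) (use seg aH in \<open>auto simp: path_image_join\<close>)
  moreover have "contour_integral ?g h = contour_integral (linepath a1 a2) h + (contour_integral (linepath a2 a3) h
     + (contour_integral (linepath a3 a4) h + contour_integral (linepath a4 a1) h))"
    using aH ci by (subst contour_integral_join; (simp add: contour_integrable_joinI)?)+
  ultimately have sum: "contour_integral (linepath a1 a4) h = contour_integral (linepath a1 a2) h
     + contour_integral (linepath a2 a3) h + contour_integral (linepath a3 a4) h"
    using contour_integral_reverse_linepath[OF continuous_on_subset[OF hc seg[OF aH(4,1)]]]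
    by (simp add: contour_integral_unique add_eq_0_iff algebra_simps)
  have C: "0 \<le> C"
  proof -
    have "0 \<le> norm (h (complex_of_real T))" by simp
    also have "\<dots> \<le> C / T\<^sup>2" using decay[of "complex_of_real T"] T by simp
    finally show ?thesis using T by (simp add: zero_le_divide_iff)
  qed
  have bd: "norm (h z) \<le> C / T\<^sup>2" if "0 < Re z" "T \<le> norm z" for z
  proof -
    have "norm (h z) \<le> C / (norm z)\<^sup>2" using decay that T by simp
    also have "\<dots> \<le> C / T\<^sup>2" using that T C by (intro divide_left_mono power_mono mult_pos_pos) auto
    finally show ?thesis .
  qed
  have side: "norm (contour_integral (linepath u v) h) \<le> C / T\<^sup>2 * norm (v - u)"
    if "u \<in> ?H" "v \<in> ?H" and far: "\<And>z. z \<in> closed_segment u v \<Longrightarrow> T \<le> norm z" for u v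
    by (rule has_contour_integral_bound_linepath[OF has_contour_integral_integral[OF ci[OF that(1,2)]]])
       (use bd far seg[OF that(1,2)] C T in auto)
  have far: "T \<le> norm z" if "z \<in> closed_segment a1 a2 \<or> z \<in> closed_segment a2 a3 \<or> z \<in> closed_segment a3 a4" for z
  proof -
    have "Im z = -T \<or> Re z = \<eta> + T \<or> Im z = T"
      using that by (auto simp: in_segment a left_diff_distrib)
    then show ?thesis
      using abs_Re_le_cmod[of z] abs_Im_le_cmod[of z] T \<eta> by auto
  qed
  have n: "norm (a2 - a1) = T" "norm (a3 - a2) = 2 * T" "norm (a4 - a3) = T"
    using T by (auto simp: a cmod_def real_sqrt_mult)
  have "norm (contour_integral (linepath a1 a4) h) \<le> C / T\<^sup>2 * T + C / T\<^sup>2 * (2 * T) + C / T\<^sup>2 * T"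
    unfolding sum using side[of a1 a2] side[of a2 a3] side[of a3 a4] aH far n
    by (intro norm_triangle_mono) auto
  also have "\<dots> = 4 * C / T" using T by (simp add: field_simps power2_eq_square)
  finally have "norm (contour_integral (linepath a1 a4) h) \<le> 4 * C / T" .
  moreover have "contour_integral (linepath a1 a4) h = \<i> * integral {-T..T} (\<lambda>x. h (Complex \<eta> x))"
    by (rule contour_integral_linepath_same_Re) (use T in \<open>auto simp: a\<close>)
  ultimately show ?thesis by (simp add: norm_mult)
qed

text \<open>Since the real part of \<open>h0\<close> vanishes far out, \<open>integral {-T..T} (Re \<circ> h0)\<close> does not depend on \<open>T\<close>,
  so the decay of \<open>h\<close> forces it to be \<open>0\<close>.\<close>

lemma half_plane_boundary_integral:
  fixes h :: "complex \<Rightarrow> complex" and h0 :: "real \<Rightarrow> complex"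
  assumes h: "h holomorphic_on {z. Re z > 0}"
    and decay: "\<And>z. 0 < Re z \<Longrightarrow> R \<le> norm z \<Longrightarrow> norm (h z) \<le> C / (norm z)\<^sup>2"
    and N: "finite N"
    and lim: "\<And>t. t \<notin> N \<Longrightarrow> ((\<lambda>\<eta>. h (Complex \<eta> t)) \<longlongrightarrow> h0 t) (at_right 0)"
    and dom: "\<And>T. 0 < T \<Longrightarrow> g T absolutely_integrable_on {-T..T}"
      "\<And>T \<eta> t. 0 < T \<Longrightarrow> 0 < \<eta> \<Longrightarrow> \<eta> \<le> 1 \<Longrightarrow> \<bar>t\<bar> \<le> T \<Longrightarrow> t \<notin> N \<Longrightarrow> norm (h (Complex \<eta> t)) \<le> g T t"
    and far: "\<And>t. R \<le> \<bar>t\<bar> \<Longrightarrow> Re (h0 t) = 0" and R: "0 < R"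
  shows "((\<lambda>t. Re (h0 t)) has_integral 0) {-R..R}"
proof -
  have Nn: "negligible N" using N by (rule negligible_finite)
  have T: "h0 integrable_on {-T..T}" "norm (integral {-T..T} h0) \<le> 4 * C / T" if T: "R \<le> T" for T
  proof -
    let ?S = "{-T..T} - N"
    have T0: "0 < T" using R T by simp
    have sp: "f integrable_on ?S \<longleftrightarrow> f integrable_on {-T..T}" "integral ?S f = integral {-T..T} f"
      for f :: "real \<Rightarrow> 'x::euclidean_space"
      using Nn by (auto intro!: integrable_spike_set_eq integral_spike_set
          intro: negligible_subset[OF Nn])
    define f where "f k t = h (Complex (inverse (real (Suc k))) t)" for k t
    have 1: "f k integrable_on ?S" for k
    proof -
      have "continuous_on {-T..T} (\<lambda>t. h (Complex (inverse (real (Suc k))) t))"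
        by (rule continuous_on_compose2[OF holomorphic_on_imp_continuous_on[OF h]])
           (auto simp: Complex_eq intro!: continuous_intros)
      then show ?thesis unfolding sp f_def by (rule integrable_continuous_real)
    qed
    have 2: "g T integrable_on ?S" unfolding sp using dom(1)[OF T0] by (rule set_lebesgue_integral_eq_integral(1))
    have 3: "norm (f k t) \<le> g T t" if "t \<in> ?S" for k t
      unfolding f_def using that T0 by (intro dom(2)) (auto simp: inverse_le_1_iff)
    have inv: "filterlim (\<lambda>k. inverse (real (Suc k))) (at_right 0) sequentially"
      using LIMSEQ_inverse_real_of_nat by (auto simp: filterlim_at)
    have 4: "(\<lambda>k. f k t) \<longlonglongrightarrow> h0 t" if "t \<in> ?S" for t
      unfolding f_def using filterlim_compose[OF lim[of t] inv] that by simp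
    note dc = dominated_convergence[of f ?S "g T" h0, OF 1 2 3 4]
    show "h0 integrable_on {-T..T}" using dc(1) unfolding sp .
    have "norm (integral ?S (f k)) \<le> 4 * C / T" for k
      unfolding sp f_def by (rule half_plane_integral_bound[OF h decay T T0]) auto
    then show "norm (integral {-T..T} h0) \<le> 4 * C / T"
      using Lim_norm_ubound[OF _ dc(2)] unfolding sp by simp
  qed
  define I where "I = Re (integral {-R..R} h0)"
  have I: "((\<lambda>t. Re (h0 t)) has_integral I) {-R..R}"
    unfolding I_def using T(1)[of R] by (intro has_integral_Re integrable_integral) auto
  have "\<bar>I\<bar> \<le> 4 * C / T'" if "R \<le> T'" for T'
  proof -
    have "((\<lambda>t. Re (h0 t)) has_integral I) {-T'..T'}"
      by (rule has_integral_on_superset[OF I]) (use far that in auto)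
    moreover have "((\<lambda>t. Re (h0 t)) has_integral Re (integral {-T'..T'} h0)) {-T'..T'}"
      using T(1)[OF that] by (intro has_integral_Re integrable_integral)
    ultimately have "I = Re (integral {-T'..T'} h0)" by (rule has_integral_unique)
    then show ?thesis using abs_Re_le_cmod[of "integral {-T'..T'} h0"] T(2)[OF that] by simp
  qed
  then have "\<forall>\<^sub>F T' in at_top. \<bar>I\<bar> \<le> 4 * C / T'" by (auto simp: eventually_at_top_linorder)
  moreover have "((\<lambda>T'. 4 * C / T') \<longlongrightarrow> 0) at_top"
    by (intro tendsto_divide_0[OF tendsto_const] filterlim_at_top_imp_at_infinity filterlim_ident)
  ultimately have "\<bar>I\<bar> \<le> 0" by (intro tendsto_lowerbound[where f = "\<lambda>T'. 4 * C / T'" and F = at_top]) auto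
  then show ?thesis using I by simp
qed

section \<open>Logarithmic potentials of arcs\<close>

lemma set_lebesgue_integral_abs_le:
  fixes f :: "'a \<Rightarrow> real"
  assumes "set_integrable M A f"
  shows "\<bar>LINT x:A|M. f x\<bar> \<le> (LINT x:A|M. \<bar>f x\<bar>)"
proof -
  have "\<bar>LINT x:A|M. f x\<bar> \<le> (LINT x|M. norm (indicator A x *\<^sub>R f x))"
    unfolding set_lebesgue_integral_def real_norm_def[symmetric] by (rule integral_norm_bound)
  also have "\<dots> = (LINT x:A|M. \<bar>f x\<bar>)"
    unfolding set_lebesgue_integral_def by (intro Bochner_Integration.integral_cong) (auto simp: indicator_def)
  finally show ?thesis .
qed

text \<open>The bounded case is reduced to the singular one by a fictitious centre
  \<open>a = 2\<close> outside the interval: there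
  \<open>1 \<le> 3 * \<bar>t - 2\<bar> powr (-1/4)\<close>, and 240 is
  \<open>3 * (64 + 8 * 2)\<close>.\<close>

lemma arcsine_kernel_bounded:
  assumes \<psi>: "arcsine_bounded C \<psi>"
    and k: "k \<in> borel_measurable (lebesgue_on {-1<..<1})"
    and bd: "\<And>t. t \<in> {-1<..<1} - N \<Longrightarrow> \<bar>k t\<bar> \<le> K"
    and N: "finite N" and K: "0 \<le> K"
  shows "(\<lambda>t. k t * \<psi> t) absolutely_integrable_on {-1<..<1}"
    and "(LINT t:{-1<..<1}|lebesgue. \<bar>k t * \<psi> t\<bar>) \<le> 240 * K * C"
    and "\<bar>LINT t:{-1<..<1}|lebesgue. k t * \<psi> t\<bar> \<le> 240 * K * C"
proof -
  have b: "\<bar>k t\<bar> \<le> (3 * K) * \<bar>t - 2\<bar> powr (-1/4)" if t: "t \<in> {-1<..<1} - N" for t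
  proof -
    have "\<bar>t - 2\<bar> powr (1/4) \<le> 3 powr (1/4)" using t by (intro powr_mono2) auto
    also have "\<dots> \<le> 3 powr 1" by (intro powr_mono) auto
    finally have "\<bar>t - 2\<bar> powr (1/4) \<le> 3" by simp
    moreover have "0 < \<bar>t - 2\<bar> powr (1/4)" using t by auto
    ultimately have "1 \<le> 3 * \<bar>t - 2\<bar> powr (-1/4)"
      by (simp add: powr_minus field_simps)
    then have "K * 1 \<le> K * (3 * \<bar>t - 2\<bar> powr (-1/4))" using K by (rule mult_left_mono)
    then show ?thesis using bd[OF t] by (simp add: mult_ac)
  qed
  have r: "3 * K * C * (64 + 8 * 2) = 240 * K * C" by simp
  show i: "(\<lambda>t. k t * \<psi> t) absolutely_integrable_on {-1<..<1}"
    and a: "(LINT t:{-1<..<1}|lebesgue. \<bar>k t * \<psi> t\<bar>) \<le> 240 * K * C"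
    using arcsine_weighted[OF \<psi> k b N, of 2] K unfolding r by auto
  show "\<bar>LINT t:{-1<..<1}|lebesgue. k t * \<psi> t\<bar> \<le> 240 * K * C"
    using set_lebesgue_integral_abs_le[OF i] a by linarith
qed

lemma arcsine_integrable: "arcsine_bounded C \<psi> \<Longrightarrow> \<psi> absolutely_integrable_on {-1<..<1}"
  using arcsine_kernel_bounded(1)[of C \<psi> "\<lambda>_. 1" "{}" 1] by simp

section \<open>Chords of the unit circle compared with arc lengths\<close>

lemma norm_circle_point [simp]: "norm (circle_point a) = 1"
  by (simp add: circle_point_def norm_Pair)

lemma norm_circle_point_diff: "norm (circle_point a - circle_point b) = 2 * \<bar>sin ((a - b) / 2)\<bar>"
proof -
  have "(norm (circle_point a - circle_point b))\<^sup>2 = (cos a - cos b)\<^sup>2 + (sin a - sin b)\<^sup>2"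
    by (simp add: circle_point_def norm_Pair)
  also have "\<dots> = 2 - 2 * cos (a - b)"
    using sin_cos_squared_add[of a] sin_cos_squared_add[of b]
    by (simp add: cos_diff power2_eq_square algebra_simps)
  also have "\<dots> = (2 * \<bar>sin ((a - b) / 2)\<bar>)\<^sup>2"
  proof -
    have "2 * ((a - b) / 2) = a - b" using field_sum_of_halves[of "a - b"] by (simp only: mult_2)
    then have "cos (a - b) = cos (2 * ((a - b) / 2))" by (simp only:)
    also have "\<dots> = 1 - 2 * (sin ((a - b) / 2))\<^sup>2" by (rule cos_double_sin)
    finally show ?thesis by (simp add: power_mult_distrib)
  qed
  finally show ?thesis by (rule power2_eq_imp_eq) auto
qed

lemma norm_circle_point_diff_le: "norm (circle_point a - circle_point b) \<le> \<bar>a - b\<bar>"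
  using abs_sin_x_le_abs_x[of "(a - b) / 2"] by (simp add: norm_circle_point_diff)

lemma abs_sin_diff_le:
  fixes v :: real
  shows "\<bar>sin v - v\<bar> \<le> \<bar>v\<bar> ^ 3 / 6"
  using Maclaurin_sin_bound[of v 3] by (simp add: numeral_3_eq_3 sin_coeff_def fact_numeral)

lemma norm_circle_point_diff_ge:
  assumes "\<bar>a - b\<bar> \<le> 2"
  shows "\<bar>a - b\<bar> / 2 \<le> norm (circle_point a - circle_point b)"
proof -
  let ?v = "(a - b) / 2"
  have "\<bar>?v\<bar> ^ 3 \<le> \<bar>?v\<bar> ^ 1" using assms by (intro power_decreasing) auto
  then have "\<bar>sin ?v - ?v\<bar> \<le> \<bar>?v\<bar> / 6" using abs_sin_diff_le[of ?v] by simp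
  then have "\<bar>?v\<bar> / 2 \<le> \<bar>sin ?v\<bar>" by linarith
  then show ?thesis by (simp add: norm_circle_point_diff)
qed

lemma continuous_circle_point [continuous_intros]:
  fixes f :: "real \<Rightarrow> real"
  shows "continuous_on S f \<Longrightarrow> continuous_on S (\<lambda>x. circle_point (f x))"
  unfolding circle_point_def by (intro continuous_intros)

text \<open>The point of the arc nearest to \<open>x\<close> serves as the centre of the singularity.\<close>

lemma arc_distance_lower:
  fixes x :: "real \<times> real"
  assumes "0 < \<epsilon>" "\<epsilon> \<le> 1"
  obtains \<tau> where "\<bar>\<tau>\<bar> \<le> 1"
    "\<And>t. \<bar>t\<bar> \<le> 1 \<Longrightarrow> \<epsilon> / 4 * \<bar>t - \<tau>\<bar> \<le> norm (x - circle_point (s + \<epsilon> * t))"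
proof -
  have "\<exists>\<tau>\<in>{-1..1}. \<forall>t\<in>{-1..1}. norm (x - circle_point (s + \<epsilon> * \<tau>)) \<le> norm (x - circle_point (s + \<epsilon> * t))"
    by (intro continuous_attains_inf continuous_intros) auto
  then obtain \<tau> where \<tau>: "\<bar>\<tau>\<bar> \<le> 1"
    "\<And>t. \<bar>t\<bar> \<le> 1 \<Longrightarrow> norm (x - circle_point (s + \<epsilon> * \<tau>)) \<le> norm (x - circle_point (s + \<epsilon> * t))"
    by (auto simp: abs_le_iff)
  show thesis
  proof (rule that[OF \<tau>(1)])
    fix t :: real assume t: "\<bar>t\<bar> \<le> 1"
    have "\<bar>t - \<tau>\<bar> \<le> 2" using t \<tau>(1) by linarith
    then have "\<epsilon> * \<bar>t - \<tau>\<bar> \<le> 1 * 2" using assms by (intro mult_mono) auto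
    moreover have e: "\<bar>(s + \<epsilon> * t) - (s + \<epsilon> * \<tau>)\<bar> = \<epsilon> * \<bar>t - \<tau>\<bar>"
      using assms by (simp add: right_diff_distrib[symmetric] abs_mult)
    ultimately have "\<epsilon> * \<bar>t - \<tau>\<bar> / 2 \<le> norm (circle_point (s + \<epsilon> * t) - circle_point (s + \<epsilon> * \<tau>))"
      using norm_circle_point_diff_ge[of "s + \<epsilon> * t" "s + \<epsilon> * \<tau>"] by simp
    \<comment> \<open>Because the point at \<open>\<tau>\<close> is nearest, the triangle inequality
      costs only a factor 2; the other factor 2 in \<open>\<epsilon> / 4\<close> was lost in
      bounding the chord by half the arc.\<close>
    also have "\<dots> \<le> norm (x - circle_point (s + \<epsilon> * \<tau>)) + norm (x - circle_point (s + \<epsilon> * t))"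
      using norm_triangle_ineq4[of "x - circle_point (s + \<epsilon> * \<tau>)" "x - circle_point (s + \<epsilon> * t)"] by simp
    also have "\<dots> \<le> 2 * norm (x - circle_point (s + \<epsilon> * t))" using \<tau>(2)[OF t] by simp
    finally show "\<epsilon> / 4 * \<bar>t - \<tau>\<bar> \<le> norm (x - circle_point (s + \<epsilon> * t))" by simp
  qed
qed

lemma quarter_powr_le:
  fixes \<epsilon> r v :: real
  assumes "0 < \<epsilon>" "\<epsilon> / 4 * v \<le> r" "0 < v"
  shows "r powr (-1/4) \<le> (\<epsilon> / 4) powr (-1/4) * v powr (-1/4)"
proof -
  have "r powr (-1/4) \<le> (\<epsilon> / 4 * v) powr (-1/4)" using assms by (intro powr_mono2') auto
  also have "\<dots> = (\<epsilon> / 4) powr (-1/4) * v powr (-1/4)" by (rule powr_mult)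
  finally show ?thesis .
qed

text \<open>The integration variable is the rescaled parameter: the factor \<open>\<epsilon>\<close>
  of arc length is absorbed in \<open>\<psi>\<close>, and the total charge does not depend on
  \<open>\<epsilon>\<close>.\<close>

definition arc_potential :: "real \<Rightarrow> real \<Rightarrow> (real \<Rightarrow> real) \<Rightarrow> real \<times> real \<Rightarrow> real" where
  "arc_potential \<epsilon> s \<psi> x = (LINT t:{-1<..<1}|lebesgue. ln (norm (x - circle_point (s + \<epsilon> * t))) * \<psi> t)"

lemma borel_measurable_lebesgue_on_continuous:
  fixes f :: "real \<Rightarrow> 'a::real_normed_vector"
  assumes "continuous_on UNIV f"
  shows "f \<in> borel_measurable (lebesgue_on S)"
  using borel_measurable_continuous_onI[OF assms] measurable_restrict_space1 borel_measurable_if_I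
  by (metis lebesgue_on_UNIV_eq measurable_completion measurable_lborel2)

lemma measurable_arc_ln:
  "(\<lambda>t. ln (norm (x - circle_point (s + \<epsilon> * t)))) \<in> borel_measurable (lebesgue_on {-1<..<1})"
  by (intro borel_measurable_ln borel_measurable_lebesgue_on_continuous continuous_intros)

text \<open>The point \<open>x\<close> may lie on the arc: by comparison with its nearest arc point,
  the kernel has at worst a singularity of order 1/4 in \<open>t\<close>.\<close>

lemma arc_potential_integrable:
  assumes \<psi>: "arcsine_bounded C \<psi>" and \<epsilon>: "0 < \<epsilon>" "\<epsilon> \<le> 1"
  shows "(\<lambda>t. ln (norm (x - circle_point (s + \<epsilon> * t))) * \<psi> t) absolutely_integrable_on {-1<..<1}"
proof -
  obtain \<tau> where \<tau>: "\<bar>\<tau>\<bar> \<le> 1"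
    "\<And>t. \<bar>t\<bar> \<le> 1 \<Longrightarrow> \<epsilon> / 4 * \<bar>t - \<tau>\<bar> \<le> norm (x - circle_point (s + \<epsilon> * t))"
    using arc_distance_lower[OF \<epsilon>] by metis
  define B where "B = norm x + 1"
  have "\<bar>ln (norm (x - circle_point (s + \<epsilon> * t)))\<bar>
      \<le> ((4 + B\<^sup>2) * (\<epsilon> / 4) powr (-1/4)) * \<bar>t - \<tau>\<bar> powr (-1/4)" if t: "t \<in> {-1<..<1} - {\<tau>}" for t
  proof -
    let ?r = "norm (x - circle_point (s + \<epsilon> * t))"
    have p: "0 < \<bar>t - \<tau>\<bar>" using t by auto
    have l: "\<epsilon> / 4 * \<bar>t - \<tau>\<bar> \<le> ?r" using \<tau>(2)[of t] t by auto
    have "0 < \<epsilon> / 4 * \<bar>t - \<tau>\<bar>" using p \<epsilon> by simp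
    then have "0 < ?r" using l by linarith
    moreover have "?r \<le> B" unfolding B_def using norm_triangle_ineq4[of x "circle_point (s + \<epsilon> * t)"] by simp
    ultimately have "\<bar>ln ?r\<bar> \<le> (4 + B\<^sup>2) * ?r powr (-1/4)" by (rule abs_ln_le_powr) (simp add: B_def)
    also have "\<dots> \<le> (4 + B\<^sup>2) * ((\<epsilon> / 4) powr (-1/4) * \<bar>t - \<tau>\<bar> powr (-1/4))"
      by (intro mult_left_mono quarter_powr_le) (use \<epsilon> l p in auto)
    finally show ?thesis by (simp add: mult_ac)
  qed
  then show ?thesis
    by (rule arcsine_weighted(1)[OF \<psi> measurable_arc_ln _ _ \<tau>(1)]) auto
qed

lemma powr_quarter_diff_le:
  fixes r r' :: real
  assumes "0 < r'" "r' \<le> r"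
  shows "r powr (1/4) \<le> (r - r') powr (1/4) + r' powr (1/4)"
proof -
  let ?a = "(r - r') powr (1/4)" and ?b = "r' powr (1/4)"
  have p4: "(z powr (1/4)) ^ 4 = z" if "0 \<le> z" for z :: real
    using that by (cases "z = 0") (auto simp: powr_power)
  have ab: "0 \<le> ?a" "0 \<le> ?b" by auto
  have "(r powr (1/4)) ^ 4 = ?a ^ 4 + ?b ^ 4" using assms by (simp add: p4)
  also have "\<dots> \<le> (?a + ?b) ^ 4"
    using ab by (simp add: power4_eq_xxxx algebra_simps)
  finally show ?thesis by (rule power_mono_iff[THEN iffD1, rotated -1]) (use ab in auto)
qed

text \<open>Writing \<open>ln r\<close> as \<open>4 * ln (r powr (1/4))\<close> and using
  subadditivity of the quarter power trades smallness of \<open>r - r'\<close> against a singularity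
  that the arcsine weight still absorbs.\<close>

lemma ln_diff_le_quarter:
  fixes r r' :: real
  assumes "0 < r" "0 < r'"
  shows "\<bar>ln r - ln r'\<bar> \<le> 4 * \<bar>r - r'\<bar> powr (1/4) * (r powr (-1/4) + r' powr (-1/4))"
proof -
  have *: "\<bar>ln r - ln r'\<bar> \<le> 4 * \<bar>r - r'\<bar> powr (1/4) * r' powr (-1/4)"
    if "0 < r'" "r' \<le> r" for r r' :: real
  proof -
    have "ln r - ln r' = 4 * ln (r powr (1/4) / r' powr (1/4))"
      using that by (simp add: ln_div ln_powr)
    also have "\<dots> \<le> 4 * (r powr (1/4) / r' powr (1/4) - 1)"
      using that ln_le_minus_one[of "r powr (1/4) / r' powr (1/4)"] by simp
    also have "r powr (1/4) / r' powr (1/4) - 1 = (r powr (1/4) - r' powr (1/4)) / r' powr (1/4)"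
      using that by (simp add: field_simps)
    also have "\<dots> \<le> (r - r') powr (1/4) / r' powr (1/4)"
      using powr_quarter_diff_le[OF that] by (intro divide_right_mono) auto
    finally show ?thesis using that by (simp add: powr_minus_divide)
  qed
  show ?thesis
  proof (cases "r' \<le> r")
    case True
    have "4 * \<bar>r - r'\<bar> powr (1/4) * r' powr (-1/4) \<le> 4 * \<bar>r - r'\<bar> powr (1/4) * (r powr (-1/4) + r' powr (-1/4))"
      by (intro mult_left_mono) auto
    then show ?thesis using *[OF assms(2) True] by linarith
  next
    case False
    have "4 * \<bar>r' - r\<bar> powr (1/4) * r powr (-1/4) \<le> 4 * \<bar>r' - r\<bar> powr (1/4) * (r powr (-1/4) + r' powr (-1/4))"
      by (intro mult_left_mono) auto
    then show ?thesis using *[OF assms(1), of r'] False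
      unfolding abs_minus_commute[of "ln r" "ln r'"] abs_minus_commute[of r r'] by linarith
  qed
qed

text \<open>Hoelder continuity of exponent 1/4 in the whole plane, across the arc as well. The
  constant grows as \<open>\<epsilon>\<close> shrinks, which is harmless since only continuity for
  fixed \<open>\<epsilon>\<close> is drawn from it. Each of the two singularities contributes
  \<open>C * 72\<close>, where 72 is \<open>64 + 8\<close>.\<close>

lemma arc_potential_diff_le:
  assumes \<psi>: "arcsine_bounded C \<psi>" and \<epsilon>: "0 < \<epsilon>" "\<epsilon> \<le> 1"
  shows "\<bar>arc_potential \<epsilon> s \<psi> x - arc_potential \<epsilon> s \<psi> y\<bar>
    \<le> 4 * norm (x - y) powr (1/4) * (\<epsilon> / 4) powr (-1/4) * (C * 144)"
proof -
  let ?I = "{-1<..<1::real}"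
  obtain \<tau> where \<tau>: "\<bar>\<tau>\<bar> \<le> 1"
    "\<And>t. \<bar>t\<bar> \<le> 1 \<Longrightarrow> \<epsilon> / 4 * \<bar>t - \<tau>\<bar> \<le> norm (x - circle_point (s + \<epsilon> * t))"
    using arc_distance_lower[OF \<epsilon>] by metis
  obtain \<sigma> where \<sigma>: "\<bar>\<sigma>\<bar> \<le> 1"
    "\<And>t. \<bar>t\<bar> \<le> 1 \<Longrightarrow> \<epsilon> / 4 * \<bar>t - \<sigma>\<bar> \<le> norm (y - circle_point (s + \<epsilon> * t))"
    using arc_distance_lower[OF \<epsilon>] by metis
  define c where "c = 4 * norm (x - y) powr (1/4) * (\<epsilon> / 4) powr (-1/4)"
  have c: "0 \<le> c" by (simp add: c_def)
  let ?k = "\<lambda>t. ln (norm (x - circle_point (s + \<epsilon> * t))) - ln (norm (y - circle_point (s + \<epsilon> * t)))"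
  have le: "\<bar>?k t\<bar> \<le> c * \<bar>t - \<tau>\<bar> powr (-1/4) + c * \<bar>t - \<sigma>\<bar> powr (-1/4)"
    if t: "t \<in> ?I - {\<tau>, \<sigma>}" for t
  proof -
    let ?r = "norm (x - circle_point (s + \<epsilon> * t))" and ?r' = "norm (y - circle_point (s + \<epsilon> * t))"
    have p: "0 < \<bar>t - \<tau>\<bar>" "0 < \<bar>t - \<sigma>\<bar>" using t by auto
    have l: "\<epsilon> / 4 * \<bar>t - \<tau>\<bar> \<le> ?r" "\<epsilon> / 4 * \<bar>t - \<sigma>\<bar> \<le> ?r'" using \<tau>(2)[of t] \<sigma>(2)[of t] t by auto
    have "0 < \<epsilon> / 4 * \<bar>t - \<tau>\<bar>" "0 < \<epsilon> / 4 * \<bar>t - \<sigma>\<bar>" using p \<epsilon> by auto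
    then have pos: "0 < ?r" "0 < ?r'" using l by linarith+
    have "\<bar>?r - ?r'\<bar> \<le> norm (x - y)"
      using norm_triangle_ineq3[of "x - circle_point (s + \<epsilon> * t)" "y - circle_point (s + \<epsilon> * t)"] by simp
    then have "\<bar>?r - ?r'\<bar> powr (1/4) \<le> norm (x - y) powr (1/4)" by (intro powr_mono2) auto
    then have "\<bar>?k t\<bar> \<le> 4 * norm (x - y) powr (1/4) * (?r powr (-1/4) + ?r' powr (-1/4))"
      using ln_diff_le_quarter[OF pos] by (smt (verit) mult_right_mono mult_left_mono powr_ge_zero)
    also have "\<dots> \<le> 4 * norm (x - y) powr (1/4) * ((\<epsilon> / 4) powr (-1/4) * \<bar>t - \<tau>\<bar> powr (-1/4)
        + (\<epsilon> / 4) powr (-1/4) * \<bar>t - \<sigma>\<bar> powr (-1/4))"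
      by (intro mult_left_mono add_mono quarter_powr_le) (use \<epsilon> l p in auto)
    also have "\<dots> = c * \<bar>t - \<tau>\<bar> powr (-1/4) + c * \<bar>t - \<sigma>\<bar> powr (-1/4)"
      by (simp add: c_def algebra_simps)
    finally show ?thesis .
  qed
  have mp: "(\<lambda>t::real. \<bar>t - a\<bar> powr (-1/4)) \<in> borel_measurable (lebesgue_on ?I)" for a
    by (intro powr_real_measurable borel_measurable_const borel_measurable_lebesgue_on_continuous continuous_intros)
  have wt: "(\<lambda>t. \<bar>t - a\<bar> powr (-1/4) * \<psi> t) absolutely_integrable_on ?I"
    "(LINT t:?I|lebesgue. \<bar>\<bar>t - a\<bar> powr (-1/4) * \<psi> t\<bar>) \<le> C * 72" if "\<bar>a\<bar> \<le> 1" for a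
    using arcsine_weighted[OF \<psi> mp[of a], where N = "{}" and K = 1 and a = a and B = 1] that by auto
  have ki: "(\<lambda>t. ?k t * \<psi> t) absolutely_integrable_on ?I"
    using set_integral_diff(1)[OF arc_potential_integrable[OF \<psi> \<epsilon>, of x s] arc_potential_integrable[OF \<psi> \<epsilon>, of y s]]
    by (simp add: left_diff_distrib)
  have "\<bar>arc_potential \<epsilon> s \<psi> x - arc_potential \<epsilon> s \<psi> y\<bar> = \<bar>LINT t:?I|lebesgue. ?k t * \<psi> t\<bar>"
    unfolding arc_potential_def left_diff_distrib
    by (subst set_integral_diff(2)) (auto intro!: arc_potential_integrable[OF \<psi> \<epsilon>])
  also have "\<dots> \<le> (LINT t:?I|lebesgue. \<bar>?k t * \<psi> t\<bar>)"
    by (rule set_lebesgue_integral_abs_le[OF ki])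
  also have "\<dots> \<le> (LINT t:?I|lebesgue. c * \<bar>\<bar>t - \<tau>\<bar> powr (-1/4) * \<psi> t\<bar> + c * \<bar>\<bar>t - \<sigma>\<bar> powr (-1/4) * \<psi> t\<bar>)"
  proof (rule set_integral_mono_AE)
    show "set_integrable lebesgue ?I (\<lambda>t. \<bar>?k t * \<psi> t\<bar>)" by (rule set_integrable_abs[OF ki])
    show "set_integrable lebesgue ?I (\<lambda>t. c * \<bar>\<bar>t - \<tau>\<bar> powr (-1/4) * \<psi> t\<bar> + c * \<bar>\<bar>t - \<sigma>\<bar> powr (-1/4) * \<psi> t\<bar>)"
      by (intro set_integral_add set_integrable_mult_right set_integrable_abs wt \<tau> \<sigma>)
    have "AE t in lebesgue. t \<notin> {\<tau>, \<sigma>}"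
      by (intro AE_not_in negligible_iff_null_sets[THEN iffD1]) simp
    then show "AE t\<in>?I in lebesgue. \<bar>?k t * \<psi> t\<bar> \<le> c * \<bar>\<bar>t - \<tau>\<bar> powr (-1/4) * \<psi> t\<bar> + c * \<bar>\<bar>t - \<sigma>\<bar> powr (-1/4) * \<psi> t\<bar>"
    proof (rule eventually_mono, intro impI)
      fix t assume "t \<notin> {\<tau>, \<sigma>}" "t \<in> ?I"
      then have "\<bar>?k t\<bar> * \<bar>\<psi> t\<bar> \<le> (c * \<bar>t - \<tau>\<bar> powr (-1/4) + c * \<bar>t - \<sigma>\<bar> powr (-1/4)) * \<bar>\<psi> t\<bar>"
        by (intro mult_right_mono le) auto
      then show "\<bar>?k t * \<psi> t\<bar> \<le> c * \<bar>\<bar>t - \<tau>\<bar> powr (-1/4) * \<psi> t\<bar> + c * \<bar>\<bar>t - \<sigma>\<bar> powr (-1/4) * \<psi> t\<bar>"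
        unfolding abs_mult by (simp only: powr_ge_zero abs_of_nonneg distrib_right mult.assoc)
    qed
  qed
  also have "\<dots> = c * (LINT t:?I|lebesgue. \<bar>\<bar>t - \<tau>\<bar> powr (-1/4) * \<psi> t\<bar>)
      + c * (LINT t:?I|lebesgue. \<bar>\<bar>t - \<sigma>\<bar> powr (-1/4) * \<psi> t\<bar>)"
    using set_integral_add(2)[OF set_integrable_mult_right[OF set_integrable_abs[OF wt(1)[OF \<tau>(1)]], of c]
        set_integrable_mult_right[OF set_integrable_abs[OF wt(1)[OF \<sigma>(1)]], of c]]
    by (simp only: set_integral_mult_right)
  also have "\<dots> \<le> c * (C * 72) + c * (C * 72)"
    using c \<tau> \<sigma> by (intro add_mono mult_left_mono wt) auto
  finally show ?thesis unfolding c_def by (simp add: mult_ac)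
qed

lemma arc_potential_continuous:
  assumes \<psi>: "arcsine_bounded C \<psi>" and \<epsilon>: "0 < \<epsilon>" "\<epsilon> \<le> 1"
  shows "continuous_on S (arc_potential \<epsilon> s \<psi>)"
proof -
  have "isCont (arc_potential \<epsilon> s \<psi>) y" for y
  proof -
    have "((\<lambda>x. 4 * norm (x - y) powr (1/4) * (\<epsilon> / 4) powr (-1/4) * (C * 144)) \<longlongrightarrow>
        4 * norm (y - y) powr (1/4) * (\<epsilon> / 4) powr (-1/4) * (C * 144)) (at y)"
      by (intro tendsto_mult tendsto_const tendsto_powr2 tendsto_norm tendsto_diff tendsto_ident_at) auto
    then have z: "((\<lambda>x. 4 * norm (x - y) powr (1/4) * (\<epsilon> / 4) powr (-1/4) * (C * 144)) \<longlongrightarrow> 0) (at y)"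
      by (simp only: diff_self norm_zero powr_0 mult_zero_left mult_zero_right)
    have "((\<lambda>x. arc_potential \<epsilon> s \<psi> x - arc_potential \<epsilon> s \<psi> y) \<longlongrightarrow> 0) (at y)"
      by (rule Lim_null_comparison[OF _ z], rule always_eventually)
        (simp only: real_norm_def arc_potential_diff_le[OF \<psi> \<epsilon>] simp_thms)
    then show ?thesis unfolding isCont_def by (simp add: LIM_zero_iff)
  qed
  then show ?thesis by (simp add: continuous_at_imp_continuous_on)
qed

text \<open>An interior point keeps the distance \<open>1 - norm x\<close> from the circle, so the
  five-point difference of the kernel is of order \<open>t ^ 4\<close> uniformly along the arc, and
  the bound survives integration.\<close>

lemma arc_potential_cross_diff:
  assumes \<psi>: "arcsine_bounded C \<psi>" and \<epsilon>: "0 < \<epsilon>" "\<epsilon> \<le> 1" and x: "x \<in> ball 0 1"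
  shows "((\<lambda>t. cross_diff (arc_potential \<epsilon> s \<psi>) x t / t\<^sup>2) \<longlongrightarrow> 0) (at_right 0)"
proof (rule Lim_null_comparison)
  define d where "d = 1 - norm x"
  have d: "0 < d" using x by (simp add: d_def)
  let ?I = "{-1<..<1::real}"
  let ?L = "\<lambda>t \<tau>. cross_diff (\<lambda>x. ln (norm (x - circle_point (s + \<epsilon> * \<tau>)))) x t"
  have eq: "cross_diff (arc_potential \<epsilon> s \<psi>) x t = (LINT \<tau>:?I|lebesgue. ?L t \<tau> * \<psi> \<tau>)" for t
    unfolding cross_diff_def arc_potential_def ring_distribs
    by (simp add: set_integral_add set_integral_diff set_integrable_mult_right mult.assoc
        arc_potential_integrable[OF \<psi> \<epsilon>])
  have ev: "\<forall>\<^sub>F t in at_right 0. t < d / 2" by (rule eventually_at_rightI[of 0 "d/2"]) (use d in auto)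
  show "\<forall>\<^sub>F t in at_right 0. norm (cross_diff (arc_potential \<epsilon> s \<psi>) x t / t\<^sup>2) \<le> 240 * (3 * t\<^sup>2 / d ^ 4) * C"
    using ev eventually_at_right_less[of "0::real"]
  proof eventually_elim
    case (elim t)
    have "(2 * t)\<^sup>2 \<le> d\<^sup>2" using elim by (intro power_mono) auto
    then have td: "3 * t\<^sup>2 \<le> d\<^sup>2" by (simp add: power_mult_distrib) (smt (verit) zero_le_power2)
    have bd: "\<bar>?L t \<tau>\<bar> \<le> 3 * t ^ 4 / d ^ 4" for \<tau>
    proof -
      let ?r = "norm (x - circle_point (s + \<epsilon> * \<tau>))"
      have r: "d \<le> ?r" unfolding d_def
        using norm_triangle_ineq2[of "circle_point (s + \<epsilon> * \<tau>)" x] by (simp add: norm_minus_commute)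
      then have "d\<^sup>2 \<le> ?r\<^sup>2" using d by (intro power_mono) auto
      then have "3 * t\<^sup>2 \<le> ?r\<^sup>2" using td by linarith
      moreover have "x \<noteq> circle_point (s + \<epsilon> * \<tau>)" using r d by auto
      ultimately have "\<bar>?L t \<tau>\<bar> \<le> 3 * t ^ 4 / ?r ^ 4" by (intro cross_diff_ln_bound)
      also have "\<dots> \<le> 3 * t ^ 4 / d ^ 4" using r d by (intro divide_left_mono power_mono mult_pos_pos) auto
      finally show ?thesis .
    qed
    have "\<bar>LINT \<tau>:?I|lebesgue. ?L t \<tau> * \<psi> \<tau>\<bar> \<le> 240 * (3 * t ^ 4 / d ^ 4) * C"
    proof (rule arcsine_kernel_bounded(3)[OF \<psi>])
      show "?L t \<in> borel_measurable (lebesgue_on ?I)" unfolding cross_diff_def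
        by (intro borel_measurable_add borel_measurable_diff borel_measurable_times measurable_arc_ln) auto
    qed (use bd d in auto)
    then have "\<bar>cross_diff (arc_potential \<epsilon> s \<psi>) x t\<bar> / t\<^sup>2 \<le> 240 * (3 * t ^ 4 / d ^ 4) * C / t\<^sup>2"
      unfolding eq by (rule divide_right_mono) simp
    also have "\<dots> = 240 * (3 * t\<^sup>2 / d ^ 4) * C" using elim d by (simp add: power2_eq_square power4_eq_xxxx)
    finally show ?case by simp
  qed
  have "((\<lambda>t::real. 240 * (3 * t\<^sup>2 / d ^ 4) * C) \<longlongrightarrow> 240 * (3 * 0\<^sup>2 / d ^ 4) * C) (at_right 0)"
    using d by (intro tendsto_intros) auto
  then show "((\<lambda>t::real. 240 * (3 * t\<^sup>2 / d ^ 4) * C) \<longlongrightarrow> 0) (at_right 0)" by simp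
qed

text \<open>The remainder depends on \<open>y\<close> only through the lower bound \<open>r\<close>,
  so that the expansion can be integrated against a density on an arc.\<close>

lemma ln_norm_normal_expansion:
  fixes x y :: "'a::real_inner"
  assumes x: "norm x = 1" "norm y = 1" and r: "0 < r" "r \<le> 1" "r \<le> norm (x - y)"
    and t: "\<bar>t\<bar> \<le> r\<^sup>2 / 4"
  shows "\<bar>ln (norm (x + t *\<^sub>R x - y)) - ln (norm (x - y)) - t / 2\<bar> \<le> (4 + 1 / r\<^sup>2) * t\<^sup>2"
proof -
  define D where "D = (norm (x - y))\<^sup>2"
  have rD: "r\<^sup>2 \<le> D" unfolding D_def using r by (intro power_mono) auto
  have D: "0 < D" using r rD by (smt (verit) zero_less_power)
  have r2: "r\<^sup>2 \<le> 1" using r by (simp add: power_le_one)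
  \<comment> \<open>As both points lie on the circle, \<open>2 * ((x - y) \<bullet> x) = D\<close>,
    and the squared distance becomes \<open>D + t * D + t\<^sup>2 = D * (1 + z)\<close>.\<close>
  define z where "z = t + t\<^sup>2 / D"
  have tD: "t\<^sup>2 / D \<le> t\<^sup>2 / r\<^sup>2" using rD r D by (intro divide_left_mono mult_pos_pos) auto
  have "t\<^sup>2 = \<bar>t\<bar> * \<bar>t\<bar>" by (simp add: power2_eq_square)
  also have "\<dots> \<le> \<bar>t\<bar> * (r\<^sup>2 / 4)" using t by (intro mult_left_mono) auto
  finally have "t\<^sup>2 / r\<^sup>2 \<le> \<bar>t\<bar> / 4" using r by (simp add: divide_le_eq)
  moreover have "0 \<le> t\<^sup>2 / D" using D by simp
  ultimately have z: "\<bar>z\<bar> \<le> 5/4 * \<bar>t\<bar>" unfolding z_def using tD by linarith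
  have t4: "\<bar>t\<bar> \<le> 1/4" using t r2 by linarith
  then have z2: "\<bar>z\<bar> \<le> 1/2" using z by linarith
  have "(norm (x + t *\<^sub>R x - y))\<^sup>2 = (norm ((x - y) + t *\<^sub>R x))\<^sup>2" by (simp add: algebra_simps)
  also have "\<dots> = D + t * (2 * ((x - y) \<bullet> x)) + t\<^sup>2"
  proof -
    have xx: "x \<bullet> x = 1" using x by (simp add: dot_square_norm)
    show ?thesis unfolding D_def power2_norm_eq_inner
      by (simp add: inner_add_left inner_add_right xx inner_commute[of x "x - y"] inner_commute[of y x]
          power2_eq_square algebra_simps)
  qed
  also have "\<dots> = D * (1 + z)"
    unfolding inner_diff_self_sphere[OF x(1)] D_def[symmetric] z_def using D x
    by (simp add: field_simps)
  finally have "ln (norm (x + t *\<^sub>R x - y)) = ln (D * (1 + z)) / 2" by (subst ln_norm) simp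
  also have "\<dots> = ln (norm (x - y)) + ln (1 + z) / 2"
    using D z2 by (subst ln_mult_pos) (auto simp: ln_norm[of "x - y"] D_def abs_if split: if_splits)
  finally have "\<bar>ln (norm (x + t *\<^sub>R x - y)) - ln (norm (x - y)) - t / 2\<bar> = \<bar>(ln (1 + z) - z) / 2 + t\<^sup>2 / D / 2\<bar>"
    by (simp add: z_def field_simps)
  also have "\<dots> \<le> z\<^sup>2 + t\<^sup>2 / D"
  proof -
    have "\<bar>ln (1 + z) - z\<bar> \<le> 2 * z\<^sup>2" using z2 by (rule abs_ln_one_plus_x_minus_x_bound)
    moreover have "\<bar>a\<bar> \<le> 2 * b \<Longrightarrow> 0 \<le> Y \<Longrightarrow> \<bar>a / 2 + Y / 2\<bar> \<le> b + Y" for a b Y :: real by linarith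
    ultimately show ?thesis using \<open>0 \<le> t\<^sup>2 / D\<close> by blast
  qed
  also have "z\<^sup>2 \<le> 4 * t\<^sup>2"
  proof -
    have "\<bar>z\<bar>\<^sup>2 \<le> (2 * \<bar>t\<bar>)\<^sup>2" using z by (intro power_mono) auto
    then show ?thesis by (simp add: power_mult_distrib)
  qed
  finally show ?thesis using tD by (simp add: distrib_right)
qed

lemma arc_potential_normal_derivative:
  assumes \<psi>: "arcsine_bounded C \<psi>" and \<epsilon>: "0 < \<epsilon>" "\<epsilon> \<le> 1" and x: "norm x = 1"
    and r: "0 < r" "\<And>t. t \<in> {-1<..<1} \<Longrightarrow> r \<le> norm (x - circle_point (s + \<epsilon> * t))"
  shows "has_normal_derivative (arc_potential \<epsilon> s \<psi>) x ((LINT t:{-1<..<1}|lebesgue. \<psi> t) / 2) x"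
proof -
  let ?I = "{-1<..<1::real}"
  define \<rho> where "\<rho> = min r 1"
  have \<rho>: "0 < \<rho>" "\<rho> \<le> 1" "\<rho> \<le> r" using r(1) by (auto simp: \<rho>_def)
  define M where "M = (LINT t:?I|lebesgue. \<psi> t)"
  let ?P = "arc_potential \<epsilon> s \<psi>"
  define B where "B = 240 * (4 + 1 / \<rho>\<^sup>2) * C"
  let ?k = "\<lambda>t \<tau>. ln (norm (x + t *\<^sub>R x - circle_point (s + \<epsilon> * \<tau>))) - ln (norm (x - circle_point (s + \<epsilon> * \<tau>))) - t / 2"
  have bd: "\<bar>?P (x + t *\<^sub>R x) - ?P x - t * (M / 2)\<bar> \<le> B * t\<^sup>2" if t: "\<bar>t\<bar> \<le> \<rho>\<^sup>2 / 4" for t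
  proof -
    have eq: "?P (x + t *\<^sub>R x) - ?P x - t * (M / 2) = (LINT \<tau>:?I|lebesgue. ?k t \<tau> * \<psi> \<tau>)"
      unfolding arc_potential_def M_def left_diff_distrib
      using arc_potential_integrable[OF \<psi> \<epsilon>] arcsine_integrable[OF \<psi>]
      by (simp add: set_integral_diff set_integrable_mult_right set_integrable_divide)
    have "\<bar>LINT \<tau>:?I|lebesgue. ?k t \<tau> * \<psi> \<tau>\<bar> \<le> 240 * ((4 + 1 / \<rho>\<^sup>2) * t\<^sup>2) * C"
    proof (rule arcsine_kernel_bounded(3)[OF \<psi>])
      show "?k t \<in> borel_measurable (lebesgue_on ?I)"
        by (intro borel_measurable_diff measurable_arc_ln borel_measurable_const)
      show "\<bar>?k t \<tau>\<bar> \<le> (4 + 1 / \<rho>\<^sup>2) * t\<^sup>2" if "\<tau> \<in> ?I - {}" for \<tau>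
        by (rule ln_norm_normal_expansion) (use x \<rho> t r(2)[of \<tau>] that in auto)
    qed auto
    then show ?thesis unfolding eq B_def by (simp only: mult_ac)
  qed
  have "((\<lambda>t. (?P (x + t *\<^sub>R x) - ?P x) / t - M / 2) \<longlongrightarrow> 0) (at_left 0)"
  proof (rule Lim_null_comparison)
    have "\<forall>\<^sub>F t in at_left (0::real). t \<in> {-(\<rho>\<^sup>2 / 4)<..<0}" by (rule eventually_at_left_real) (use \<rho> in simp)
    then show "\<forall>\<^sub>F t in at_left 0. norm ((?P (x + t *\<^sub>R x) - ?P x) / t - M / 2) \<le> B * \<bar>t\<bar>"
    proof eventually_elim
      case (elim t)
      have "\<bar>?P (x + t *\<^sub>R x) - ?P x - t * (M / 2)\<bar> / \<bar>t\<bar> \<le> B * t\<^sup>2 / \<bar>t\<bar>"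
        using elim by (intro divide_right_mono bd) auto
      also have "\<dots> = B * \<bar>t\<bar>" using elim by (simp add: power2_eq_square abs_if)
      also have "\<bar>?P (x + t *\<^sub>R x) - ?P x - t * (M / 2)\<bar> / \<bar>t\<bar> = \<bar>(?P (x + t *\<^sub>R x) - ?P x - t * (M / 2)) / t\<bar>"
        by simp
      also have "(?P (x + t *\<^sub>R x) - ?P x - t * (M / 2)) / t = (?P (x + t *\<^sub>R x) - ?P x) / t - M / 2"
        using elim by (simp add: diff_divide_distrib)
      finally show ?case by simp
    qed
    have "((\<lambda>t. B * \<bar>t\<bar>) \<longlongrightarrow> B * \<bar>0\<bar>) (at_left 0)" by (intro tendsto_intros)
    then show "((\<lambda>t. B * \<bar>t\<bar>) \<longlongrightarrow> 0) (at_left 0)" by simp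
  qed
  then have "((\<lambda>t. (?P (x + t *\<^sub>R x) - ?P x) / t) \<longlongrightarrow> M / 2) (at_left 0)" by (rule LIM_zero_cancel)
  then show ?thesis unfolding has_normal_derivative_def has_field_derivative_iff M_def by simp
qed

section \<open>Asymptotics of an arc potential at the scale of the arcs and at fixed
  distance\<close>

lemma ln_chord_ratio:
  fixes v :: real
  assumes "v \<noteq> 0" "\<bar>v\<bar> \<le> 1"
  shows "\<bar>ln \<bar>sin v\<bar> - ln \<bar>v\<bar>\<bar> \<le> \<bar>v\<bar>"
proof -
  define z where "z = \<bar>sin v\<bar> / \<bar>v\<bar> - 1"
  have "\<bar>\<bar>sin v\<bar> - \<bar>v\<bar>\<bar> \<le> \<bar>v\<bar> ^ 3 / 6" using abs_sin_diff_le[of v] by linarith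
  moreover have "\<bar>v\<bar> ^ 3 \<le> \<bar>v\<bar> ^ 2" using assms by (intro power_decreasing) auto
  ultimately have "\<bar>\<bar>sin v\<bar> - \<bar>v\<bar>\<bar> \<le> \<bar>v\<bar>\<^sup>2 / 6" by linarith
  then have "\<bar>\<bar>sin v\<bar> - \<bar>v\<bar>\<bar> / \<bar>v\<bar> \<le> \<bar>v\<bar>\<^sup>2 / 6 / \<bar>v\<bar>" by (rule divide_right_mono) simp
  moreover have "\<bar>\<bar>sin v\<bar> - \<bar>v\<bar>\<bar> / \<bar>v\<bar> = \<bar>z\<bar>"
  proof -
    have "z = (\<bar>sin v\<bar> - \<bar>v\<bar>) / \<bar>v\<bar>" using assms by (simp add: z_def diff_divide_distrib)
    then show ?thesis by (simp only: abs_divide abs_idempotent)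
  qed
  moreover have "\<bar>v\<bar>\<^sup>2 / 6 / \<bar>v\<bar> = \<bar>v\<bar> / 6"
  proof -
    have "x \<noteq> 0 \<Longrightarrow> x\<^sup>2 / 6 / x = x / 6" for x :: real by (simp add: power2_eq_square)
    then show ?thesis by this (use assms in simp)
  qed
  ultimately have z: "\<bar>z\<bar> \<le> \<bar>v\<bar> / 6" by simp
  then have z2: "\<bar>z\<bar> \<le> 1/2" using assms by linarith
  have "0 < 1 + z" using z2 by (simp add: abs_if split: if_splits)
  then have "ln \<bar>sin v\<bar> = ln (\<bar>v\<bar> * (1 + z))" using assms by (simp add: z_def)
  also have "\<dots> = ln \<bar>v\<bar> + ln (1 + z)" using assms \<open>0 < 1 + z\<close> by (subst ln_mult_pos) auto
  finally have "\<bar>ln \<bar>sin v\<bar> - ln \<bar>v\<bar>\<bar> = \<bar>ln (1 + z)\<bar>" by simp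
  also have "\<dots> \<le> 2 * \<bar>z\<bar>"
  proof -
    have "\<bar>ln (1 + z) - z\<bar> \<le> 2 * z\<^sup>2" using z2 by (rule abs_ln_one_plus_x_minus_x_bound)
    moreover have "2 * z\<^sup>2 \<le> \<bar>z\<bar>"
      using z2 mult_left_mono[of "\<bar>z\<bar>" "1/2" "\<bar>z\<bar>"] by (simp add: power2_eq_square)
    ultimately show ?thesis by linarith
  qed
  also have "\<dots> \<le> \<bar>v\<bar>" using z by linarith
  finally show ?thesis .
qed

lemma log_kernel_integrable:
  assumes \<psi>: "arcsine_bounded C \<psi>"
  shows "(\<lambda>t. ln \<bar>a - t\<bar> * \<psi> t) absolutely_integrable_on {-1<..<1}"
    and "(LINT t:{-1<..<1}|lebesgue. \<bar>ln \<bar>a - t\<bar> * \<psi> t\<bar>) \<le> (4 + (\<bar>a\<bar> + 1)\<^sup>2) * C * (64 + 8 * \<bar>a\<bar>)"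
proof -
  have m: "(\<lambda>t::real. ln \<bar>a - t\<bar>) \<in> borel_measurable (lebesgue_on {-1<..<1})"
    by (intro borel_measurable_ln borel_measurable_lebesgue_on_continuous continuous_intros)
  have b: "\<bar>ln \<bar>a - t\<bar>\<bar> \<le> (4 + (\<bar>a\<bar> + 1)\<^sup>2) * \<bar>t - a\<bar> powr (-1/4)" if "t \<in> {-1<..<1} - {a}" for t
    using abs_ln_le_powr[of "\<bar>a - t\<bar>" "\<bar>a\<bar> + 1"] that by (auto simp: abs_minus_commute)
  show "(\<lambda>t. ln \<bar>a - t\<bar> * \<psi> t) absolutely_integrable_on {-1<..<1}"
    "(LINT t:{-1<..<1}|lebesgue. \<bar>ln \<bar>a - t\<bar> * \<psi> t\<bar>) \<le> (4 + (\<bar>a\<bar> + 1)\<^sup>2) * C * (64 + 8 * \<bar>a\<bar>)"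
    using arcsine_weighted[OF \<psi> m b _ order_refl] by auto
qed

text \<open>A chord of small arc length \<open>\<epsilon> * \<bar>a - t\<bar>\<close> splits
  logarithmically into \<open>ln \<epsilon>\<close>, the kernel on the line and a small error. The
  offset \<open>a\<close> is measured from the centre of the charged arc in units of
  \<open>\<epsilon>\<close>, so the point may also lie on another arc.\<close>

lemma arc_potential_near:
  assumes \<psi>: "arcsine_bounded C \<psi>" and \<epsilon>: "0 < \<epsilon>" "\<epsilon> \<le> 1" and a: "\<epsilon> * (\<bar>a\<bar> + 1) \<le> 1"
  shows "\<bar>arc_potential \<epsilon> s \<psi> (circle_point (s + \<epsilon> * a))
     - (ln \<epsilon> * (LINT t:{-1<..<1}|lebesgue. \<psi> t) + (LINT t:{-1<..<1}|lebesgue. ln \<bar>a - t\<bar> * \<psi> t))\<bar>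
     \<le> 240 * (\<epsilon> * (\<bar>a\<bar> + 1)) * C"
proof -
  let ?I = "{-1<..<1::real}" and ?x = "circle_point (s + \<epsilon> * a)"
  let ?k = "\<lambda>t. ln (norm (?x - circle_point (s + \<epsilon> * t))) - ln \<epsilon> - ln \<bar>a - t\<bar>"
  have eq: "arc_potential \<epsilon> s \<psi> ?x - (ln \<epsilon> * (LINT t:?I|lebesgue. \<psi> t) + (LINT t:?I|lebesgue. ln \<bar>a - t\<bar> * \<psi> t))
    = (LINT t:?I|lebesgue. ?k t * \<psi> t)"
    unfolding arc_potential_def left_diff_distrib
    using arc_potential_integrable[OF \<psi> \<epsilon>] arcsine_integrable[OF \<psi>] log_kernel_integrable(1)[OF \<psi>]
    by (simp add: set_integral_diff set_integrable_mult_right)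
  show ?thesis unfolding eq
  proof (rule arcsine_kernel_bounded(3)[OF \<psi>])
    show "?k \<in> borel_measurable (lebesgue_on ?I)"
      by (intro borel_measurable_diff measurable_arc_ln borel_measurable_const borel_measurable_ln
          borel_measurable_lebesgue_on_continuous continuous_intros)
    show "\<bar>?k t\<bar> \<le> \<epsilon> * (\<bar>a\<bar> + 1)" if t: "t \<in> ?I - {a}" for t
    proof -
      define v where "v = \<epsilon> * (a - t) / 2"
      have v0: "v \<noteq> 0" using t \<epsilon> by (auto simp: v_def)
      have "\<bar>a - t\<bar> \<le> \<bar>a\<bar> + 1" using t by auto
      then have "\<epsilon> * \<bar>a - t\<bar> \<le> \<epsilon> * (\<bar>a\<bar> + 1)" using \<epsilon> by (intro mult_left_mono) auto
      moreover have av: "\<bar>v\<bar> = \<epsilon> * \<bar>a - t\<bar> / 2" using \<epsilon> by (simp add: v_def abs_mult)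
      ultimately have v1: "\<bar>v\<bar> \<le> \<epsilon> * (\<bar>a\<bar> + 1)" "\<bar>v\<bar> \<le> 1" using a by linarith+
      have "norm (?x - circle_point (s + \<epsilon> * t)) = 2 * \<bar>sin v\<bar>"
        unfolding norm_circle_point_diff v_def by (simp add: right_diff_distrib)
      moreover have "sin v \<noteq> 0"
      proof
        assume "sin v = 0"
        then have "\<bar>v\<bar> \<le> \<bar>v\<bar> ^ 3 / 6" using abs_sin_diff_le[of v] by simp
        moreover have "\<bar>v\<bar> ^ 3 \<le> \<bar>v\<bar> ^ 1" using v1 by (intro power_decreasing) auto
        ultimately show False using v0 by simp
      qed
      ultimately have "ln (norm (?x - circle_point (s + \<epsilon> * t))) = ln 2 + ln \<bar>sin v\<bar>"
        by (simp add: ln_mult_pos)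
      moreover have "ln \<bar>v\<bar> = ln \<epsilon> + ln \<bar>a - t\<bar> - ln 2"
        unfolding av using \<epsilon> t by (simp add: ln_div ln_mult_pos)
      ultimately have k: "?k t = ln \<bar>sin v\<bar> - ln \<bar>v\<bar>" by linarith
      show ?thesis unfolding k using ln_chord_ratio[OF v0 v1(2)] v1(1) by linarith
    qed
  qed (use \<epsilon> in auto)
qed

lemma abs_ln_diff_le:
  fixes r r' c :: real
  assumes "0 < c" "c \<le> r" "c \<le> r'"
  shows "\<bar>ln r - ln r'\<bar> \<le> \<bar>r - r'\<bar> / c"
proof -
  have *: "ln r - ln r' \<le> \<bar>r - r'\<bar> / c" if "c \<le> r" "c \<le> r'" for r r'
  proof -
    have "ln r - ln r' = ln (r / r')" using assms that by (simp add: ln_div)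
    also have "\<dots> \<le> r / r' - 1" using assms that by (intro ln_le_minus_one) auto
    also have "\<dots> = (r - r') / r'" using assms that by (simp add: field_simps)
    also have "\<dots> \<le> \<bar>r - r'\<bar> / r'" using assms that by (intro divide_right_mono) auto
    also have "\<dots> \<le> \<bar>r - r'\<bar> / c" using assms that by (intro divide_left_mono) auto
    finally show ?thesis .
  qed
  show ?thesis using *[OF assms(2,3)] *[OF assms(3,2)] by (simp add: abs_le_iff abs_minus_commute)
qed

text \<open>The reference point is again given by an offset \<open>a\<close>, so that the potential
  of one arc can be compared with the logarithm centred at any other arc.\<close>

lemma arc_potential_far:
  assumes \<psi>: "arcsine_bounded C \<psi>" and \<epsilon>: "0 < \<epsilon>" "\<epsilon> \<le> 1" and c: "0 < c"
    and far: "\<And>t. t \<in> {-1<..<1} \<Longrightarrow> c \<le> norm (x - circle_point (s + \<epsilon> * t))"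
      "c \<le> norm (x - circle_point (s + \<epsilon> * a))"
  shows "\<bar>arc_potential \<epsilon> s \<psi> x - ln (norm (x - circle_point (s + \<epsilon> * a))) * (LINT t:{-1<..<1}|lebesgue. \<psi> t)\<bar>
     \<le> 240 * (\<epsilon> * (\<bar>a\<bar> + 1) / c) * C"
proof -
  let ?I = "{-1<..<1::real}" and ?y = "circle_point (s + \<epsilon> * a)"
  let ?k = "\<lambda>t. ln (norm (x - circle_point (s + \<epsilon> * t))) - ln (norm (x - ?y))"
  have eq: "arc_potential \<epsilon> s \<psi> x - ln (norm (x - ?y)) * (LINT t:?I|lebesgue. \<psi> t)
    = (LINT t:?I|lebesgue. ?k t * \<psi> t)"
    unfolding arc_potential_def left_diff_distrib
    using arc_potential_integrable[OF \<psi> \<epsilon>] arcsine_integrable[OF \<psi>]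
    by (simp add: set_integral_diff set_integrable_mult_right)
  show ?thesis unfolding eq
  proof (rule arcsine_kernel_bounded(3)[OF \<psi>])
    show "?k \<in> borel_measurable (lebesgue_on ?I)"
      by (intro borel_measurable_diff measurable_arc_ln borel_measurable_const)
    show "\<bar>?k t\<bar> \<le> \<epsilon> * (\<bar>a\<bar> + 1) / c" if t: "t \<in> ?I - {}" for t
    proof -
      have "\<bar>?k t\<bar> \<le> \<bar>norm (x - circle_point (s + \<epsilon> * t)) - norm (x - ?y)\<bar> / c"
        using t by (intro abs_ln_diff_le c far) auto
      also have "\<bar>norm (x - circle_point (s + \<epsilon> * t)) - norm (x - ?y)\<bar> \<le> norm (?y - circle_point (s + \<epsilon> * t))"
        using norm_triangle_ineq3[of "x - circle_point (s + \<epsilon> * t)" "x - ?y"] by simp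
      also have "\<dots> \<le> \<bar>(s + \<epsilon> * a) - (s + \<epsilon> * t)\<bar>" by (rule norm_circle_point_diff_le)
      also have "\<dots> = \<epsilon> * \<bar>a - t\<bar>" using \<epsilon> by (simp add: right_diff_distrib[symmetric] abs_mult)
      also have "\<dots> \<le> \<epsilon> * (\<bar>a\<bar> + 1)" using t \<epsilon> by (intro mult_left_mono) auto
      finally show ?thesis using c by (simp add: divide_right_mono)
    qed
  qed (use \<epsilon> c in auto)
qed

section \<open>Symmetry of the logarithmic operator\<close>

text \<open>Fubini's theorem will be applied to a product of Borel measures, whereas the densities
  are only Lebesgue measurable; hence a Borel version, equal up to a null set.\<close>

lemma ex_borel_lebesgue_on:
  fixes f :: "real \<Rightarrow> real"
  assumes "f \<in> borel_measurable (lebesgue_on {-1<..<1})"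
  obtains g where "g \<in> borel_measurable lborel" "\<And>x. x \<notin> {-1<..<1} \<Longrightarrow> g x = 0"
    "AE x in lebesgue. indicator {-1<..<1} x * f x = g x"
proof -
  let ?I = "{-1<..<1::real}"
  have "(\<lambda>x. indicator ?I x * f x) \<in> borel_measurable lebesgue"
    using assms by (subst (asm) borel_measurable_restrict_space_iff) (auto simp: mult.commute)
  from completion_ex_borel_measurable_real[OF this]
  obtain g where g: "g \<in> borel_measurable lborel" "AE x in lborel. indicator ?I x * f x = g x" by blast
  show thesis
  proof (rule that)
    show "(\<lambda>x. indicator ?I x * g x) \<in> borel_measurable lborel" using g(1) by auto
    have "AE x in lebesgue. indicator ?I x * f x = g x" using g(2) by (rule AE_completion)
    then show "AE x in lebesgue. indicator ?I x * f x = indicator ?I x * g x"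
    proof eventually_elim
      case (elim x)
      then show ?case by (cases "x \<in> ?I") auto
    qed
  qed auto
qed

lemma set_integral_eq_lborel:
  fixes f g k :: "real \<Rightarrow> real"
  assumes f: "f \<in> borel_measurable (lebesgue_on {-1<..<1})"
    and g: "g \<in> borel_measurable lborel" "AE x in lebesgue. indicator {-1<..<1} x * f x = g x"
    and k: "k \<in> borel_measurable lborel"
  shows "(LINT x:{-1<..<1}|lebesgue. k x * f x) = (LINT x|lborel. k x * g x)"
    and "set_integrable lebesgue {-1<..<1} (\<lambda>x. k x * f x) \<longleftrightarrow> integrable lborel (\<lambda>x. k x * g x)"
proof -
  let ?I = "{-1<..<1::real}"
  have m: "(\<lambda>x. indicator ?I x * f x) \<in> borel_measurable lebesgue"
    using f by (subst (asm) borel_measurable_restrict_space_iff) (auto simp: mult.commute)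
  have k': "k \<in> borel_measurable lebesgue" using k by (rule measurable_completion)
  have m1: "(\<lambda>x. indicator ?I x *\<^sub>R (k x * f x)) \<in> borel_measurable lebesgue"
    using borel_measurable_times[OF k' m] by (simp add: mult_ac)
  have kg: "(\<lambda>x. k x * g x) \<in> borel_measurable lborel" using k g by auto
  have ae: "AE x in lebesgue. indicator ?I x *\<^sub>R (k x * f x) = k x * g x"
    using g(2) by eventually_elim (simp add: mult_ac)
  have "(LINT x:?I|lebesgue. k x * f x) = (LINT x|lebesgue. k x * g x)"
    unfolding set_lebesgue_integral_def
    by (rule integral_cong_AE[OF m1 measurable_completion[OF kg] ae])
  also have "\<dots> = (LINT x|lborel. k x * g x)" by (rule integral_completion[OF kg])
  finally show "(LINT x:?I|lebesgue. k x * f x) = (LINT x|lborel. k x * g x)" .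
  have "set_integrable lebesgue ?I (\<lambda>x. k x * f x) \<longleftrightarrow> integrable lebesgue (\<lambda>x. k x * g x)"
    unfolding set_integrable_def by (rule integrable_cong_AE[OF m1 measurable_completion[OF kg] ae])
  also have "\<dots> \<longleftrightarrow> integrable lborel (\<lambda>x. k x * g x)" by (rule integrable_completion[OF kg])
  finally show "set_integrable lebesgue ?I (\<lambda>x. k x * f x) \<longleftrightarrow> integrable lborel (\<lambda>x. k x * g x)" .
qed

text \<open>Fubini for a kernel with \<open>\<bar>\<delta> + s - t\<bar> = \<bar>- \<delta> + t -
  s\<bar>\<close>. Integrability of \<open>\<phi>\<close> is enough on one side because on the
  interval the integral of \<open>\<bar>ln \<bar>\<delta> + s - t\<bar> * \<psi> t\<bar>\<close>
  over \<open>t\<close> is bounded by \<open>M\<close>. The two integrability claims justify the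
  later exchange of sums and integrals.\<close>

lemma log_op_symmetric:
  assumes \<phi>: "\<phi> absolutely_integrable_on {-1<..<1}" and \<psi>: "arcsine_bounded C \<psi>"
  shows "(LINT s:{-1<..<1}|lebesgue. log_op \<delta> \<psi> s * \<phi> s) = (LINT t:{-1<..<1}|lebesgue. log_op (-\<delta>) \<phi> t * \<psi> t)"
    and "set_integrable lebesgue {-1<..<1} (\<lambda>s. log_op \<delta> \<psi> s * \<phi> s)"
    and "set_integrable lebesgue {-1<..<1} (\<lambda>t. log_op (-\<delta>) \<phi> t * \<psi> t)"
proof -
  let ?I = "{-1<..<1::real}"
  have m\<phi>: "\<phi> \<in> borel_measurable (lebesgue_on ?I)"
    using \<phi> by (simp add: absolutely_integrable_measurable)
  have m\<psi>: "\<psi> \<in> borel_measurable (lebesgue_on ?I)" using \<psi> by (simp add: arcsine_bounded_def)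
  obtain f where f: "f \<in> borel_measurable lborel" "\<And>x. x \<notin> ?I \<Longrightarrow> f x = 0"
    "AE x in lebesgue. indicator ?I x * \<phi> x = f x" using ex_borel_lebesgue_on[OF m\<phi>] by blast
  obtain g where g: "g \<in> borel_measurable lborel" "\<And>x. x \<notin> ?I \<Longrightarrow> g x = 0"
    "AE x in lebesgue. indicator ?I x * \<psi> x = g x" using ex_borel_lebesgue_on[OF m\<psi>] by blast
  note [measurable] = f(1) g(1)
  have K: "(\<lambda>(x, y). ln \<bar>\<delta> + x - y\<bar>) \<in> borel_measurable (lborel \<Otimes>\<^sub>M lborel)"
    "\<And>x. (\<lambda>y. ln \<bar>\<delta> + x - y\<bar>) \<in> borel_measurable lborel"
    "\<And>y. (\<lambda>x. ln \<bar>\<delta> + x - y\<bar>) \<in> borel_measurable lborel"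
    "\<And>y. (\<lambda>x. ln \<bar>-\<delta> + y - x\<bar>) \<in> borel_measurable lborel" by measurable
  have fi: "integrable lborel f"
    using set_integral_eq_lborel(2)[OF m\<phi> f(1,3), of "\<lambda>_. 1"] \<phi> by simp
  let ?F = "\<lambda>s t. ln \<bar>\<delta> + s - t\<bar> * f s * g t"
  define B where "B = \<bar>\<delta>\<bar> + 1"
  define M where "M = (4 + (B + 1)\<^sup>2) * C * (64 + 8 * B)"
  have C: "0 \<le> C" using \<psi> by (simp add: arcsine_bounded_def)
  have gi: "integrable lborel (\<lambda>t. ln \<bar>\<delta> + s - t\<bar> * g t)" for s
    using set_integral_eq_lborel(2)[OF m\<psi> g(1,3) K(2)] log_kernel_integrable(1)[OF \<psi>] by simp
  have gM: "(LINT t|lborel. \<bar>ln \<bar>\<delta> + s - t\<bar> * g t\<bar>) \<le> M" if s: "s \<in> ?I" for s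
  proof -
    have "AE x in lebesgue. indicator ?I x * \<bar>\<psi> x\<bar> = \<bar>g x\<bar>"
      using g(3) by eventually_elim (metis abs_indicator abs_mult)
    then have "(LINT t|lborel. \<bar>ln \<bar>\<delta> + s - t\<bar>\<bar> * \<bar>g t\<bar>) = (LINT t:?I|lebesgue. \<bar>ln \<bar>\<delta> + s - t\<bar>\<bar> * \<bar>\<psi> t\<bar>)"
      using K(2)[of s] m\<psi> g(1) by (intro set_integral_eq_lborel(1)[symmetric]) auto
    also have "\<dots> \<le> (4 + (\<bar>\<delta> + s\<bar> + 1)\<^sup>2) * C * (64 + 8 * \<bar>\<delta> + s\<bar>)"
      using log_kernel_integrable(2)[OF \<psi>, of "\<delta> + s"] by (simp add: abs_mult)
    also have "\<dots> \<le> M"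
    proof -
      have "\<bar>\<delta> + s\<bar> \<le> B" using s by (auto simp: B_def)
      then show ?thesis unfolding M_def using C
        by (intro mult_mono add_mono power_mono) auto
    qed
    finally show ?thesis by (simp add: abs_mult)
  qed
  have Fi: "integrable (lborel \<Otimes>\<^sub>M lborel) (case_prod ?F)"
  proof (rule lborel_pair.Fubini_integrable)
    show "case_prod ?F \<in> borel_measurable (lborel \<Otimes>\<^sub>M lborel)" by measurable
    show "AE x in lborel. integrable lborel (\<lambda>y. case (x, y) of (s, t) \<Rightarrow> ?F s t)"
      using integrable_mult_right[OF gi] by (intro AE_I2) (simp add: mult_ac)
    show "integrable lborel (\<lambda>x. \<integral>y. norm (case (x, y) of (s, t) \<Rightarrow> ?F s t) \<partial>lborel)"
    proof (rule Bochner_Integration.integrable_bound[OF integrable_mult_right[OF fi, of M]])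
      show "(\<lambda>x. \<integral>y. norm (case (x, y) of (s, t) \<Rightarrow> ?F s t) \<partial>lborel) \<in> borel_measurable lborel" by measurable
      show "AE s in lborel. norm (\<integral>y. norm (case (s, y) of (s, t) \<Rightarrow> ?F s t) \<partial>lborel) \<le> norm (M * f s)"
      proof (rule AE_I2)
        fix s
        have "(\<integral>y. norm (case (s, y) of (s, t) \<Rightarrow> ?F s t) \<partial>lborel) = \<bar>f s\<bar> * (LINT t|lborel. \<bar>ln \<bar>\<delta> + s - t\<bar> * g t\<bar>)"
          by (simp add: abs_mult mult_ac)
        moreover have "\<bar>\<bar>f s\<bar> * (LINT t|lborel. \<bar>ln \<bar>\<delta> + s - t\<bar> * g t\<bar>)\<bar> \<le> \<bar>M * f s\<bar>"
        proof (cases "s \<in> ?I")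
          case True
          have "0 \<le> (LINT t|lborel. \<bar>ln \<bar>\<delta> + s - t\<bar> * g t\<bar>)" by (rule Bochner_Integration.integral_nonneg) auto
          moreover from this have "0 \<le> M" using gM[OF True] by linarith
          ultimately show ?thesis using gM[OF True] mult_left_mono[OF gM[OF True], of "\<bar>f s\<bar>"]
            by (simp add: abs_mult mult_ac)
        qed (use f in simp)
        ultimately show "norm (\<integral>y. norm (case (s, y) of (s, t) \<Rightarrow> ?F s t) \<partial>lborel) \<le> norm (M * f s)" by simp
      qed
    qed
  qed
  have l\<psi>: "log_op \<delta> \<psi> s = (LINT t|lborel. ln \<bar>\<delta> + s - t\<bar> * g t)" for s
    unfolding log_op_def by (rule set_integral_eq_lborel(1)[OF m\<psi> g(1,3) K(2)])
  have l\<phi>: "log_op (-\<delta>) \<phi> t = (LINT s|lborel. ln \<bar>\<delta> + s - t\<bar> * f s)" for t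
  proof -
    have e: "\<bar>-\<delta> + t - s\<bar> = \<bar>\<delta> + s - t\<bar>" for s by linarith
    show ?thesis unfolding log_op_def
      using set_integral_eq_lborel(1)[OF m\<phi> f(1,3) K(4)[of t]] unfolding e .
  qed
  have mk: "(\<lambda>s. LINT t|lborel. ln \<bar>\<delta> + s - t\<bar> * g t) \<in> borel_measurable lborel"
    "(\<lambda>t. LINT s|lborel. ln \<bar>\<delta> + s - t\<bar> * f s) \<in> borel_measurable lborel" by measurable
  have e1: "(LINT t|lborel. ln \<bar>\<delta> + s - t\<bar> * g t) * f s = (LINT t|lborel. ?F s t)" for s
    by (subst integral_mult_left_zero[symmetric]) (simp add: mult_ac)
  have e2: "(LINT s|lborel. ln \<bar>\<delta> + s - t\<bar> * f s) * g t = (LINT s|lborel. ?F s t)" for t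
    by (subst integral_mult_left_zero[symmetric]) (simp add: mult_ac)
  show "(LINT s:?I|lebesgue. log_op \<delta> \<psi> s * \<phi> s) = (LINT t:?I|lebesgue. log_op (-\<delta>) \<phi> t * \<psi> t)"
    unfolding l\<psi> l\<phi> set_integral_eq_lborel(1)[OF m\<phi> f(1,3) mk(1)] set_integral_eq_lborel(1)[OF m\<psi> g(1,3) mk(2)]
      e1 e2
    by (rule lborel_pair.Fubini_integral[OF Fi, symmetric])
  show "set_integrable lebesgue ?I (\<lambda>s. log_op \<delta> \<psi> s * \<phi> s)"
    unfolding l\<psi> set_integral_eq_lborel(2)[OF m\<phi> f(1,3) mk(1)] e1
    using lborel_pair.integrable_fst'[OF Fi] by simp
  show "set_integrable lebesgue ?I (\<lambda>t. log_op (-\<delta>) \<phi> t * \<psi> t)"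
    unfolding l\<phi> set_integral_eq_lborel(2)[OF m\<psi> g(1,3) mk(2)] e2
    using lborel_pair.integrable_snd[OF Fi] by simp
qed

lemma arcsine_bounded_inverse_sqrt: "arcsine_bounded 1 (\<lambda>t. 1 / sqrt (1 - t\<^sup>2))"
  unfolding arcsine_bounded_def
proof (intro conjI)
  show "(\<lambda>t. 1 / sqrt (1 - t\<^sup>2)) \<in> borel_measurable (lebesgue_on {-1<..<1})"
    by (intro borel_measurable_divide borel_measurable_const borel_measurable_lebesgue_on_continuous continuous_intros)
qed (auto simp: abs_square_le_1)

lemma set_integral_sum:
  fixes f :: "'i \<Rightarrow> 'a \<Rightarrow> real"
  assumes "\<And>i. i \<in> I \<Longrightarrow> set_integrable M A (f i)"
  shows "(LINT x:A|M. (\<Sum>i\<in>I. f i x)) = (\<Sum>i\<in>I. LINT x:A|M. f i x)"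
  using assms unfolding set_lebesgue_integral_def set_integrable_def
  by (simp add: scaleR_sum_right Bochner_Integration.integral_sum del: real_scaleR_def)

text \<open>With \<open>w = sqrt (1 - x\<^sup>2)\<close>, expanding
  \<open>0 \<le> (w * \<bar>\<phi> x\<bar> - 1)\<^sup>2 / w\<close> bounds
  \<open>2 * \<bar>\<phi> x\<bar>\<close> by two integrable terms, a pointwise substitute for the
  Cauchy-Schwarz inequality.\<close>

lemma X1_integrable:
  assumes "\<phi> \<in> X1"
  shows "\<phi> absolutely_integrable_on {-1<..<1}"
proof -
  let ?I = "{-1<..<1::real}"
  have m: "\<phi> \<in> borel_measurable (lebesgue_on ?I)"
    using assms by (subst borel_measurable_restrict_space_iff) (auto simp: X1_def set_borel_measurable_def)
  have i1: "set_integrable lebesgue ?I (\<lambda>x. sqrt (1 - x\<^sup>2) * \<bar>\<phi> x\<bar>\<^sup>2)" using assms by (simp add: X1_def)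
  have i2: "set_integrable lebesgue ?I (\<lambda>x. 1 / sqrt (1 - x\<^sup>2))"
    by (rule arcsine_integrable[OF arcsine_bounded_inverse_sqrt])
  have le: "\<bar>\<phi> x\<bar> \<le> sqrt (1 - x\<^sup>2) * \<bar>\<phi> x\<bar>\<^sup>2 + 1 / sqrt (1 - x\<^sup>2)" if "x \<in> ?I" for x
  proof -
    define w where "w = sqrt (1 - x\<^sup>2)"
    have w: "0 < w" using that by (simp add: w_def abs_square_less_1 abs_less_iff)
    have "0 \<le> (w * \<bar>\<phi> x\<bar> - 1)\<^sup>2 / w" using w by simp
    also have "\<dots> = w * \<bar>\<phi> x\<bar>\<^sup>2 - 2 * \<bar>\<phi> x\<bar> + 1 / w"
      using w by (simp add: power2_eq_square field_simps)
    finally show ?thesis unfolding w_def by (smt (verit) abs_ge_zero)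
  qed
  show ?thesis
    by (rule measurable_bounded_by_integrable_imp_absolutely_integrable[OF m _
        set_lebesgue_integral_eq_integral(1)[OF set_integral_add(1)[OF i1 i2]]])
       (use le in auto)
qed

text \<open>Makes an explicit density an admissible argument: the choice made by
  \<open>inv_into\<close> is a genuine preimage only if some element of \<open>X1_vec\<close> is
  mapped to the constant 1.\<close>

lemma arcsine_bounded_X1:
  assumes "arcsine_bounded C \<psi>"
  shows "\<psi> \<in> X1"
proof -
  let ?I = "{-1<..<1::real}"
  have m: "\<psi> \<in> borel_measurable (lebesgue_on ?I)" using assms by (simp add: arcsine_bounded_def)
  have C: "0 \<le> C" using assms by (simp add: arcsine_bounded_def)
  have m2: "(\<lambda>x. sqrt (1 - x\<^sup>2) * \<bar>\<psi> x\<bar>\<^sup>2) \<in> borel_measurable (lebesgue_on ?I)"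
    by (intro borel_measurable_times borel_measurable_power borel_measurable_abs m
        borel_measurable_lebesgue_on_continuous continuous_intros)
  have i2: "set_integrable lebesgue ?I (\<lambda>x. C\<^sup>2 * (1 / sqrt (1 - x\<^sup>2)))"
    by (intro set_integrable_mult_right arcsine_integrable[OF arcsine_bounded_inverse_sqrt])
  have le: "sqrt (1 - x\<^sup>2) * \<bar>\<psi> x\<bar>\<^sup>2 \<le> C\<^sup>2 * (1 / sqrt (1 - x\<^sup>2))" if "x \<in> ?I" for x
  proof -
    define w where "w = sqrt (1 - x\<^sup>2)"
    have w: "0 < w" using that by (simp add: w_def abs_square_less_1 abs_less_iff)
    have "\<bar>\<psi> x\<bar> \<le> C / w" using assms that by (simp add: arcsine_bounded_def w_def)
    then have "w * \<bar>\<psi> x\<bar>\<^sup>2 \<le> w * (C / w)\<^sup>2" using w by (intro mult_left_mono power_mono) auto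
    also have "\<dots> = C\<^sup>2 * (1 / w)" using w by (simp add: power2_eq_square field_simps)
    finally show ?thesis by (simp add: w_def)
  qed
  have "(\<lambda>x. sqrt (1 - x\<^sup>2) * \<bar>\<psi> x\<bar>\<^sup>2) absolutely_integrable_on ?I"
    by (rule measurable_bounded_by_integrable_imp_absolutely_integrable[OF m2 _
        set_lebesgue_integral_eq_integral(1)[OF i2]])
       (use le in \<open>auto simp: abs_square_less_1 abs_mult less_imp_le abs_less_iff\<close>)
  moreover have "set_borel_measurable lebesgue ?I \<psi>"
    using m by (subst (asm) borel_measurable_restrict_space_iff) (auto simp: set_borel_measurable_def)
  ultimately show ?thesis by (simp add: X1_def)
qed

lemma set_integrable_vec:
  fixes f :: "'a \<Rightarrow> real ^ 'n::finite"
  assumes "\<And>i. set_integrable M A (\<lambda>t. f t $ i)"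
  shows "set_integrable M A f" "(LINT t:A|M. f t) $ i = (LINT t:A|M. f t $ i)"
proof -
  have e: "indicator A t *\<^sub>R f t = (\<Sum>i\<in>UNIV. (indicator A t *\<^sub>R f t $ i) *\<^sub>R axis i 1)" for t
    by (simp add: vec_eq_iff axis_def if_distrib sum.delta cong: if_cong)
  have "integrable M (\<lambda>t. \<Sum>i\<in>UNIV. (indicator A t *\<^sub>R f t $ i) *\<^sub>R (axis i 1 :: real ^ 'n))"
    using assms unfolding set_integrable_def
    by (intro Bochner_Integration.integrable_sum integrable_scaleR_left) auto
  then show i: "set_integrable M A f" unfolding set_integrable_def e[symmetric] .
  show "(LINT t:A|M. f t) $ i = (LINT t:A|M. f t $ i)"
    using integral_bounded_linear[OF bounded_linear_vec_nth i[unfolded set_integrable_def], of i]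
    unfolding set_lebesgue_integral_def by simp
qed

text \<open>Pairing an arbitrary solution of \<open>A \<phi> = 1\<close> with an explicit one shows that both have the same
  total integral, so the choice made by \<^const>\<open>inv_into\<close> does not matter.\<close>

lemma sum_log_alpha:
  fixes d :: "real ^ 'n::finite ^ 'n" and \<Psi> :: "real \<Rightarrow> real ^ 'n"
  assumes d: "\<And>i j. d $ j $ i = - d $ i $ j"
    and \<Psi>: "\<And>j. arcsine_bounded C (\<lambda>t. \<Psi> t $ j)"
    and A: "log_matrix_op d \<Psi> = (\<lambda>s\<in>{-1..1}. \<chi> i. 1)"
  shows "(\<Sum>i\<in>UNIV. log_alpha d $ i) = (\<Sum>j\<in>UNIV. LINT t:{-1<..<1}|lebesgue. \<Psi> t $ j)"
proof -
  let ?I = "{-1<..<1::real}" and ?one = "\<lambda>s\<in>{-1..1}. (\<chi> i. 1) :: real ^ 'n"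
  define \<Phi> where "\<Phi> = inv_into X1_vec (log_matrix_op d) ?one"
  have "\<Psi> \<in> X1_vec" using arcsine_bounded_X1[OF \<Psi>] by (simp add: X1_vec_def)
  then have im: "?one \<in> log_matrix_op d ` X1_vec" using A by (metis image_eqI)
  have \<Phi>1: "\<Phi> \<in> X1_vec" unfolding \<Phi>_def using im by (rule inv_into_into)
  have \<Phi>A: "log_matrix_op d \<Phi> = ?one" unfolding \<Phi>_def using im by (rule f_inv_into_f)
  have \<Phi>i: "(\<lambda>t. \<Phi> t $ i) absolutely_integrable_on ?I" for i
    using \<Phi>1 by (intro X1_integrable) (simp add: X1_vec_def)
  have eq1: "(\<Sum>j\<in>UNIV. log_op (d $ i $ j) (\<lambda>t. F t $ j) s) = 1"
    if "log_matrix_op d F = ?one" "s \<in> ?I" for F s i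
  proof -
    have "log_matrix_op d F s $ i = 1" using that by auto
    then show ?thesis using that(2) by (simp add: log_matrix_op_def)
  qed
  have "(\<Sum>i\<in>UNIV. log_alpha d $ i) = (\<Sum>i\<in>UNIV. LINT t:?I|lebesgue. \<Phi> t $ i)"
    unfolding log_alpha_def \<Phi>_def[symmetric] using set_integrable_vec(2)[OF \<Phi>i] by simp
  \<comment> \<open>An inserted factor 1 is written as row \<open>i\<close> of the system solved by
    \<open>\<Psi>\<close>.\<close>
  also have "\<dots> = (\<Sum>i\<in>UNIV. LINT s:?I|lebesgue. (\<Sum>j\<in>UNIV. log_op (d $ i $ j) (\<lambda>t. \<Psi> t $ j) s * \<Phi> s $ i))"
    using eq1[OF A] by (intro sum.cong refl set_lebesgue_integral_cong) (auto simp: sum_distrib_right[symmetric])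
  also have "\<dots> = (\<Sum>i\<in>UNIV. \<Sum>j\<in>UNIV. LINT s:?I|lebesgue. log_op (d $ i $ j) (\<lambda>t. \<Psi> t $ j) s * \<Phi> s $ i)"
    using log_op_symmetric(2)[OF \<Phi>i \<Psi>] by (intro sum.cong refl set_integral_sum) auto
  \<comment> \<open>The transposed kernel has offset \<open>- d $ i $ j = d $ j $ i\<close>, so the
    rows of the same operator reappear, now applied to \<open>\<Phi>\<close>.\<close>
  also have "\<dots> = (\<Sum>i\<in>UNIV. \<Sum>j\<in>UNIV. LINT t:?I|lebesgue. log_op (d $ j $ i) (\<lambda>t. \<Phi> t $ i) t * \<Psi> t $ j)"
    unfolding log_op_symmetric(1)[OF \<Phi>i \<Psi>] d[symmetric] ..
  also have "\<dots> = (\<Sum>j\<in>UNIV. \<Sum>i\<in>UNIV. LINT t:?I|lebesgue. log_op (d $ j $ i) (\<lambda>t. \<Phi> t $ i) t * \<Psi> t $ j)"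
    by (rule sum.swap)
  also have "\<dots> = (\<Sum>j\<in>UNIV. LINT t:?I|lebesgue. (\<Sum>i\<in>UNIV. log_op (d $ j $ i) (\<lambda>t. \<Phi> t $ i) t * \<Psi> t $ j))"
    using log_op_symmetric(3)[OF \<Phi>i \<Psi>, of "- d $ j $ i" for j i]
    by (intro sum.cong refl set_integral_sum[symmetric]) simp
  also have "\<dots> = (\<Sum>j\<in>UNIV. LINT t:?I|lebesgue. \<Psi> t $ j)"
    using eq1[OF \<Phi>A] by (intro sum.cong refl set_lebesgue_integral_cong) (auto simp: sum_distrib_right[symmetric])
  finally show ?thesis .
qed

section \<open>An algebraic function with prescribed cuts\<close>

text \<open>The boundary of the right half plane is parametrized by \<open>\<i> t\<close>, so that \<open>csqrt\<close> and \<open>Ln\<close> with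
  their standard cuts are holomorphic there.\<close>

definition sqrt_at :: "real \<Rightarrow> complex \<Rightarrow> complex" where
  "sqrt_at a z = csqrt (z - \<i> * of_real a)"

text \<open>For \<open>s \<noteq> 0\<close> this is the eighth root of unity with argument
  \<open>pi / 4 * sgn s\<close>, the phase of the principal square root of
  \<open>\<i> * s\<close>.\<close>

definition unit8 :: "real \<Rightarrow> complex" where
  "unit8 s = Complex (1 / sqrt 2) (sgn s / sqrt 2)"

lemma unit8_mult: "unit8 1 * unit8 1 = \<i>" "unit8 (-1) * unit8 (-1) = -\<i>" "unit8 1 * unit8 (-1) = 1"
  "unit8 (-1) * unit8 1 = 1"
  by (auto simp: unit8_def complex_eq_iff)

lemma unit8_sgn: "unit8 s = (if s > 0 then unit8 1 else if s < 0 then unit8 (-1) else unit8 0)"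
  by (auto simp: unit8_def)

lemma csqrt_imaginary:
  assumes "s \<noteq> 0"
  shows "csqrt (\<i> * of_real s) = of_real (sqrt \<bar>s\<bar>) * unit8 s"
proof (rule csqrt_unique)
  have u: "(unit8 s)\<^sup>2 = \<i> * of_real (sgn s)"
    using assms by (subst (1) unit8_sgn) (auto simp: power2_eq_square unit8_mult)
  show "(of_real (sqrt \<bar>s\<bar>) * unit8 s)\<^sup>2 = \<i> * of_real s"
    unfolding power_mult_distrib u of_real_power[symmetric]
    by (simp add: mult.commute[of _ \<i>] flip: of_real_mult) (simp add: mult.assoc mult_sgn_abs mult.commute[of "sgn s"] abs_mult_sgn)
  show "0 < Re (of_real (sqrt \<bar>s\<bar>) * unit8 s) \<or>
    Re (of_real (sqrt \<bar>s\<bar>) * unit8 s) = 0 \<and> 0 \<le> Im (of_real (sqrt \<bar>s\<bar>) * unit8 s)"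
    using assms by (simp add: unit8_def)
qed

lemma sqrt_at_boundary:
  assumes "t \<noteq> a"
  shows "((\<lambda>\<eta>. sqrt_at a (Complex \<eta> t)) \<longlongrightarrow> of_real (sqrt \<bar>t - a\<bar>) * unit8 (t - a)) (at_right 0)"
proof -
  let ?w = "\<i> * of_real (t - a)"
  have "?w \<notin> \<real>\<^sub>\<le>\<^sub>0" using assms by (auto simp: complex_nonpos_Reals_iff)
  then have "isCont csqrt ?w" by (rule continuous_at_csqrt)
  moreover have "((\<lambda>\<eta>. Complex \<eta> t - \<i> * of_real a) \<longlongrightarrow> ?w) (at_right 0)"
    by (auto simp: Complex_eq ring_distribs intro!: tendsto_eq_intros)
  ultimately have "((\<lambda>\<eta>. csqrt (Complex \<eta> t - \<i> * of_real a)) \<longlongrightarrow> csqrt ?w) (at_right 0)"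
    by (rule isCont_tendsto_compose)
  then show ?thesis unfolding sqrt_at_def using csqrt_imaginary[of "t - a"] assms by simp
qed

lemma sqrt_at_holomorphic: "sqrt_at a holomorphic_on {z. Re z > 0}"
  unfolding sqrt_at_def by (intro holomorphic_intros) (auto simp: complex_nonpos_Reals_iff)

lemma sqrt_at_power2: "(sqrt_at a z)\<^sup>2 = z - \<i> * of_real a"
  by (simp add: sqrt_at_def)

lemma norm_sqrt_at: "norm (sqrt_at a z) = sqrt (norm (z - \<i> * of_real a))"
  by (simp add: sqrt_at_def norm_csqrt)

text \<open>The real part of the square is \<open>Re z > 0\<close>, so the root lies in the open
  sector of half angle pi/4 around the positive axis. Hence products of two such roots stay in the
  right half plane, and in sums of two nothing cancels.\<close>

lemma sqrt_at_sector:
  assumes "Re z > 0"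
  shows "\<bar>Im (sqrt_at a z)\<bar> < Re (sqrt_at a z)"
proof -
  have "Re (sqrt_at a z) ^ 2 - Im (sqrt_at a z) ^ 2 = Re z"
    using arg_cong[OF sqrt_at_power2[of a z], of Re] by (simp add: power2_eq_square)
  then have "\<bar>Im (sqrt_at a z)\<bar>\<^sup>2 < (Re (sqrt_at a z))\<^sup>2" using assms by simp
  moreover have "0 \<le> Re (sqrt_at a z)" using csqrt_principal[of "z - \<i> * of_real a"] by (auto simp: sqrt_at_def)
  ultimately show ?thesis by (rule power2_less_imp_less)
qed

lemma sqrt_at_mult_Re_pos:
  assumes "Re z > 0"
  shows "Re (sqrt_at a z * sqrt_at b z) > 0"
proof -
  have "\<bar>Im (sqrt_at a z)\<bar> * \<bar>Im (sqrt_at b z)\<bar> < Re (sqrt_at a z) * Re (sqrt_at b z)"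
    using sqrt_at_sector[OF assms, of a] sqrt_at_sector[OF assms, of b] by (intro mult_strict_mono') auto
  then have "Im (sqrt_at a z) * Im (sqrt_at b z) < Re (sqrt_at a z) * Re (sqrt_at b z)"
    using abs_ge_self[of "Im (sqrt_at a z) * Im (sqrt_at b z)"] unfolding abs_mult by linarith
  then show ?thesis by simp
qed

lemma sqrt_at_add_norm_ge:
  assumes "Re z > 0"
  shows "norm (sqrt_at a z) \<le> norm (sqrt_at a z + sqrt_at b z)"
proof -
  let ?u = "sqrt_at a z" and ?v = "sqrt_at b z"
  have "\<bar>Im ?u\<bar> * \<bar>Im ?v\<bar> \<le> Re ?u * Re ?v"
    using sqrt_at_sector[OF assms, of a] sqrt_at_sector[OF assms, of b] by (intro mult_mono) auto
  then have "- (Im ?u * Im ?v) \<le> Re ?u * Re ?v"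
    using abs_ge_minus_self[of "Im ?u * Im ?v"] unfolding abs_mult by linarith
  then have "(norm ?u)\<^sup>2 \<le> (norm (?u + ?v))\<^sup>2"
    unfolding cmod_power2 plus_complex.sel power2_sum
    using zero_le_power2[of "Re ?v"] zero_le_power2[of "Im ?v"] by linarith
  then show ?thesis by (rule power2_le_imp_le) simp
qed

lemma sqrt_at_nonzero: "Re z > 0 \<Longrightarrow> sqrt_at a z \<noteq> 0"
  using sqrt_at_sector[of z a] by auto

lemma norm_strip_ge: "\<bar>t - a\<bar> \<le> norm (Complex \<eta> t - \<i> * of_real a)"
  using abs_Im_le_cmod[of "Complex \<eta> t - \<i> * of_real a"] by simp

lemma norm_strip_le: "norm (Complex \<eta> t - \<i> * of_real a) \<le> \<bar>\<eta>\<bar> + \<bar>t\<bar> + \<bar>a\<bar>"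
  using cmod_le[of "Complex \<eta> t - \<i> * of_real a"] by simp

text \<open>The points of \<open>N\<close> are distinct, so \<open>t\<close> can be close to only
  one of them and the other factors are bounded; the product is therefore no worse than the
  sum.\<close>

lemma prod_inverse_sqrt_le:
  fixes N :: "real set"
  assumes "finite N"
  shows "\<exists>K\<ge>0. \<forall>t. t \<notin> N \<longrightarrow> (\<Prod>e\<in>N. \<bar>t - e\<bar> powr (-1/2)) \<le> K * (1 + (\<Sum>e\<in>N. \<bar>t - e\<bar> powr (-1/2)))"
  using assms
proof (induction N)
  case empty
  then show ?case by (auto intro!: exI[of _ 1])
next
  case (insert x N)
  then obtain K where K: "K \<ge> 0" "\<And>t. t \<notin> N \<Longrightarrow> (\<Prod>e\<in>N. \<bar>t - e\<bar> powr (-1/2)) \<le> K * (1 + (\<Sum>e\<in>N. \<bar>t - e\<bar> powr (-1/2)))"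
    by blast
  define D where "D e = (\<bar>x - e\<bar> / 2) powr (-1/2)" for e
  define S where "S t = (\<Sum>e\<in>N. \<bar>t - e\<bar> powr (-1/2))" for t
  \<comment> \<open>One of the distances from \<open>t\<close> to \<open>x\<close> and to
    \<open>e\<close> is at least half of \<open>\<bar>x - e\<bar>\<close>; the factor belonging to
    it is at most \<open>D e\<close>.\<close>
  have pair: "\<bar>t - x\<bar> powr (-1/2) * \<bar>t - e\<bar> powr (-1/2) \<le> D e * (\<bar>t - x\<bar> powr (-1/2) + \<bar>t - e\<bar> powr (-1/2))"
    if "e \<in> N" for t e
  proof -
    have xe: "0 < \<bar>x - e\<bar> / 2" using that insert.hyps by auto
    have tri: "\<bar>x - e\<bar> \<le> \<bar>t - x\<bar> + \<bar>t - e\<bar>" by linarith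
    show ?thesis
    proof (cases "\<bar>x - e\<bar> \<le> 2 * \<bar>t - x\<bar>")
      case True
      then have "\<bar>t - x\<bar> powr (-1/2) \<le> D e" unfolding D_def using xe by (intro powr_mono2') auto
      then have "\<bar>t - x\<bar> powr (-1/2) * \<bar>t - e\<bar> powr (-1/2) \<le> D e * \<bar>t - e\<bar> powr (-1/2)" by (intro mult_right_mono) auto
      moreover have "0 \<le> D e * \<bar>t - x\<bar> powr (-1/2)" by (simp add: D_def)
      ultimately show ?thesis unfolding distrib_left by linarith
    next
      case False
      then have "\<bar>x - e\<bar> \<le> 2 * \<bar>t - e\<bar>" using tri by argo
      then have "\<bar>t - e\<bar> powr (-1/2) \<le> D e" unfolding D_def using xe by (intro powr_mono2') auto
      then have "\<bar>t - x\<bar> powr (-1/2) * \<bar>t - e\<bar> powr (-1/2) \<le> \<bar>t - x\<bar> powr (-1/2) * D e" by (intro mult_left_mono) auto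
      moreover have "0 \<le> D e * \<bar>t - e\<bar> powr (-1/2)" by (simp add: D_def)
      ultimately show ?thesis unfolding distrib_left by (simp only: mult.commute[of "D e"])
    qed
  qed
  define M where "M = 1 + (\<Sum>e\<in>N. D e)"
  have De: "0 \<le> D e" "e \<in> N \<Longrightarrow> D e \<le> M" for e
    unfolding M_def using insert.hyps member_le_sum[of e N D] by (auto simp: D_def)
  have M: "0 \<le> M" unfolding M_def using De(1) by (simp add: sum_nonneg)
  show ?case
  proof (intro exI[of _ "K * (1 + M)"] conjI allI impI)
    show "0 \<le> K * (1 + M)" using K M by simp
    fix t assume t: "t \<notin> insert x N"
    let ?a = "\<bar>t - x\<bar> powr (-1/2)"
    have "?a * S t = (\<Sum>e\<in>N. ?a * \<bar>t - e\<bar> powr (-1/2))" unfolding S_def by (rule sum_distrib_left)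
    also have "\<dots> \<le> (\<Sum>e\<in>N. D e * ?a + M * \<bar>t - e\<bar> powr (-1/2))"
    proof (rule sum_mono)
      fix e assume e: "e \<in> N"
      have "D e * \<bar>t - e\<bar> powr (-1/2) \<le> M * \<bar>t - e\<bar> powr (-1/2)" using De(2)[OF e] by (intro mult_right_mono) auto
      then show "?a * \<bar>t - e\<bar> powr (-1/2) \<le> D e * ?a + M * \<bar>t - e\<bar> powr (-1/2)"
        using pair[OF e, of t] unfolding distrib_left by linarith
    qed
    also have "\<dots> = (M - 1) * ?a + M * S t" by (simp add: sum.distrib sum_distrib_left sum_distrib_right M_def S_def)
    finally have aS: "?a + ?a * S t \<le> M * (?a + S t)" by (simp add: algebra_simps)
    have S0: "0 \<le> S t" "0 \<le> ?a" by (auto simp: S_def sum_nonneg)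
    have "?a * (\<Prod>e\<in>N. \<bar>t - e\<bar> powr (-1/2)) \<le> ?a * (K * (1 + S t))"
      using K(2)[of t] t unfolding S_def by (intro mult_left_mono) auto
    also have "\<dots> = K * (?a + ?a * S t)" by (simp add: algebra_simps)
    also have "\<dots> \<le> K * (M * (?a + S t))" by (rule mult_left_mono[OF aS K(1)])
    also have "\<dots> \<le> K * ((1 + M) * (1 + (?a + S t)))" using K M S0 by (intro mult_left_mono mult_mono) auto
    finally show "(\<Prod>e\<in>insert x N. \<bar>t - e\<bar> powr (-1/2)) \<le> K * (1 + M) * (1 + (\<Sum>e\<in>insert x N. \<bar>t - e\<bar> powr (-1/2)))"
      using insert.hyps by (simp add: S_def mult.assoc)
  qed
qed

section \<open>The algebraic function for several intervals: boundary values, domination,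
  decay\<close>

locale interval_system =
  fixes p :: "'n::finite \<Rightarrow> real"
  assumes sep: "i \<noteq> j \<Longrightarrow> \<bar>p i - p j\<bar> > 2"
begin

definition ends :: "real set" where
  "ends = range (\<lambda>j. p j - 1) \<union> range (\<lambda>j. p j + 1)"

text \<open>A branch of the square root of \<open>(z - \<i> * p j)\<^sup>2 + 1\<close>, factored
  over its branch points so that each factor is a principal root, holomorphic in the right half
  plane.\<close>

definition hroot :: "'n \<Rightarrow> complex \<Rightarrow> complex" where
  "hroot j z = sqrt_at (p j - 1) z * sqrt_at (p j + 1) z"

text \<open>The numerators are written in the Lagrange basis at the centres. This parametrizes the
  polynomials of degree below \<open>n\<close> by the index type of the intervals, so that
  coefficients and boundary constants have the same dimension by their type.\<close>

definition alg :: "('n \<Rightarrow> real) \<Rightarrow> complex \<Rightarrow> complex" where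
  "alg c z = (\<Sum>k\<in>UNIV. of_real (c k) * (\<Prod>j\<in>UNIV - {k}. z - \<i> * of_real (p j))) / (\<Prod>j\<in>UNIV. hroot j z)"

definition numer :: "('n \<Rightarrow> real) \<Rightarrow> real \<Rightarrow> real" where
  "numer c t = (\<Sum>k\<in>UNIV. c k * (\<Prod>j\<in>UNIV - {k}. t - p j))"

text \<open>The reciprocal modulus of \<open>hroot\<close> on the boundary, with the sign that is
  left after the phase \<open>- \<i>\<close> has been split off outside the interval.\<close>

definition weight :: "'n \<Rightarrow> real \<Rightarrow> real" where
  "weight j t = (if \<bar>t - p j\<bar> < 1 then 1 else sgn (t - p j)) / sqrt \<bar>1 - (t - p j)\<^sup>2\<bar>"

definition inside :: "real \<Rightarrow> bool" where
  "inside t \<longleftrightarrow> (\<exists>m. \<bar>t - p m\<bar> < 1)"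

text \<open>\<open>dens\<close> and \<open>slope\<close> are the real and imaginary parts of the
  boundary values of \<open>alg\<close>. The first is the charge density, supported on the
  intervals; the second vanishes on them and gives the derivative of the potential elsewhere, up to
  the factor -pi.\<close>

definition dens :: "('n \<Rightarrow> real) \<Rightarrow> real \<Rightarrow> real" where
  "dens c t = (if inside t then numer c t * (\<Prod>j\<in>UNIV. weight j t) else 0)"

definition slope :: "('n \<Rightarrow> real) \<Rightarrow> real \<Rightarrow> real" where
  "slope c t = (if inside t then 0 else - (numer c t * (\<Prod>j\<in>UNIV. weight j t)))"

lemma finite_ends [simp]: "finite ends" by (simp add: ends_def)

lemma inside_unique: "\<bar>t - p i\<bar> < 1 \<Longrightarrow> \<bar>t - p j\<bar> \<le> 1 \<Longrightarrow> i = j"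
  using sep[of i j] by (cases "i = j") (auto simp: abs_if split: if_splits)

lemma hroot_holomorphic: "hroot j holomorphic_on {z. Re z > 0}"
  unfolding hroot_def by (intro holomorphic_intros sqrt_at_holomorphic)

lemma hroot_nonzero: "Re z > 0 \<Longrightarrow> hroot j z \<noteq> 0"
  by (simp add: hroot_def sqrt_at_nonzero)

lemma alg_holomorphic: "alg c holomorphic_on {z. Re z > 0}"
  unfolding alg_def by (intro holomorphic_intros hroot_holomorphic) (auto simp: hroot_nonzero)

lemma ends_iff: "t \<in> ends \<longleftrightarrow> (\<exists>j. \<bar>t - p j\<bar> = 1)"
proof
  assume "t \<in> ends"
  then obtain j where "t = p j - 1 \<or> t = p j + 1" by (auto simp: ends_def)
  then have "\<bar>t - p j\<bar> = 1" by auto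
  then show "\<exists>j. \<bar>t - p j\<bar> = 1" by blast
next
  assume "\<exists>j. \<bar>t - p j\<bar> = 1"
  then obtain j where "\<bar>t - p j\<bar> = 1" by blast
  then have "t = p j - 1 \<or> t = p j + 1" by linarith
  then show "t \<in> ends" by (auto simp: ends_def)
qed

text \<open>Between the two branch points the phases of the roots are conjugate and cancel; beyond
  them they agree and multiply to \<open>\<i>\<close> or \<open>- \<i>\<close>, whose sign goes into
  \<open>weight\<close>.\<close>

lemma hroot_boundary:
  assumes "t \<notin> ends"
  shows "((\<lambda>\<eta>. inverse (hroot j (Complex \<eta> t))) \<longlongrightarrow> (if \<bar>t - p j\<bar> < 1 then 1 else - \<i>) * of_real (weight j t)) (at_right 0)"
proof -
  have "\<bar>t - p j\<bar> \<noteq> 1" using assms ends_iff by blast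
  then have ne: "t \<noteq> p j - 1" "t \<noteq> p j + 1" "\<bar>t - p j\<bar> \<noteq> 1" by auto
  let ?H = "(of_real (sqrt \<bar>t - (p j - 1)\<bar>) * unit8 (t - (p j - 1))) * (of_real (sqrt \<bar>t - (p j + 1)\<bar>) * unit8 (t - (p j + 1)))"
  have H: "((\<lambda>\<eta>. hroot j (Complex \<eta> t)) \<longlongrightarrow> ?H) (at_right 0)"
    unfolding hroot_def using ne by (intro tendsto_mult sqrt_at_boundary) auto
  have "\<bar>t - (p j - 1)\<bar> * \<bar>t - (p j + 1)\<bar> = \<bar>1 - (t - p j)\<^sup>2\<bar>"
    unfolding abs_mult[symmetric] abs_minus_commute[of 1] by (simp add: power2_eq_square algebra_simps)
  then have s: "sqrt \<bar>t - (p j - 1)\<bar> * sqrt \<bar>t - (p j + 1)\<bar> = sqrt \<bar>1 - (t - p j)\<^sup>2\<bar>"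
    by (simp only: real_sqrt_mult[symmetric])
  have Heq: "?H = of_real (sqrt \<bar>1 - (t - p j)\<^sup>2\<bar>) * (unit8 (t - (p j - 1)) * unit8 (t - (p j + 1)))"
    unfolding s[symmetric] by simp
  have sq: "(t - p j)\<^sup>2 \<noteq> 1" using ne by (simp add: power2_eq_1_iff abs_if split: if_splits)
  from sq have pos: "sqrt \<bar>1 - (t - p j)\<^sup>2\<bar> > 0" by auto
  consider "\<bar>t - p j\<bar> < 1" | "t - p j > 1" | "t - p j < -1" using ne by linarith
  then have "?H \<noteq> 0 \<and> inverse ?H = (if \<bar>t - p j\<bar> < 1 then 1 else - \<i>) * of_real (weight j t)"
  proof cases
    case 1
    then have "unit8 (t - (p j - 1)) * unit8 (t - (p j + 1)) = 1"
      by (subst (1 2) unit8_sgn) (auto simp: unit8_mult)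
    then show ?thesis unfolding Heq using 1 pos by (simp add: weight_def inverse_eq_divide)
  next
    case 2
    then have "unit8 (t - (p j - 1)) * unit8 (t - (p j + 1)) = \<i>"
      by (subst (1 2) unit8_sgn) (auto simp: unit8_mult)
    then show ?thesis unfolding Heq using 2 pos sq by (simp add: weight_def inverse_eq_divide divide_simps)
  next
    case 3
    then have "unit8 (t - (p j - 1)) * unit8 (t - (p j + 1)) = - \<i>"
      by (subst (1 2) unit8_sgn) (auto simp: unit8_mult)
    then show ?thesis unfolding Heq using 3 pos sq by (simp add: weight_def inverse_eq_divide divide_simps)
  qed
  then show ?thesis using tendsto_inverse[OF H] by simp
qed

text \<open>Phase count: the numerator contributes one \<open>\<i>\<close> for each interval but
  one, every interval not containing \<open>t\<close> contributes \<open>- \<i>\<close>. If one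
  interval contains \<open>t\<close> these cancel completely; otherwise a single
  \<open>- \<i>\<close> remains.\<close>

lemma alg_boundary:
  assumes "t \<notin> ends"
  shows "((\<lambda>\<eta>. alg c (Complex \<eta> t)) \<longlongrightarrow> Complex (dens c t) (slope c t)) (at_right 0)"
proof -
  define n where "n = CARD('n) - 1"
  let ?u = "\<lambda>j. if \<bar>t - p j\<bar> < 1 then 1 else - \<i>"
  have cd: "card (UNIV - {k} :: 'n set) = n" for k by (simp add: n_def card_Diff_singleton)
  have num: "((\<lambda>\<eta>. \<Sum>k\<in>UNIV. of_real (c k) * (\<Prod>j\<in>UNIV - {k}. Complex \<eta> t - \<i> * of_real (p j)))
      \<longlongrightarrow> (\<Sum>k\<in>UNIV. of_real (c k) * (\<Prod>j\<in>UNIV - {k}. \<i> * of_real (t - p j)))) (at_right 0)"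
    by (intro tendsto_sum tendsto_mult tendsto_const tendsto_prod)
       (auto simp: Complex_eq ring_distribs intro!: tendsto_eq_intros)
  have den: "((\<lambda>\<eta>. \<Prod>j\<in>UNIV. inverse (hroot j (Complex \<eta> t))) \<longlongrightarrow>
      (\<Prod>j\<in>UNIV. ?u j * of_real (weight j t))) (at_right 0)"
    by (intro tendsto_prod hroot_boundary assms)
  have n: "(\<Sum>k\<in>UNIV. of_real (c k) * (\<Prod>j\<in>UNIV - {k}. \<i> * of_real (t - p j))) = \<i> ^ n * of_real (numer c t)"
  proof -
    have "(\<Prod>j\<in>UNIV - {k}. \<i> * of_real (t - p j)) = \<i> ^ n * of_real (\<Prod>j\<in>UNIV - {k}. t - p j)" for k
      by (simp only: prod.distrib prod_constant cd of_real_prod)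
    then show ?thesis unfolding numer_def by (simp only: of_real_sum of_real_mult sum_distrib_left mult_ac)
  qed
  have d: "(\<Prod>j\<in>UNIV. ?u j * of_real (weight j t)) = (\<Prod>j\<in>UNIV. ?u j) * of_real (\<Prod>j\<in>UNIV. weight j t)"
    by (simp add: prod.distrib)
  have iu: "\<i> ^ n * (\<Prod>j\<in>UNIV. ?u j) = (if inside t then 1 else - \<i>)"
  proof (cases "inside t")
    case True
    then obtain m where m: "\<bar>t - p m\<bar> < 1" by (auto simp: inside_def)
    have "(\<Prod>j\<in>UNIV. ?u j) = ?u m * (\<Prod>j\<in>UNIV - {m}. ?u j)" by (rule prod.remove) auto
    also have "(\<Prod>j\<in>UNIV - {m}. ?u j) = (\<Prod>j\<in>UNIV - {m}. - \<i>)"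
      using inside_unique[OF m] by (intro prod.cong) (auto dest: less_imp_le)
    finally have "(\<Prod>j\<in>UNIV. ?u j) = (- \<i>) ^ n" using m by (simp add: cd)
    then show ?thesis using True by (simp flip: power_mult_distrib)
  next
    case False
    then have "(\<Prod>j\<in>UNIV. ?u j) = (\<Prod>j\<in>(UNIV :: 'n set). - \<i>)" by (intro prod.cong) (auto simp: inside_def)
    also have "\<dots> = (- \<i>) * (\<Prod>j\<in>UNIV - {undefined :: 'n}. - \<i>)" by (rule prod.remove) auto
    finally have "(\<Prod>j\<in>UNIV. ?u j) = - \<i> * (- \<i>) ^ n" by (simp only: prod_constant cd)
    then have "\<i> ^ n * (\<Prod>j\<in>UNIV. ?u j) = - \<i> * (\<i> ^ n * (- \<i>) ^ n)" by (simp only: mult_ac)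
    also have "\<dots> = - \<i>" by (simp flip: power_mult_distrib)
    finally show ?thesis using False by simp
  qed
  have "\<i> ^ n * of_real (numer c t) * ((\<Prod>j\<in>UNIV. ?u j) * of_real (\<Prod>j\<in>UNIV. weight j t))
     = (\<i> ^ n * (\<Prod>j\<in>UNIV. ?u j)) * of_real (numer c t * (\<Prod>j\<in>UNIV. weight j t))"
    by (simp only: of_real_mult mult_ac)
  also have "\<dots> = Complex (dens c t) (slope c t)"
    unfolding iu by (auto simp: dens_def slope_def complex_eq_iff simp del: of_real_prod)
  finally show ?thesis
    using tendsto_mult[OF num den] unfolding n d alg_def
    by (simp only: divide_inverse prod_inversef[symmetric] o_def)
qed

text \<open>A majorant independent of the distance to the boundary, for dominated convergence. It
  exists because each root is at least as large as at the boundary point with the same imaginary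
  part.\<close>

lemma alg_strip_bound:
  fixes T :: real
  assumes T: "0 \<le> T"
  shows "\<exists>K\<ge>0. \<forall>\<eta> t. 0 < \<eta> \<longrightarrow> \<eta> \<le> 1 \<longrightarrow> \<bar>t\<bar> \<le> T \<longrightarrow> t \<notin> ends \<longrightarrow>
     norm (alg c (Complex \<eta> t)) \<le> K * (1 + (\<Sum>e\<in>ends. \<bar>t - e\<bar> powr (-1/2)))"
proof -
  obtain K where K: "K \<ge> 0" "\<And>t. t \<notin> ends \<Longrightarrow> (\<Prod>e\<in>ends. \<bar>t - e\<bar> powr (-1/2)) \<le> K * (1 + (\<Sum>e\<in>ends. \<bar>t - e\<bar> powr (-1/2)))"
    using prod_inverse_sqrt_le[OF finite_ends] by blast
  define M where "M = (\<Sum>k\<in>UNIV. \<bar>c k\<bar> * (\<Prod>j\<in>UNIV - {k}. 1 + T + \<bar>p j\<bar>))"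
  have M: "0 \<le> M" unfolding M_def using T by (intro sum_nonneg mult_nonneg_nonneg prod_nonneg) auto
  show ?thesis
  proof (intro exI[of _ "M * K"] conjI allI impI)
    show "0 \<le> M * K" using M K by simp
    fix \<eta> t :: real assume h: "0 < \<eta>" "\<eta> \<le> 1" "\<bar>t\<bar> \<le> T" "t \<notin> ends"
    let ?z = "Complex \<eta> t"
    have num: "norm (\<Sum>k\<in>UNIV. of_real (c k) * (\<Prod>j\<in>UNIV - {k}. ?z - \<i> * of_real (p j))) \<le> M"
      unfolding M_def
    proof (rule sum_norm_le)
      fix k
      have "(\<Prod>j\<in>UNIV - {k}. norm (?z - \<i> * of_real (p j))) \<le> (\<Prod>j\<in>UNIV - {k}. 1 + T + \<bar>p j\<bar>)"
      proof (rule prod_mono, intro conjI)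
        show "norm (?z - \<i> * of_real (p j)) \<le> 1 + T + \<bar>p j\<bar>" for j
          using norm_strip_le[of \<eta> t "p j"] h by linarith
      qed simp
      then show "norm (of_real (c k) * (\<Prod>j\<in>UNIV - {k}. ?z - \<i> * of_real (p j))) \<le> \<bar>c k\<bar> * (\<Prod>j\<in>UNIV - {k}. 1 + T + \<bar>p j\<bar>)"
        by (simp add: norm_mult prod_norm[symmetric] mult_left_mono)
    qed
    have inv: "inverse (norm (sqrt_at e ?z)) \<le> \<bar>t - e\<bar> powr (-1/2)" if "t \<noteq> e" for e
    proof -
      have "inverse (sqrt (norm (?z - \<i> * of_real e))) \<le> inverse (sqrt \<bar>t - e\<bar>)"
        using norm_strip_ge[of t e \<eta>] that by (intro le_imp_inverse_le) auto
      also have "\<dots> = \<bar>t - e\<bar> powr (-1/2)" by (simp add: powr_minus powr_half_sqrt)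
      finally show ?thesis by (simp add: norm_sqrt_at)
    qed
    \<comment> \<open>Left and right endpoints could only coincide for centres exactly 2 apart. All
      endpoints being distinct, each inverse root occurs once in the product over
      \<open>ends\<close>.\<close>
    have disj: "range (\<lambda>j. p j - 1) \<inter> range (\<lambda>j. p j + 1) = {}"
    proof -
      have "p i - 1 \<noteq> p j + 1" for i j using sep[of i j] by (cases "i = j") auto
      then show ?thesis by auto
    qed
    have "inj p" using sep by (intro injI) fastforce
    then have inj: "inj (\<lambda>j. p j - 1)" "inj (\<lambda>j. p j + 1)" by (auto simp: inj_def)
    have "norm (inverse (\<Prod>j\<in>UNIV. hroot j ?z)) = (\<Prod>j\<in>UNIV. inverse (norm (sqrt_at (p j - 1) ?z)) * inverse (norm (sqrt_at (p j + 1) ?z)))"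
      by (simp add: norm_inverse prod_norm[symmetric] hroot_def norm_mult prod_inversef[symmetric] o_def)
    also have "\<dots> = (\<Prod>e\<in>ends. inverse (norm (sqrt_at e ?z)))"
      unfolding ends_def by (subst prod.union_disjoint) (auto simp: disj prod.reindex[OF inj(1)] prod.reindex[OF inj(2)] prod.distrib)
    also have "\<dots> \<le> (\<Prod>e\<in>ends. \<bar>t - e\<bar> powr (-1/2))"
    proof (rule prod_mono, intro conjI)
      fix e assume "e \<in> ends"
      then have "t \<noteq> e" using h by auto
      then show "inverse (norm (sqrt_at e ?z)) \<le> \<bar>t - e\<bar> powr (-1/2)" by (rule inv)
    qed simp
    also have "\<dots> \<le> K * (1 + (\<Sum>e\<in>ends. \<bar>t - e\<bar> powr (-1/2)))" using K h by blast
    finally have den: "norm (inverse (\<Prod>j\<in>UNIV. hroot j ?z)) \<le> K * (1 + (\<Sum>e\<in>ends. \<bar>t - e\<bar> powr (-1/2)))" .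
    have "norm (alg c ?z) \<le> M * (K * (1 + (\<Sum>e\<in>ends. \<bar>t - e\<bar> powr (-1/2))))"
      using mult_mono[OF num den M norm_ge_zero] by (simp only: alg_def divide_inverse[of "sum _ _"] norm_mult)
    then show "norm (alg c ?z) \<le> M * K * (1 + (\<Sum>e\<in>ends. \<bar>t - e\<bar> powr (-1/2)))" by (simp add: mult.assoc)
  qed
qed

text \<open>A numerator of degree below \<open>n\<close> against a denominator growing like the
  \<open>n\<close>-th power. The radius makes all branch points at most half as large as
  \<open>norm z\<close>.\<close>

lemma alg_decay:
  shows "\<exists>R>0. \<exists>C\<ge>0. \<forall>z. R \<le> norm z \<longrightarrow> norm (alg c z) \<le> C / norm z"
proof -
  define R where "R = 2 * (1 + (\<Sum>j\<in>UNIV. \<bar>p j\<bar> + 1))"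
  have R1: "R > 0" unfolding R_def by (auto intro!: add_pos_nonneg sum_nonneg)
  have pR: "2 * (\<bar>p j\<bar> + 1) \<le> R" for j
    using member_le_sum[of j UNIV "\<lambda>j. \<bar>p j\<bar> + 1"] by (simp add: R_def)
  define n where "n = CARD('n) - 1"
  have cd: "card (UNIV - {k} :: 'n set) = n" for k by (simp add: n_def card_Diff_singleton)
  have cU: "card (UNIV :: 'n set) = Suc n" by (simp add: n_def)
  define C where "C = (\<Sum>k\<in>UNIV. \<bar>c k\<bar>) * 2 ^ n * 2 ^ Suc n"
  show ?thesis
  proof (rule exI[of _ R], rule conjI[OF R1], rule exI[of _ C], intro conjI allI impI)
    show "C \<ge> 0" unfolding C_def by (auto intro!: sum_nonneg mult_nonneg_nonneg)
    fix z :: complex assume z: "R \<le> norm z"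
    then have z0: "0 < norm z" using R1 by linarith
    have up: "norm (z - \<i> * of_real (p j)) \<le> 2 * norm z" for j
      using norm_triangle_ineq4[of z "\<i> * of_real (p j)"] pR[of j] z by (simp add: norm_mult)
    have low: "norm z / 2 \<le> norm (z - \<i> * of_real e)" if "\<bar>e\<bar> \<le> \<bar>p j\<bar> + 1" for e j
      using norm_triangle_ineq2[of z "\<i> * of_real e"] pR[of j] z that by (simp add: norm_mult)
    have h: "norm z / 2 \<le> norm (hroot j z)" for j
    proof -
      have "norm z / 2 = sqrt (norm z / 2) * sqrt (norm z / 2)" by simp
      also have "\<dots> \<le> sqrt (norm (z - \<i> * of_real (p j - 1))) * sqrt (norm (z - \<i> * of_real (p j + 1)))"
        by (intro mult_mono real_sqrt_le_mono low[of _ j]) auto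
      finally show ?thesis by (simp add: hroot_def norm_mult norm_sqrt_at)
    qed
    have num: "norm (\<Sum>k\<in>UNIV. of_real (c k) * (\<Prod>j\<in>UNIV - {k}. z - \<i> * of_real (p j))) \<le> (\<Sum>k\<in>UNIV. \<bar>c k\<bar> * (2 * norm z) ^ n)"
    proof (rule sum_norm_le)
      fix k
      have "(\<Prod>j\<in>UNIV - {k}. norm (z - \<i> * of_real (p j))) \<le> (\<Prod>j\<in>UNIV - {k}. 2 * norm z)"
        using up by (intro prod_mono) auto
      also have "\<dots> = (2 * norm z) ^ n" by (simp only: prod_constant cd)
      finally show "norm (of_real (c k) * (\<Prod>j\<in>UNIV - {k}. z - \<i> * of_real (p j))) \<le> \<bar>c k\<bar> * (2 * norm z) ^ n"
        by (simp add: norm_mult prod_norm[symmetric] mult_left_mono)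
    qed
    have den: "(norm z / 2) ^ Suc n \<le> norm (\<Prod>j\<in>UNIV. hroot j z)"
    proof -
      have "(norm z / 2) ^ Suc n = (\<Prod>j\<in>(UNIV :: 'n set). norm z / 2)" by (simp only: prod_constant cU)
      also have "\<dots> \<le> (\<Prod>j\<in>UNIV. norm (hroot j z))" using h by (intro prod_mono) auto
      finally show ?thesis by (simp add: prod_norm)
    qed
    have "norm (alg c z) \<le> (\<Sum>k\<in>UNIV. \<bar>c k\<bar> * (2 * norm z) ^ n) / (norm z / 2) ^ Suc n"
      unfolding alg_def norm_divide using z0 by (intro frac_le num den) (auto intro!: sum_nonneg)
    also have "\<dots> = C / norm z"
      unfolding C_def sum_distrib_right[symmetric] using z0
      by (simp add: power_mult_distrib power_divide field_simps)
    finally show "norm (alg c z) \<le> C / norm z" .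
  qed
qed

lemma dens_far: "\<exists>R. \<forall>t. R \<le> \<bar>t\<bar> \<longrightarrow> dens c t = 0"
proof -
  define R where "R = 1 + (\<Sum>j\<in>UNIV. \<bar>p j\<bar> + 1)"
  have pR: "\<bar>p j\<bar> + 1 < R" for j
    using member_le_sum[of j UNIV "\<lambda>j. \<bar>p j\<bar> + 1"] by (simp add: R_def)
  have "\<not> inside t" if "R \<le> \<bar>t\<bar>" for t
  proof
    assume "inside t"
    then obtain m where "\<bar>t - p m\<bar> < 1" by (auto simp: inside_def)
    then show False using pR[of m] that by linarith
  qed
  then show ?thesis by (auto simp: dens_def)
qed

text \<open>Cauchy's theorem for \<open>alg c z * L z\<close>, whose boundary value has the
  displayed integrand as real part. Each factor decays like \<open>1 / norm z\<close>, together fast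
  enough. Singularities of \<open>L\<close> of order 1/4 times those of \<open>alg\<close> of order
  1/2 remain integrable. Different choices of \<open>L\<close> yield the oscillation and the value
  of the potential.\<close>

lemma boundary_identity:
  fixes L :: "complex \<Rightarrow> complex" and L0 :: "real \<Rightarrow> complex" and N :: "real set"
  assumes L: "L holomorphic_on {z. Re z > 0}" and N: "finite N"
    and lim: "\<And>t. t \<notin> N \<Longrightarrow> ((\<lambda>\<eta>. L (Complex \<eta> t)) \<longlongrightarrow> L0 t) (at_right 0)"
    and strip: "\<And>T. 0 < T \<Longrightarrow> \<exists>K\<ge>0. \<forall>(\<eta>::real) (t::real). 0 < \<eta> \<longrightarrow> \<eta> \<le> 1 \<longrightarrow> \<bar>t\<bar> \<le> T \<longrightarrow> t \<notin> N \<longrightarrow>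
     norm (L (Complex \<eta> t)) \<le> K * (1 + (\<Sum>e\<in>N. \<bar>t - e\<bar> powr (-1/4)))"
    and decay: "\<exists>R>0. \<exists>C\<ge>0. \<forall>z. 0 < Re z \<longrightarrow> R \<le> norm z \<longrightarrow> norm (L z) \<le> C / norm z"
    and far: "\<exists>R. \<forall>t. R \<le> \<bar>t\<bar> \<longrightarrow> Im (L0 t) = 0"
  shows "\<forall>\<^sub>F R in at_top. ((\<lambda>t. dens c t * Re (L0 t) - slope c t * Im (L0 t)) has_integral 0) {-R..R}"
proof -
  obtain R1 C1 where 1: "R1 > 0" "C1 \<ge> 0" "\<And>z. R1 \<le> norm z \<Longrightarrow> norm (alg c z) \<le> C1 / norm z"
    using alg_decay by blast
  obtain R2 C2 where 2: "R2 > 0" "C2 \<ge> 0" "\<And>z. 0 < Re z \<Longrightarrow> R2 \<le> norm z \<Longrightarrow> norm (L z) \<le> C2 / norm z"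
    using decay by blast
  obtain R3 where 3: "\<And>t. R3 \<le> \<bar>t\<bar> \<Longrightarrow> dens c t = 0" using dens_far by blast
  obtain R4 where 4: "\<And>t. R4 \<le> \<bar>t\<bar> \<Longrightarrow> Im (L0 t) = 0" using far by blast
  have *: "((\<lambda>t. dens c t * Re (L0 t) - slope c t * Im (L0 t)) has_integral 0) {-R..R}"
    if R: "R \<ge> R1" "R \<ge> R2" "R \<ge> R3" "R \<ge> R4" for R
  proof -
    have "\<exists>K\<ge>0. \<forall>(\<eta>::real) (t::real). 0 < \<eta> \<longrightarrow> \<eta> \<le> 1 \<longrightarrow> \<bar>t\<bar> \<le> T \<longrightarrow> t \<notin> ends \<union> N \<longrightarrow> norm (alg c (Complex \<eta> t) * L (Complex \<eta> t))
      \<le> K * ((1 + (\<Sum>e\<in>ends. \<bar>t - e\<bar> powr (-1/2))) * (1 + (\<Sum>e\<in>N. \<bar>t - e\<bar> powr (-1/4))))" if T: "0 < T" for T :: real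
    proof -
      obtain K where K: "K \<ge> 0" "\<And>(\<eta>::real) (t::real). 0 < \<eta> \<Longrightarrow> \<eta> \<le> 1 \<Longrightarrow> \<bar>t\<bar> \<le> T \<Longrightarrow> t \<notin> ends \<Longrightarrow>
          norm (alg c (Complex \<eta> t)) \<le> K * (1 + (\<Sum>e\<in>ends. \<bar>t - e\<bar> powr (-1/2)))"
        using alg_strip_bound[of T c] T by (auto simp: less_imp_le)
      obtain K' where K': "K' \<ge> 0" "\<And>(\<eta>::real) (t::real). 0 < \<eta> \<Longrightarrow> \<eta> \<le> 1 \<Longrightarrow> \<bar>t\<bar> \<le> T \<Longrightarrow> t \<notin> N \<Longrightarrow>
          norm (L (Complex \<eta> t)) \<le> K' * (1 + (\<Sum>e\<in>N. \<bar>t - e\<bar> powr (-1/4)))"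
        using strip[OF T] by auto
      show ?thesis
      proof (intro exI[of _ "K * K'"] conjI allI impI)
        show "0 \<le> K * K'" using K K' by simp
        fix \<eta> t :: real assume h: "0 < \<eta>" "\<eta> \<le> 1" "\<bar>t\<bar> \<le> T" "t \<notin> ends \<union> N"
        have "norm (alg c (Complex \<eta> t) * L (Complex \<eta> t))
          \<le> (K * (1 + (\<Sum>e\<in>ends. \<bar>t - e\<bar> powr (-1/2)))) * (K' * (1 + (\<Sum>e\<in>N. \<bar>t - e\<bar> powr (-1/4))))"
          unfolding norm_mult using h K by (intro mult_mono K K') (auto intro!: sum_nonneg mult_nonneg_nonneg add_nonneg_nonneg)
        then show "norm (alg c (Complex \<eta> t) * L (Complex \<eta> t))
          \<le> K * K' * ((1 + (\<Sum>e\<in>ends. \<bar>t - e\<bar> powr (-1/2))) * (1 + (\<Sum>e\<in>N. \<bar>t - e\<bar> powr (-1/4))))"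
          by (simp only: mult_ac)
      qed
    qed
    then obtain K where K: "\<And>T::real. 0 < T \<Longrightarrow> K T \<ge> (0::real)"
      "\<And>(T::real) (\<eta>::real) (t::real). 0 < T \<Longrightarrow> 0 < \<eta> \<Longrightarrow> \<eta> \<le> 1 \<Longrightarrow> \<bar>t\<bar> \<le> T \<Longrightarrow> t \<notin> ends \<union> N \<Longrightarrow> norm (alg c (Complex \<eta> t) * L (Complex \<eta> t))
        \<le> K T * ((1 + (\<Sum>e\<in>ends. \<bar>t - e\<bar> powr (-1/2))) * (1 + (\<Sum>e\<in>N. \<bar>t - e\<bar> powr (-1/4))))"
      by metis
    let ?s = "\<lambda>e t::real. \<bar>t - e\<bar> powr (-3/4)"
    define g where "g T t = K T * (1 + (\<Sum>e\<in>N. 1 + ?s e t) + ((\<Sum>e\<in>ends. 1 + ?s e t) + (\<Sum>e\<in>N. \<Sum>f\<in>ends. ?s e t + ?s f t)))" for T t :: real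
    have prod: "(1 + (\<Sum>e\<in>ends. \<bar>t - e\<bar> powr (-1/2))) * (1 + (\<Sum>e\<in>N. \<bar>t - e\<bar> powr (-1/4)))
      \<le> 1 + (\<Sum>e\<in>N. 1 + ?s e t) + ((\<Sum>e\<in>ends. 1 + ?s e t) + (\<Sum>e\<in>N. \<Sum>f\<in>ends. ?s e t + ?s f t))" for t :: real
    proof -
      have "(1 + (\<Sum>e\<in>ends. \<bar>t - e\<bar> powr (-1/2))) * (1 + (\<Sum>e\<in>N. \<bar>t - e\<bar> powr (-1/4)))
        = 1 + (\<Sum>e\<in>N. \<bar>t - e\<bar> powr (-1/4)) + ((\<Sum>e\<in>ends. \<bar>t - e\<bar> powr (-1/2))
          + (\<Sum>e\<in>N. \<Sum>f\<in>ends. \<bar>t - e\<bar> powr (-1/4) * \<bar>t - f\<bar> powr (-1/2)))"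
        unfolding sum_product[symmetric] by (simp add: algebra_simps)
      also have "\<dots> \<le> 1 + (\<Sum>e\<in>N. 1 + ?s e t) + ((\<Sum>e\<in>ends. 1 + ?s e t) + (\<Sum>e\<in>N. \<Sum>f\<in>ends. ?s e t + ?s f t))"
      proof (intro add_mono sum_mono order_refl)
        show "\<bar>t - e\<bar> powr (-1/4) * \<bar>t - f\<bar> powr (-1/2) \<le> ?s e t + ?s f t" for e f
          by (rule powr_quarter_half_le) auto
        show "\<bar>t - e\<bar> powr (-1/4) \<le> 1 + ?s e t" for e using powr_quarter_half_le[of "\<bar>t - e\<bar>" 1] by simp
        show "\<bar>t - e\<bar> powr (-1/2) \<le> 1 + ?s e t" for e using powr_quarter_half_le[of 1 "\<bar>t - e\<bar>"] by simp
      qed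
      finally show ?thesis .
    qed
    have "((\<lambda>t. Re (Complex (dens c t) (slope c t) * L0 t)) has_integral 0) {-R..R}"
    proof (rule half_plane_boundary_integral[where h = "\<lambda>z. alg c z * L z" and N = "ends \<union> N" and C = "C1 * C2" and g = g])
      show "(\<lambda>z. alg c z * L z) holomorphic_on {z. 0 < Re z}" by (intro holomorphic_intros alg_holomorphic L)
      fix z assume z: "0 < Re z" "R \<le> norm z"
      have "norm (alg c z * L z) \<le> (C1 / norm z) * (C2 / norm z)"
        unfolding norm_mult using z R 1 2 by (intro mult_mono 1(3) 2(3)) auto
      then show "norm (alg c z * L z) \<le> C1 * C2 / (norm z)\<^sup>2" by (simp add: power2_eq_square)
    next
      fix t assume "t \<notin> ends \<union> N"
      then show "((\<lambda>\<eta>. alg c (Complex \<eta> t) * L (Complex \<eta> t)) \<longlongrightarrow> Complex (dens c t) (slope c t) * L0 t) (at_right 0)"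
        by (intro tendsto_mult alg_boundary lim) auto
    next
      fix T :: real assume T: "0 < T"
      have cst: "(\<lambda>t::real. k::real) absolutely_integrable_on {-T..T}" for k by (auto intro!: absolutely_integrable_on_const)
      show "g T absolutely_integrable_on {-T..T}" unfolding g_def
        by (intro set_integrable_mult_right set_integral_add absolutely_integrable_sum sing_integrable cst finite_ends N)
    next
      fix T \<eta> t :: real assume "0 < T" "0 < \<eta>" "\<eta> \<le> 1" "\<bar>t\<bar> \<le> T" "t \<notin> ends \<union> N"
      from order_trans[OF K(2)[OF this] mult_left_mono[OF prod[of t] K(1)[OF this(1)]]]
      show "norm (alg c (Complex \<eta> t) * L (Complex \<eta> t)) \<le> g T t" unfolding g_def .
    next
      fix t assume "R \<le> \<bar>t\<bar>"
      then have "dens c t = 0" "Im (L0 t) = 0" using R 3 4 by auto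
      then show "Re (Complex (dens c t) (slope c t) * L0 t) = 0" by simp
    next
      show "0 < R" using R 1 by linarith
    qed (use N in auto)
    then show ?thesis by simp
  qed
  show ?thesis
    by (rule eventually_at_top_linorderI[of "max (max R1 R2) (max R3 R4)"]) (rule *; simp)
qed

end

section \<open>Logarithmic potentials of the boundary densities\<close>

lemma Ln_imaginary:
  assumes "s \<noteq> 0"
  shows "Ln (\<i> * of_real s) = Complex (ln \<bar>s\<bar>) (pi / 2 * sgn s)"
proof -
  have "exp (Complex (ln \<bar>s\<bar>) (pi / 2 * sgn s)) = \<i> * of_real s"
    using assms by (cases "s > 0") (auto simp: exp_eq_polar complex_eq_iff cis.sel)
  moreover have "Ln (exp (Complex (ln \<bar>s\<bar>) (pi / 2 * sgn s))) = Complex (ln \<bar>s\<bar>) (pi / 2 * sgn s)"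
    by (rule Ln_exp) (use assms in \<open>auto simp: sgn_if\<close>)
  ultimately show ?thesis by simp
qed

lemma Ln_boundary:
  assumes "t \<noteq> x"
  shows "((\<lambda>\<eta>. Ln (Complex \<eta> t - \<i> * of_real x)) \<longlongrightarrow> Complex (ln \<bar>t - x\<bar>) (pi / 2 * sgn (t - x))) (at_right 0)"
proof -
  let ?w = "\<i> * of_real (t - x)"
  have "?w \<notin> \<real>\<^sub>\<le>\<^sub>0" using assms by (auto simp: complex_nonpos_Reals_iff)
  moreover have "((\<lambda>\<eta>. Complex \<eta> t - \<i> * of_real x) \<longlongrightarrow> ?w) (at_right 0)"
    by (auto simp: Complex_eq ring_distribs intro!: tendsto_eq_intros)
  ultimately have "((\<lambda>\<eta>. Ln (Complex \<eta> t - \<i> * of_real x)) \<longlongrightarrow> Ln ?w) (at_right 0)"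
    by (intro tendsto_Ln)
  then show ?thesis using Ln_imaginary[of "t - x"] assms by simp
qed

lemma norm_Ln_le_pi: "norm (Ln w) \<le> \<bar>ln (norm w)\<bar> + pi" if "w \<noteq> 0"
proof -
  have "norm (Ln w) \<le> \<bar>Re (Ln w)\<bar> + \<bar>Im (Ln w)\<bar>" by (rule cmod_le)
  moreover have "Re (Ln w) = ln (norm w)" using that by simp
  moreover have "\<bar>Im (Ln w)\<bar> \<le> pi" using mpi_less_Im_Ln[OF that] Im_Ln_le_pi[OF that] by linarith
  ultimately show ?thesis by linarith
qed

lemma Ln_strip_bound:
  fixes T x :: real
  assumes "0 < T"
  shows "\<exists>K\<ge>0. \<forall>(\<eta>::real) (t::real). 0 < \<eta> \<longrightarrow> \<eta> \<le> 1 \<longrightarrow> \<bar>t\<bar> \<le> T \<longrightarrow> t \<noteq> x \<longrightarrow>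
     norm (Ln (Complex \<eta> t - \<i> * of_real x)) \<le> K * (1 + \<bar>t - x\<bar> powr (-1/4))"
proof -
  define B where "B = 1 + T + \<bar>x\<bar>"
  define K where "K = 4 + B\<^sup>2 + pi"
  show ?thesis
  proof (intro exI[of _ K] conjI allI impI)
    show "0 \<le> K" by (simp add: K_def)
    fix \<eta> t :: real assume h: "0 < \<eta>" "\<eta> \<le> 1" "\<bar>t\<bar> \<le> T" "t \<noteq> x"
    let ?w = "Complex \<eta> t - \<i> * of_real x"
    have lo: "\<bar>t - x\<bar> \<le> norm ?w" by (rule norm_strip_ge)
    have hi: "norm ?w \<le> B" using norm_strip_le[of \<eta> t x] h by (simp add: B_def)
    have w: "0 < norm ?w" using lo h by linarith
    have "norm (Ln ?w) \<le> \<bar>ln (norm ?w)\<bar> + pi" using w by (intro norm_Ln_le_pi) auto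
    also have "\<bar>ln (norm ?w)\<bar> \<le> (4 + B\<^sup>2) * norm ?w powr (-1/4)"
      using w hi assms by (intro abs_ln_le_powr) (auto simp: B_def)
    also have "\<dots> \<le> (4 + B\<^sup>2) * \<bar>t - x\<bar> powr (-1/4)"
      using lo h by (intro mult_left_mono powr_mono2') auto
    also have "\<dots> \<le> K * \<bar>t - x\<bar> powr (-1/4)" unfolding K_def by (intro mult_right_mono) auto
    also have "pi \<le> K" by (simp add: K_def)
    finally show "norm (Ln ?w) \<le> K * (1 + \<bar>t - x\<bar> powr (-1/4))" by (simp add: distrib_left add.commute)
  qed
qed

text \<open>Both arguments lie strictly between -pi/2 and pi/2, so their difference does not cross
  the branch cut.\<close>

lemma Ln_diff_right_half_plane:
  assumes "Re w > 0" "Re v > 0"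
  shows "Ln w - Ln v = Ln (w / v)"
proof -
  have "w \<noteq> 0" "v \<noteq> 0" using assms by auto
  then have "exp (Ln w - Ln v) = w / v" by (simp add: exp_diff)
  moreover have "Ln (exp (Ln w - Ln v)) = Ln w - Ln v"
    by (rule Ln_exp) (use Re_Ln_pos_lt_imp[OF assms(1)] Re_Ln_pos_lt_imp[OF assms(2)] in auto)
  ultimately show ?thesis by simp
qed

lemma Ln_diff_decay:
  fixes G :: "complex \<Rightarrow> complex"
  assumes G: "\<And>z. Re z > 0 \<Longrightarrow> Re (G z) > 0"
    and R: "R0 > 0" "D \<ge> 0" "\<And>z. Re z > 0 \<Longrightarrow> R0 \<le> norm z \<Longrightarrow> norm (G z / (z - \<i> * of_real x) - 1) \<le> D / norm (z - \<i> * of_real x)"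
  shows "\<exists>R>0. \<exists>C\<ge>0. \<forall>z. 0 < Re z \<longrightarrow> R \<le> norm z \<longrightarrow> norm (Ln (z - \<i> * of_real x) - Ln (G z)) \<le> C / norm z"
proof -
  \<comment> \<open>The term \<open>2 * \<bar>x\<bar>\<close> ensures
    \<open>norm z \<le> 2 * norm (z - \<i> * x)\<close>, and \<open>4 * D\<close> makes the relative
    error less than 1/2, where \<open>Ln (1 + y)\<close> is bounded by
    \<open>2 * norm y\<close>.\<close>
  define R where "R = R0 + 2 * \<bar>x\<bar> + 4 * D + 1"
  have RR: "R > 0" using R by (simp add: R_def add_pos_nonneg)
  show ?thesis
  proof (rule exI[of _ R], rule conjI[OF RR], rule exI[of _ "4 * D"], intro conjI allI impI)
    show "0 \<le> 4 * D" using R by simp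
    fix z assume z: "0 < Re z" "R \<le> norm z"
    let ?w = "z - \<i> * of_real x"
    have "norm z - \<bar>x\<bar> \<le> norm ?w" using norm_triangle_ineq2[of z "\<i> * of_real x"] by (simp add: norm_mult)
    then have w: "norm z \<le> 2 * norm ?w" using z R by (simp add: R_def)
    have zp: "0 < norm z" using z by auto
    have wp: "0 < norm ?w" using w zp by linarith
    have dw: "D / norm ?w \<le> 2 * D / norm z" using w zp wp R(2) mult_left_mono[OF w R(2)] by (simp add: field_simps)
    have "4 * D < norm z" using z R by (simp add: R_def)
    then have dz: "2 * D / norm z < 1/2" using zp by (simp add: divide_less_eq)
    have rw: "Re ?w > 0" using z by simp
    have "R0 \<le> norm z" using z R by (simp add: R_def)
    from order_trans[OF R(3)[OF z(1) this] dw] have G1: "norm (G z / ?w - 1) \<le> 2 * D / norm z" .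
    have "norm (Ln (1 + (G z / ?w - 1))) \<le> 2 * norm (G z / ?w - 1)" using G1 dz by (intro norm_Ln_le) linarith
    moreover have "Ln (G z) - Ln ?w = Ln (G z / ?w)" by (rule Ln_diff_right_half_plane[OF G[OF z(1)] rw])
    ultimately have "norm (Ln (G z) - Ln ?w) \<le> 4 * D / norm z" using G1 by simp
    then show "norm (Ln ?w - Ln (G z)) \<le> 4 * D / norm z" by (simp only: norm_minus_commute)
  qed
qed

lemma has_integral_shift_unit:
  fixes f :: "real \<Rightarrow> real"
  assumes "((\<lambda>t. f (q + t)) has_integral I) {-1<..<1}"
  shows "(f has_integral I) {q - 1<..<q + 1}"
proof -
  have "((\<lambda>t. f (t + q)) has_integral I) {(q - 1) - q..(q + 1) - q}"
    using assms by (simp add: has_integral_Icc_iff_Ioo add.commute)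
  then have "(f has_integral I) {q - 1..q + 1}" by (subst has_integral_shift_real_ivl_iff)
  then show ?thesis by (simp add: has_integral_Icc_iff_Ioo)
qed

context interval_system
begin

section \<open>Endpoint behaviour of the densities and their potential on the line\<close>

lemma dens_local:
  assumes "\<bar>t\<bar> < 1"
  shows "dens c (p j + t) = numer c (p j + t) * (\<Prod>i\<in>UNIV - {j}. weight i (p j + t)) / sqrt (1 - t\<^sup>2)"
proof -
  have "\<bar>p j + t - p j\<bar> < 1" using assms by simp
  then have i: "inside (p j + t)" unfolding inside_def by blast
  have t2: "t\<^sup>2 < 1" using assms by (simp add: abs_square_less_1)
  have w: "weight j (p j + t) = 1 / sqrt (1 - t\<^sup>2)" unfolding weight_def using assms t2 by simp
  have "(\<Prod>i\<in>UNIV. weight i (p j + t)) = weight j (p j + t) * (\<Prod>i\<in>UNIV - {j}. weight i (p j + t))"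
    by (rule prod.remove) auto
  then show ?thesis unfolding dens_def using i w by simp
qed

lemma weight_off:
  assumes "\<bar>t\<bar> \<le> 1" "i \<noteq> j"
  shows "weight i (p j + t) = sgn (p j - p i) / sqrt ((p j + t - p i)\<^sup>2 - 1)" "(p j + t - p i)\<^sup>2 > 1"
    "sgn (p j + t - p i) = sgn (p j - p i)"
proof -
  have s: "\<bar>p j - p i\<bar> > 2" using sep[of j i] assms by auto
  have g: "\<bar>p j + t - p i\<bar> > 1" using s assms by linarith
  then show sq: "(p j + t - p i)\<^sup>2 > 1" using abs_square_le_1[of "p j + t - p i"] by linarith
  show sg: "sgn (p j + t - p i) = sgn (p j - p i)"
    using s assms by (auto simp: sgn_if abs_if split: if_splits)
  show "weight i (p j + t) = sgn (p j - p i) / sqrt ((p j + t - p i)\<^sup>2 - 1)"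
    unfolding weight_def sg using g sq by simp
qed

text \<open>On the closed interval \<open>j\<close> only its own root vanishes; the other intervals
  are disjoint from it, so the remaining factor \<open>r\<close> is continuous up to the ends and
  bounded.\<close>

lemma dens_arcsine_bounded: "\<exists>C. arcsine_bounded C (\<lambda>t. dens c (p j + t))"
proof -
  define r where "r t = numer c (p j + t) * (\<Prod>i\<in>UNIV - {j}. sgn (p j - p i) / sqrt ((p j + t - p i)\<^sup>2 - 1))" for t
  have rc: "continuous_on {-1..1} r" unfolding r_def numer_def
  proof (intro continuous_intros ballI)
    fix t i assume "t \<in> {-1..1::real}" "i \<in> UNIV - {j}"
    then show "sqrt ((p j + t - p i)\<^sup>2 - 1) \<noteq> 0" using weight_off(2)[of t i j] by (auto simp: abs_le_iff)
  qed
  have eq: "dens c (p j + t) = r t / sqrt (1 - t\<^sup>2)" if "t \<in> {-1<..<1}" for t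
  proof -
    have "\<bar>t\<bar> < 1" using that by (simp add: abs_less_iff)
    then have "(\<Prod>i\<in>UNIV - {j}. weight i (p j + t)) = (\<Prod>i\<in>UNIV - {j}. sgn (p j - p i) / sqrt ((p j + t - p i)\<^sup>2 - 1))"
      by (intro prod.cong refl weight_off(1)) auto
    then show ?thesis using dens_local[OF \<open>\<bar>t\<bar> < 1\<close>] by (simp add: r_def)
  qed
  have "bounded (r ` {-1..1})" by (intro compact_imp_bounded compact_continuous_image rc) auto
  then obtain C where "\<forall>t\<in>{-1..1}. \<bar>r t\<bar> \<le> C" by (auto simp: bounded_iff simp del: atLeastAtMost_iff)
  then have C: "\<And>t. t \<in> {-1..1} \<Longrightarrow> \<bar>r t\<bar> \<le> C" by blast
  have C0: "0 \<le> C" using C[of 0] by auto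
  have "(\<lambda>t. dens c (p j + t)) \<in> borel_measurable (lebesgue_on {-1<..<1}) \<longleftrightarrow>
      (\<lambda>t. r t / sqrt (1 - t\<^sup>2)) \<in> borel_measurable (lebesgue_on {-1<..<1})"
    by (rule measurable_cong) (use eq in auto)
  moreover have "(\<lambda>t. r t / sqrt (1 - t\<^sup>2)) \<in> borel_measurable (lebesgue_on {-1<..<1})"
  proof (rule continuous_imp_measurable_on_sets_lebesgue)
    show "continuous_on {-1<..<1} (\<lambda>t. r t / sqrt (1 - t\<^sup>2))"
      by (intro continuous_intros continuous_on_subset[OF rc]) (auto simp: abs_square_eq_1 power2_eq_1_iff)
  qed simp
  moreover have "\<bar>dens c (p j + t)\<bar> \<le> C / sqrt (1 - t\<^sup>2)" if "t \<in> {-1<..<1}" for t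
  proof -
    have "\<bar>t\<bar> < 1" using that by (simp add: abs_less_iff)
    then have "0 < sqrt (1 - t\<^sup>2)" by (simp add: abs_square_less_1)
    then show ?thesis unfolding eq[OF that] abs_divide using C[of t] that by (intro frac_le) auto
  qed
  ultimately show ?thesis using C0 unfolding arcsine_bounded_def by blast
qed

text \<open>Translates between the two forms in use: Cauchy's theorem gives one integral over a long
  segment, the operator is a sum of Lebesgue integrals over copies of the unit interval.\<close>

lemma dens_split:
  assumes k: "\<And>j. (\<lambda>t. k (p j + t) * dens c (p j + t)) absolutely_integrable_on {-1<..<1}"
  shows "\<forall>\<^sub>F R in at_top. ((\<lambda>t. dens c t * k t) has_integral
    (\<Sum>j\<in>UNIV. LINT t:{-1<..<1}|lebesgue. k (p j + t) * dens c (p j + t))) {-R..R}"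
proof (rule eventually_at_top_linorderI)
  fix R :: real assume R: "(\<Sum>j\<in>UNIV. \<bar>p j\<bar> + 1) \<le> R"
  have pR: "\<bar>p j\<bar> + 1 \<le> R" for j
    using member_le_sum[of j UNIV "\<lambda>j. \<bar>p j\<bar> + 1"] R by simp
  let ?f = "\<lambda>t. k t * dens c t"
  have piece: "((\<lambda>t. if t \<in> {p j - 1<..<p j + 1} then ?f t else 0) has_integral
      (LINT t:{-1<..<1}|lebesgue. k (p j + t) * dens c (p j + t))) {-R..R}" for j
  proof -
    have "((\<lambda>t. ?f (p j + t)) has_integral (LINT t:{-1<..<1}|lebesgue. k (p j + t) * dens c (p j + t))) {-1<..<1}"
      using set_lebesgue_integral_eq_integral[OF k[of j]] by (simp add: has_integral_iff)
    from has_integral_shift_unit[OF this] show ?thesis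
      using pR[of j] by (subst has_integral_restrict) auto
  qed
  have "((\<lambda>t. \<Sum>j\<in>UNIV. if t \<in> {p j - 1<..<p j + 1} then ?f t else 0) has_integral
      (\<Sum>j\<in>UNIV. LINT t:{-1<..<1}|lebesgue. k (p j + t) * dens c (p j + t))) {-R..R}"
    by (rule has_integral_sum, simp, rule piece)
  moreover have "(\<Sum>j\<in>UNIV. if t \<in> {p j - 1<..<p j + 1} then ?f t else 0) = dens c t * k t" for t
  proof (cases "inside t")
    case True
    then obtain m where m: "\<bar>t - p m\<bar> < 1" by (auto simp: inside_def)
    have "t \<in> {p j - 1<..<p j + 1} \<longleftrightarrow> j = m" for j
      using inside_unique[OF m, of j] m by (auto simp: abs_less_iff abs_le_iff)
    then show ?thesis by simp
  next
    case False
    then have "dens c t = 0" by (simp add: dens_def)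
    then show ?thesis by (simp cong: if_cong)
  qed
  ultimately show "((\<lambda>t. dens c t * k t) has_integral
      (\<Sum>j\<in>UNIV. LINT t:{-1<..<1}|lebesgue. k (p j + t) * dens c (p j + t))) {-R..R}" by simp
qed

text \<open>At \<open>x = p i + s\<close> this is row \<open>i\<close> of the matrix operator,
  applied to the translated densities and evaluated at \<open>s\<close>.\<close>

definition pot :: "('n \<Rightarrow> real) \<Rightarrow> real \<Rightarrow> real" where
  "pot c x = (\<Sum>j\<in>UNIV. LINT t:{-1<..<1}|lebesgue. ln \<bar>(x - p j) - t\<bar> * dens c (p j + t))"

lemma pot_integrable: "(\<lambda>t. ln \<bar>(x - p j) - t\<bar> * dens c (p j + t)) absolutely_integrable_on {-1<..<1}"
  using dens_arcsine_bounded log_kernel_integrable(1) by blast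

lemma dens_ln_has_integral:
  "\<forall>\<^sub>F R in at_top. ((\<lambda>t. dens c t * ln \<bar>t - x\<bar>) has_integral pot c x) {-R..R}"
proof -
  have e: "\<bar>p j + t - x\<bar> = \<bar>(x - p j) - t\<bar>" for j t by linarith
  show ?thesis unfolding pot_def
    using dens_split[of "\<lambda>t. ln \<bar>t - x\<bar>" c] pot_integrable unfolding e by blast
qed

text \<open>Take \<open>L\<close> to be a difference of two logarithms. Its real boundary values
  produce the difference of the potentials; its imaginary part is \<open>- pi\<close> between
  \<open>x'\<close> and \<open>x\<close> and 0 elsewhere. This avoids differentiating the potential,
  which would lead to principal value integrals.\<close>

lemma slope_has_integral:
  assumes "x' < x"
  shows "(slope c has_integral (pot c x' - pot c x) / pi) {x'..x}"
proof -
  let ?L = "\<lambda>z::complex. Ln (z - \<i> * of_real x) - Ln (z - \<i> * of_real x')"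
  let ?BV = "\<lambda>t. Complex (ln \<bar>t - x\<bar>) (pi / 2 * sgn (t - x)) - Complex (ln \<bar>t - x'\<bar>) (pi / 2 * sgn (t - x'))"
  have bi: "\<forall>\<^sub>F R in at_top. ((\<lambda>t. dens c t * Re (?BV t) - slope c t * Im (?BV t)) has_integral 0) {-R..R}"
  proof (rule boundary_identity[where L = ?L and N = "{x, x'}"])
    show "?L holomorphic_on {z. 0 < Re z}"
      by (intro holomorphic_intros) (auto simp: complex_nonpos_Reals_iff)
    show "((\<lambda>\<eta>. ?L (Complex \<eta> t)) \<longlongrightarrow> ?BV t) (at_right 0)" if "t \<notin> {x, x'}" for t
      using that by (intro tendsto_diff Ln_boundary) auto
  next
    fix T :: real assume T: "0 < T"
    obtain K where K: "K \<ge> 0" "\<And>(\<eta>::real) (t::real). 0 < \<eta> \<Longrightarrow> \<eta> \<le> 1 \<Longrightarrow> \<bar>t\<bar> \<le> T \<Longrightarrow> t \<noteq> x \<Longrightarrow>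
     norm (Ln (Complex \<eta> t - \<i> * of_real x)) \<le> K * (1 + \<bar>t - x\<bar> powr (-1/4))" using Ln_strip_bound[OF T, of x] by blast
    obtain K' where K': "K' \<ge> 0" "\<And>(\<eta>::real) (t::real). 0 < \<eta> \<Longrightarrow> \<eta> \<le> 1 \<Longrightarrow> \<bar>t\<bar> \<le> T \<Longrightarrow> t \<noteq> x' \<Longrightarrow>
     norm (Ln (Complex \<eta> t - \<i> * of_real x')) \<le> K' * (1 + \<bar>t - x'\<bar> powr (-1/4))" using Ln_strip_bound[OF T, of x'] by blast
    show "\<exists>K\<ge>0. \<forall>(\<eta>::real) (t::real). 0 < \<eta> \<longrightarrow> \<eta> \<le> 1 \<longrightarrow> \<bar>t\<bar> \<le> T \<longrightarrow> t \<notin> {x, x'} \<longrightarrow>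
     norm (?L (Complex \<eta> t)) \<le> K * (1 + (\<Sum>e\<in>{x, x'}. \<bar>t - e\<bar> powr (-1/4)))"
    proof (intro exI[of _ "K + K'"] conjI allI impI)
      show "0 \<le> K + K'" using K K' by simp
      fix \<eta> t :: real assume h: "0 < \<eta>" "\<eta> \<le> 1" "\<bar>t\<bar> \<le> T" "t \<notin> {x, x'}"
      let ?a = "\<bar>t - x\<bar> powr (-1/4)" and ?b = "\<bar>t - x'\<bar> powr (-1/4)"
      have "norm (?L (Complex \<eta> t)) \<le> K * (1 + ?a) + K' * (1 + ?b)"
        using h by (intro order_trans[OF norm_triangle_ineq4] add_mono K K') auto
      also have "\<dots> \<le> K * (1 + (?a + ?b)) + K' * (1 + (?a + ?b))"
        using K K' by (intro add_mono mult_left_mono) auto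
      finally show "norm (?L (Complex \<eta> t)) \<le> (K + K') * (1 + (\<Sum>e\<in>{x, x'}. \<bar>t - e\<bar> powr (-1/4)))"
        using assms by (simp add: distrib_right)
    qed
  next
    show "\<exists>R>0. \<exists>C\<ge>0. \<forall>z. 0 < Re z \<longrightarrow> R \<le> norm z \<longrightarrow> norm (?L z) \<le> C / norm z"
    proof (rule Ln_diff_decay[where ?R0.0 = 1 and D = "\<bar>x - x'\<bar>"])
      fix z assume z: "0 < Re z"
      then have "z - \<i> * of_real x \<noteq> 0" by (auto simp: complex_eq_iff)
      then have "(z - \<i> * of_real x') / (z - \<i> * of_real x) - 1 = \<i> * of_real (x - x') / (z - \<i> * of_real x)"
        by (simp add: field_simps)
      then show "norm ((z - \<i> * of_real x') / (z - \<i> * of_real x) - 1) \<le> \<bar>x - x'\<bar> / norm (z - \<i> * of_real x)"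
        by (simp add: norm_divide norm_mult del: of_real_diff)
    qed auto
  next
    show "\<exists>R. \<forall>t. R \<le> \<bar>t\<bar> \<longrightarrow> Im (?BV t) = 0"
      by (rule exI[of _ "\<bar>x\<bar> + \<bar>x'\<bar> + 1"]) (auto simp: sgn_if abs_if split: if_splits)
  qed simp
  have "\<forall>\<^sub>F R in at_top. R \<ge> \<bar>x\<bar> + \<bar>x'\<bar>" by (rule eventually_ge_at_top)
  then have "\<forall>\<^sub>F R::real in at_top. (slope c has_integral (pot c x' - pot c x) / pi) {x'..x}"
    using bi dens_ln_has_integral[of c x] dens_ln_has_integral[of c x']
  proof eventually_elim
    case (elim R)
    have "((\<lambda>t. (dens c t * ln \<bar>t - x\<bar> - dens c t * ln \<bar>t - x'\<bar>)
        - (dens c t * Re (?BV t) - slope c t * Im (?BV t))) has_integral (pot c x - pot c x') - 0) {-R..R}"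
      by (intro has_integral_diff elim)
    from has_integral_mult_right[OF this, of "- 1 / pi"]
    have "((\<lambda>t. - 1 / pi * (slope c t * Im (?BV t))) has_integral (pot c x' - pot c x) / pi) {-R..R}"
      by (simp add: algebra_simps diff_divide_distrib)
    then have "((\<lambda>t. if t \<in> {x'..x} then slope c t else 0) has_integral (pot c x' - pot c x) / pi) {-R..R}"
    proof (rule has_integral_spike_finite[rotated 2])
      fix t assume "t \<in> {-R..R} - {x, x'}"
      then show "(if t \<in> {x'..x} then slope c t else 0) = - 1 / pi * (slope c t * Im (?BV t))"
        using assms by (auto simp: sgn_if)
    qed simp
    then show ?case using elim assms by (subst (asm) has_integral_restrict) auto
  qed
  then show ?thesis by simp
qed

lemma slope_inside: "\<bar>t - p j\<bar> < 1 \<Longrightarrow> slope c t = 0"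
  by (auto simp: slope_def inside_def)

lemma pot_constant:
  assumes "\<bar>x - p j\<bar> \<le> 1" "\<bar>y - p j\<bar> \<le> 1"
  shows "pot c x = pot c y"
proof -
  have *: "pot c x = pot c y" if "x < y" "\<bar>x - p j\<bar> \<le> 1" "\<bar>y - p j\<bar> \<le> 1" for x y
  proof -
    have "(slope c has_integral 0) {x..y}"
    proof (rule has_integral_spike_finite[of "{x, y}"])
      show "slope c t = 0" if "t \<in> {x..y} - {x, y}" for t
        using that \<open>\<bar>x - p j\<bar> \<le> 1\<close> \<open>\<bar>y - p j\<bar> \<le> 1\<close> by (intro slope_inside[of t j]) (auto simp: abs_le_iff abs_less_iff)
    qed auto
    from has_integral_unique[OF slope_has_integral[OF that(1), of c] this]
    have "(pot c x - pot c y) / pi = 0" .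
    then show ?thesis by simp
  qed
  consider "x < y" | "x = y" | "y < x" by linarith
  then show ?thesis
  proof cases
    case 1
    then show ?thesis by (rule *[OF _ assms])
  next
    case 3
    then show ?thesis by (rule *[OF _ assms(2,1), symmetric])
  qed simp
qed

end

section \<open>Evaluation of the constant boundary potential\<close>

text \<open>For \<open>m = 0\<close>, \<open>conf\<close> is \<open>(sqrt (z\<^sup>2 + a\<^sup>2) + sqrt (z\<^sup>2 + b\<^sup>2)) / 2\<close>. Its modulus is constant on the two
  boundary intervals \<open>a \<le> \<bar>t\<bar> \<le> b\<close> and it behaves like \<open>z\<close> at infinity: the logarithm of its modulus is
  the Green function of their complement, up to a constant.\<close>

definition conf :: "real \<Rightarrow> real \<Rightarrow> real \<Rightarrow> complex \<Rightarrow> complex" where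
  "conf m a b z = (sqrt_at (m - a) z * sqrt_at (m + a) z + sqrt_at (m - b) z * sqrt_at (m + b) z) / 2"

text \<open>The modulus of \<open>conf\<close> on the boundary line. The constant
  \<open>sqrt (b\<^sup>2 - a\<^sup>2) / 2\<close> is the logarithmic capacity of the two bands;
  \<open>a = 0\<close> and \<open>b = 1\<close> give the value 1/2 of a single interval of length
  2.\<close>

definition conf_mod :: "real \<Rightarrow> real \<Rightarrow> real \<Rightarrow> real \<Rightarrow> real" where
  "conf_mod m a b t = (if a \<le> \<bar>t - m\<bar> \<and> \<bar>t - m\<bar> \<le> b then sqrt (b\<^sup>2 - a\<^sup>2) / 2
     else (sqrt \<bar>(t - m)\<^sup>2 - a\<^sup>2\<bar> + sqrt \<bar>(t - m)\<^sup>2 - b\<^sup>2\<bar>) / 2)"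

lemma sqrt_at_pair_boundary:
  fixes a m t :: real
  assumes "0 \<le> a" "\<bar>t - m\<bar> \<noteq> a"
  shows "((\<lambda>\<eta>. sqrt_at (m - a) (Complex \<eta> t) * sqrt_at (m + a) (Complex \<eta> t)) \<longlongrightarrow>
    of_real (sqrt \<bar>(t - m)\<^sup>2 - a\<^sup>2\<bar>) * (if \<bar>t - m\<bar> < a then 1 else if t > m then \<i> else - \<i>)) (at_right 0)"
proof -
  have ne: "t \<noteq> m - a" "t \<noteq> m + a" using assms by auto
  have H: "((\<lambda>\<eta>. sqrt_at (m - a) (Complex \<eta> t) * sqrt_at (m + a) (Complex \<eta> t)) \<longlongrightarrow>
    (of_real (sqrt \<bar>t - (m - a)\<bar>) * unit8 (t - (m - a))) * (of_real (sqrt \<bar>t - (m + a)\<bar>) * unit8 (t - (m + a)))) (at_right 0)"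
    using ne by (intro tendsto_mult sqrt_at_boundary)
  have "\<bar>t - (m - a)\<bar> * \<bar>t - (m + a)\<bar> = \<bar>(t - m)\<^sup>2 - a\<^sup>2\<bar>"
    unfolding abs_mult[symmetric] by (simp add: power2_eq_square algebra_simps)
  then have s: "sqrt \<bar>t - (m - a)\<bar> * sqrt \<bar>t - (m + a)\<bar> = sqrt \<bar>(t - m)\<^sup>2 - a\<^sup>2\<bar>"
    by (simp only: real_sqrt_mult[symmetric])
  have u: "unit8 (t - (m - a)) * unit8 (t - (m + a)) = (if \<bar>t - m\<bar> < a then 1 else if t > m then \<i> else - \<i>)"
  proof -
    consider "\<bar>t - m\<bar> < a" | "t - m > a" | "t - m < - a" using assms by linarith
    then show ?thesis
      by cases (subst (1 2) unit8_sgn, use assms in \<open>auto simp: unit8_mult abs_less_iff\<close>)+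
  qed
  have "(of_real (sqrt \<bar>t - (m - a)\<bar>) * unit8 (t - (m - a))) * (of_real (sqrt \<bar>t - (m + a)\<bar>) * unit8 (t - (m + a)))
    = of_real (sqrt \<bar>t - (m - a)\<bar> * sqrt \<bar>t - (m + a)\<bar>) * (unit8 (t - (m - a)) * unit8 (t - (m + a)))"
    by (simp only: of_real_mult mult_ac)
  then show ?thesis using H unfolding s u by simp
qed

lemma sqrt_diff_ge:
  fixes a b \<tau> :: real
  assumes "0 \<le> a" "a < b"
  shows "\<bar>\<tau>\<bar> \<le> a \<Longrightarrow> sqrt (b\<^sup>2 - a\<^sup>2) \<le> sqrt \<bar>\<tau>\<^sup>2 - b\<^sup>2\<bar>" "b \<le> \<bar>\<tau>\<bar> \<Longrightarrow> sqrt (b\<^sup>2 - a\<^sup>2) \<le> sqrt \<bar>\<tau>\<^sup>2 - a\<^sup>2\<bar>"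
proof -
  have ab: "a\<^sup>2 < b\<^sup>2" using assms by (intro power_strict_mono) auto
  show "\<bar>\<tau>\<bar> \<le> a \<Longrightarrow> sqrt (b\<^sup>2 - a\<^sup>2) \<le> sqrt \<bar>\<tau>\<^sup>2 - b\<^sup>2\<bar>"
    using power_mono[of "\<bar>\<tau>\<bar>" a 2] ab by simp
  show "b \<le> \<bar>\<tau>\<bar> \<Longrightarrow> sqrt (b\<^sup>2 - a\<^sup>2) \<le> sqrt \<bar>\<tau>\<^sup>2 - a\<^sup>2\<bar>"
    using power_mono[of b "\<bar>\<tau>\<bar>" 2] assms ab by simp
qed

text \<open>Nonnegativity of the Green function on the line, checked by hand: off the bands one of
  the two roots alone reaches the value taken on the bands.\<close>

lemma conf_mod_ge:
  assumes "0 \<le> a" "a < b"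
  shows "sqrt (b\<^sup>2 - a\<^sup>2) / 2 \<le> conf_mod m a b t"
proof -
  have nn: "0 \<le> sqrt \<bar>(t - m)\<^sup>2 - a\<^sup>2\<bar>" "0 \<le> sqrt \<bar>(t - m)\<^sup>2 - b\<^sup>2\<bar>" by auto
  consider "a \<le> \<bar>t - m\<bar> \<and> \<bar>t - m\<bar> \<le> b" | "\<bar>t - m\<bar> < a" | "b < \<bar>t - m\<bar>" by linarith
  then show ?thesis
  proof cases
    case 2
    then have "conf_mod m a b t = (sqrt \<bar>(t - m)\<^sup>2 - a\<^sup>2\<bar> + sqrt \<bar>(t - m)\<^sup>2 - b\<^sup>2\<bar>) / 2"
      by (auto simp: conf_mod_def)
    moreover have "sqrt (b\<^sup>2 - a\<^sup>2) \<le> sqrt \<bar>(t - m)\<^sup>2 - b\<^sup>2\<bar>" using 2 by (intro sqrt_diff_ge(1)[OF assms]) simp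
    ultimately show ?thesis using nn(1) by argo
  next
    case 3
    then have "conf_mod m a b t = (sqrt \<bar>(t - m)\<^sup>2 - a\<^sup>2\<bar> + sqrt \<bar>(t - m)\<^sup>2 - b\<^sup>2\<bar>) / 2"
      by (auto simp: conf_mod_def)
    moreover have "sqrt (b\<^sup>2 - a\<^sup>2) \<le> sqrt \<bar>(t - m)\<^sup>2 - a\<^sup>2\<bar>" using 3 by (intro sqrt_diff_ge(2)[OF assms]) simp
    ultimately show ?thesis using nn(2) by argo
  qed (simp add: conf_mod_def)
qed

lemma conf_mod_pos: "0 \<le> a \<Longrightarrow> a < b \<Longrightarrow> 0 < conf_mod m a b t"
proof -
  assume ab: "0 \<le> a" "a < b"
  then have "a\<^sup>2 < b\<^sup>2" by (intro power_strict_mono) auto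
  then show ?thesis using conf_mod_ge[OF ab, of m t] by (smt (verit) half_gt_zero real_sqrt_gt_zero)
qed

text \<open>The argument is recorded only in the gap and outside, where it is constant on each
  piece. On the bands it varies, but there it will be multiplied by a vanishing
  \<open>slope\<close>.\<close>

lemma conf_boundary:
  assumes ab: "0 \<le> a" "a < b" and t: "\<bar>t - m\<bar> \<noteq> a" "\<bar>t - m\<bar> \<noteq> b"
  obtains G0 where "((\<lambda>\<eta>. conf m a b (Complex \<eta> t)) \<longlongrightarrow> G0) (at_right 0)" "G0 \<notin> \<real>\<^sub>\<le>\<^sub>0"
    "norm G0 = conf_mod m a b t" "b < \<bar>t - m\<bar> \<Longrightarrow> Im (Ln G0) = pi / 2 * sgn (t - m)"
    "\<bar>t - m\<bar> < a \<Longrightarrow> Im (Ln G0) = 0"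
proof -
  let ?u = "\<lambda>a. if \<bar>t - m\<bar> < a then 1 else if t > m then \<i> else - \<i>"
  define \<alpha> where "\<alpha> = sqrt \<bar>(t - m)\<^sup>2 - a\<^sup>2\<bar>"
  define \<beta> where "\<beta> = sqrt \<bar>(t - m)\<^sup>2 - b\<^sup>2\<bar>"
  define G0 where "G0 = (of_real \<alpha> * ?u a + of_real \<beta> * ?u b) / 2"
  have lim: "((\<lambda>\<eta>. conf m a b (Complex \<eta> t)) \<longlongrightarrow> G0) (at_right 0)"
    unfolding conf_def G0_def \<alpha>_def \<beta>_def using ab t
    by (intro tendsto_divide tendsto_add tendsto_const sqrt_at_pair_boundary) auto
  have sq: "\<bar>t - m\<bar>\<^sup>2 \<noteq> a\<^sup>2" "\<bar>t - m\<bar>\<^sup>2 \<noteq> b\<^sup>2" using t ab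
    by (auto simp only: power2_eq_iff_nonneg abs_ge_zero less_imp_le order_trans[of 0 a b])
  then have pos: "0 < \<alpha>" "0 < \<beta>" by (auto simp: \<alpha>_def \<beta>_def)
  consider "\<bar>t - m\<bar> < a" | "a < \<bar>t - m\<bar>" "\<bar>t - m\<bar> < b" | "b < \<bar>t - m\<bar>" using t by linarith
  then show thesis
  proof cases
    case 1
    then have G: "G0 = of_real ((\<alpha> + \<beta>) / 2)" using ab by (simp add: G0_def)
    show thesis
    proof (rule that[OF lim])
      show "G0 \<notin> \<real>\<^sub>\<le>\<^sub>0" unfolding G using pos by (simp add: complex_nonpos_Reals_iff)
      show "norm G0 = conf_mod m a b t" unfolding G norm_of_real using pos 1 by (simp add: conf_mod_def \<alpha>_def \<beta>_def)
      show "Im (Ln G0) = 0" unfolding G using pos by (subst Ln_of_real) auto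
    qed (use 1 ab in auto)
  next
    case 2
    \<comment> \<open>On a band one root is purely imaginary and the other real, so the squared
      moduli add and the dependence on \<open>t\<close> cancels.\<close>
    have "norm (2 * G0) = sqrt (\<beta>\<^sup>2 + \<alpha>\<^sup>2)" using 2 by (simp add: G0_def cmod_def)
    also have "\<beta>\<^sup>2 + \<alpha>\<^sup>2 = b\<^sup>2 - a\<^sup>2"
      using power_strict_mono[OF 2(1) ab(1), of 2] power_strict_mono[OF 2(2) abs_ge_zero, of 2]
      by (simp add: \<alpha>_def \<beta>_def)
    finally have n: "norm G0 = conf_mod m a b t" using 2 by (simp add: conf_mod_def norm_mult)
    show thesis
    proof (rule that[OF lim _ n])
      show "G0 \<notin> \<real>\<^sub>\<le>\<^sub>0" using 2 pos by (auto simp: complex_nonpos_Reals_iff G0_def)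
    qed (use 2 in auto)
  next
    case 3
    have tm: "t \<noteq> m" using 3 ab by auto
    have G: "G0 = \<i> * of_real (sgn (t - m) * ((\<alpha> + \<beta>) / 2))"
      using 3 ab tm by (auto simp: G0_def sgn_if algebra_simps add_divide_distrib)
    have nz: "sgn (t - m) * ((\<alpha> + \<beta>) / 2) \<noteq> 0" using tm pos by (simp add: sgn_if)
    have sg: "sgn (sgn (t - m) * ((\<alpha> + \<beta>) / 2)) = sgn (t - m)" using pos by (simp add: sgn_mult)
    show thesis
    proof (rule that[OF lim])
      show "G0 \<notin> \<real>\<^sub>\<le>\<^sub>0" unfolding G using nz by (auto simp: complex_nonpos_Reals_iff)
      show "norm G0 = conf_mod m a b t" unfolding G using pos 3 ab tm
        by (simp add: conf_mod_def \<alpha>_def \<beta>_def norm_mult abs_mult del: of_real_mult of_real_divide of_real_add)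
      show "Im (Ln G0) = pi / 2 * sgn (t - m)" unfolding G Ln_imaginary[OF nz] sg by simp
    qed (use 3 ab in auto)
  qed
qed

lemma conf_Re_pos: "Re z > 0 \<Longrightarrow> Re (conf m a b z) > 0"
  unfolding conf_def
  by (simp only: Re_divide_numeral plus_complex.sel half_gt_zero_iff sqrt_at_mult_Re_pos add_pos_pos)

lemma conf_holomorphic: "conf m a b holomorphic_on {z. Re z > 0}"
  unfolding conf_def by (intro holomorphic_intros sqrt_at_holomorphic) auto

text \<open>The sum of the two square roots cannot be small: its product with their difference has
  the constant value \<open>a\<^sup>2 - b\<^sup>2\<close>, and the difference is bounded. So
  \<open>Ln\<close> of \<open>conf\<close> has no singularity at the band ends.\<close>

lemma conf_strip:
  fixes T :: real
  assumes ab: "0 \<le> a" "a < b" and T: "0 < T"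
  shows "\<exists>K\<ge>0. \<forall>(\<eta>::real) (t::real). 0 < \<eta> \<longrightarrow> \<eta> \<le> 1 \<longrightarrow> \<bar>t\<bar> \<le> T \<longrightarrow> norm (Ln (conf m a b (Complex \<eta> t))) \<le> K"
proof -
  define H where "H = 1 + T + \<bar>m\<bar> + b"
  have H: "0 < H" using T ab by (simp add: H_def)
  define lo where "lo = (b\<^sup>2 - a\<^sup>2) / (2 * H) / 2"
  have ab2: "a\<^sup>2 < b\<^sup>2" using ab by (intro power_strict_mono) auto
  have lo: "0 < lo" using ab2 H by (simp add: lo_def)
  show ?thesis
  proof (intro exI[of _ "\<bar>ln lo\<bar> + \<bar>ln H\<bar> + pi"] conjI allI impI)
    fix \<eta> t :: real assume h: "0 < \<eta>" "\<eta> \<le> 1" "\<bar>t\<bar> \<le> T"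
    let ?z = "Complex \<eta> t"
    let ?A = "sqrt_at (m - a) ?z * sqrt_at (m + a) ?z" and ?B = "sqrt_at (m - b) ?z * sqrt_at (m + b) ?z"
    have n: "norm (sqrt_at e ?z) \<le> sqrt H" if "\<bar>e\<bar> \<le> \<bar>m\<bar> + b" for e
      unfolding norm_sqrt_at using norm_strip_le[of \<eta> t e] h that by (simp add: H_def)
    have "norm ?A \<le> sqrt H * sqrt H" "norm ?B \<le> sqrt H * sqrt H"
      unfolding norm_mult by (intro mult_mono n; use ab H in \<open>auto simp: abs_if\<close>)+
    then have AB: "norm ?A \<le> H" "norm ?B \<le> H" using H by auto
    have hi: "norm (conf m a b ?z) \<le> H"
      unfolding conf_def norm_divide using norm_triangle_ineq[of ?A ?B] AB by simp
    have "(?A + ?B) * (?A - ?B) = (sqrt_at (m - a) ?z)\<^sup>2 * (sqrt_at (m + a) ?z)\<^sup>2 - (sqrt_at (m - b) ?z)\<^sup>2 * (sqrt_at (m + b) ?z)\<^sup>2"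
      by (simp add: power2_eq_square algebra_simps)
    also have "\<dots> = of_real (a\<^sup>2 - b\<^sup>2)"
      unfolding sqrt_at_power2 by (simp add: power2_eq_square algebra_simps)
    finally have "norm (?A + ?B) * norm (?A - ?B) = b\<^sup>2 - a\<^sup>2"
      unfolding norm_mult[symmetric] using ab2 by (simp only: norm_of_real abs_if) simp
    moreover have "norm (?A + ?B) * norm (?A - ?B) \<le> norm (?A + ?B) * (2 * H)"
      using norm_triangle_ineq4[of ?A ?B] AB by (intro mult_left_mono) auto
    ultimately have "(b\<^sup>2 - a\<^sup>2) / (2 * H) \<le> norm (?A + ?B)" using H by (simp add: pos_divide_le_eq)
    then have "(b\<^sup>2 - a\<^sup>2) / (2 * H) / 2 \<le> norm (?A + ?B) / 2" by (rule divide_right_mono) simp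
    then have l: "lo \<le> norm (conf m a b ?z)" unfolding conf_def norm_divide lo_def norm_numeral .
    have cp: "0 < norm (conf m a b ?z)" using l lo by linarith
    have "ln lo \<le> ln (norm (conf m a b ?z))" using l by (simp only: ln_le_cancel_iff[OF lo cp])
    moreover have "ln (norm (conf m a b ?z)) \<le> ln H" using hi by (simp only: ln_le_cancel_iff[OF cp H])
    ultimately
    have "\<bar>ln (norm (conf m a b ?z))\<bar> \<le> \<bar>ln lo\<bar> + \<bar>ln H\<bar>" by linarith
    moreover have "conf m a b ?z \<noteq> 0" using l lo by auto
    ultimately show "norm (Ln (conf m a b ?z)) \<le> \<bar>ln lo\<bar> + \<bar>ln H\<bar> + pi" using norm_Ln_le_pi by fastforce
  qed simp
qed

text \<open>The difference of the roots is rationalized; the resulting denominator is controlled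
  because two roots from the sector do not cancel.\<close>

lemma sqrt_at_ratio:
  assumes "Re z > 0"
  shows "norm (sqrt_at e z / sqrt_at x z - 1) \<le> \<bar>x - e\<bar> / norm (z - \<i> * of_real x)"
proof -
  let ?s = "sqrt_at e z" and ?r = "sqrt_at x z"
  have r0: "?r \<noteq> 0" using assms by (rule sqrt_at_nonzero)
  have ge: "norm ?r \<le> norm (?r + ?s)" by (rule sqrt_at_add_norm_ge[OF assms])
  have p: "0 < norm ?r" using r0 by simp
  have nz: "?r + ?s \<noteq> 0" using ge p by auto
  have "(?s - ?r) * (?r + ?s) = ?s\<^sup>2 - ?r\<^sup>2" by (simp add: power2_eq_square algebra_simps)
  also have "\<dots> = \<i> * of_real (x - e)" unfolding sqrt_at_power2 by (simp add: algebra_simps)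
  finally have d: "?s - ?r = \<i> * of_real (x - e) / (?r + ?s)" using nz by (simp add: field_simps)
  have "?s / ?r - 1 = (?s - ?r) / ?r" using r0 by (simp add: diff_divide_distrib)
  then have "norm (?s / ?r - 1) = \<bar>x - e\<bar> / (norm (?r + ?s) * norm ?r)"
    unfolding d by (simp add: norm_divide norm_mult del: of_real_diff)
  also have "\<dots> \<le> \<bar>x - e\<bar> / (norm ?r * norm ?r)"
    using ge p by (intro divide_left_mono mult_right_mono mult_pos_pos) auto
  also have "norm ?r * norm ?r = norm (z - \<i> * of_real x)" by (simp add: norm_sqrt_at)
  finally show ?thesis .
qed

text \<open>All roots are compared with the one at \<open>m + b\<close>, whose square is the
  divisor. The branch points are within \<open>2 * b\<close> of it, so each ratio differs from 1 by
  at most \<open>D \<le> 1\<close>, each product of two by \<open>3 * D\<close>, and so does the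
  mean of both products.\<close>

lemma conf_ratio:
  assumes ab: "0 \<le> a" "a < b" and z: "Re z > 0" "2 * b \<le> norm (z - \<i> * of_real (m + b))"
  shows "norm (conf m a b z / (z - \<i> * of_real (m + b)) - 1) \<le> 6 * b / norm (z - \<i> * of_real (m + b))"
proof -
  let ?w = "z - \<i> * of_real (m + b)" and ?r = "sqrt_at (m + b) z"
  define D where "D = 2 * b / norm ?w"
  have w: "0 < norm ?w" using z ab by linarith
  have D: "0 \<le> D" "D \<le> 1" using w z ab by (auto simp: D_def)
  define q where "q e = sqrt_at e z / ?r - 1" for e
  have q: "norm (q e) \<le> D" if "\<bar>m + b - e\<bar> \<le> 2 * b" for e
    using sqrt_at_ratio[OF z(1), of e "m + b"] divide_right_mono[OF that norm_ge_zero[of ?w]]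
    unfolding q_def D_def by linarith
  have pair: "norm ((1 + q e) * (1 + q f) - 1) \<le> 3 * D"
    if "\<bar>m + b - e\<bar> \<le> 2 * b" "\<bar>m + b - f\<bar> \<le> 2 * b" for e f
  proof -
    have "(1 + q e) * (1 + q f) - 1 = q e + q f + q e * q f" by (simp add: algebra_simps)
    also have "norm \<dots> \<le> norm (q e) + norm (q f) + norm (q e) * norm (q f)"
      by (rule order_trans[OF norm_triangle_ineq]) (simp add: norm_mult norm_triangle_ineq)
    also have "\<dots> \<le> D + D + D * 1" using q[OF that(1)] q[OF that(2)] D by (intro add_mono mult_mono) auto
    finally show ?thesis by simp
  qed
  have r0: "?r \<noteq> 0" using z(1) by (rule sqrt_at_nonzero)
  have s: "sqrt_at e z = ?r * (1 + q e)" for e using r0 by (simp add: q_def)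
  have rr: "?r * ?r = ?w" using sqrt_at_power2[of "m + b" z] by (simp only: power2_eq_square)
  have "conf m a b z = ?w * (((1 + q (m - a)) * (1 + q (m + a)) + (1 + q (m - b)) * (1 + q (m + b))) / 2)"
    unfolding conf_def rr[symmetric] by (subst (1) s, subst (2) s, subst (3) s, subst (4) s) (simp add: algebra_simps)
  then have "conf m a b z / ?w - 1 = (((1 + q (m - a)) * (1 + q (m + a)) - 1) + ((1 + q (m - b)) * (1 + q (m + b)) - 1)) / 2"
    using w by (simp add: field_simps)
  also have "norm \<dots> \<le> (3 * D + 3 * D) / 2"
    unfolding norm_divide using ab
    by (intro frac_le order_trans[OF norm_triangle_ineq] add_mono pair) (use D in auto)
  finally show ?thesis by (simp add: D_def)
qed

context interval_system
begin

text \<open>Replacing the logarithmic kernel by \<open>ln (conf_mod m a b t)\<close> costs nothing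
  if the potential is constant on the bands and equal on both, which \<open>band\<close> and
  \<open>gap\<close> express. The gain is a kernel bounded from below by the logarithm of the
  capacity.\<close>

lemma pot_eq_conf:
  assumes ab: "0 \<le> a" "a < b"
    and band: "\<And>t. a < \<bar>t - m\<bar> \<Longrightarrow> \<bar>t - m\<bar> < b \<Longrightarrow> slope c t = 0"
    and gap: "(slope c has_integral 0) {m - a..m + a}"
  shows "pot c (m + b) = (\<Sum>j\<in>UNIV. LINT t:{-1<..<1}|lebesgue. ln (conf_mod m a b (p j + t)) * dens c (p j + t))"
    and "(\<lambda>t. ln (conf_mod m a b (p j + t)) * dens c (p j + t)) absolutely_integrable_on {-1<..<1}"
proof -
  let ?x = "m + b"
  let ?L = "\<lambda>z::complex. Ln (z - \<i> * of_real ?x) - Ln (conf m a b z)"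
  define N where "N = {m - a, m + a, m - b, m + b}"
  have N_iff: "t \<notin> N \<Longrightarrow> \<bar>t - m\<bar> \<noteq> a \<and> \<bar>t - m\<bar> \<noteq> b" for t by (auto simp: N_def)
  have "\<forall>t. \<exists>G0. t \<notin> N \<longrightarrow> (((\<lambda>\<eta>. conf m a b (Complex \<eta> t)) \<longlongrightarrow> G0) (at_right 0) \<and> G0 \<notin> \<real>\<^sub>\<le>\<^sub>0 \<and>
    norm G0 = conf_mod m a b t \<and> (b < \<bar>t - m\<bar> \<longrightarrow> Im (Ln G0) = pi / 2 * sgn (t - m)) \<and> (\<bar>t - m\<bar> < a \<longrightarrow> Im (Ln G0) = 0))"
    using conf_boundary[OF ab] N_iff by metis
  from choice[OF this] obtain G0 where *: "\<forall>t. t \<notin> N \<longrightarrow> (((\<lambda>\<eta>. conf m a b (Complex \<eta> t)) \<longlongrightarrow> G0 t) (at_right 0) \<and> G0 t \<notin> \<real>\<^sub>\<le>\<^sub>0 \<and>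
    norm (G0 t) = conf_mod m a b t \<and> (b < \<bar>t - m\<bar> \<longrightarrow> Im (Ln (G0 t)) = pi / 2 * sgn (t - m)) \<and> (\<bar>t - m\<bar> < a \<longrightarrow> Im (Ln (G0 t)) = 0))"
    by blast
  have G0: "\<And>t. t \<notin> N \<Longrightarrow> ((\<lambda>\<eta>. conf m a b (Complex \<eta> t)) \<longlongrightarrow> G0 t) (at_right 0)"
    "\<And>t. t \<notin> N \<Longrightarrow> G0 t \<notin> \<real>\<^sub>\<le>\<^sub>0" "\<And>t. t \<notin> N \<Longrightarrow> norm (G0 t) = conf_mod m a b t"
    "\<And>t. t \<notin> N \<Longrightarrow> b < \<bar>t - m\<bar> \<Longrightarrow> Im (Ln (G0 t)) = pi / 2 * sgn (t - m)"
    "\<And>t. t \<notin> N \<Longrightarrow> \<bar>t - m\<bar> < a \<Longrightarrow> Im (Ln (G0 t)) = 0"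
    using * by blast+
  let ?BV = "\<lambda>t. Complex (ln \<bar>t - ?x\<bar>) (pi / 2 * sgn (t - ?x)) - Ln (G0 t)"
  have fN: "finite N" by (simp add: N_def)
  have bi: "\<forall>\<^sub>F R in at_top. ((\<lambda>t. dens c t * Re (?BV t) - slope c t * Im (?BV t)) has_integral 0) {-R..R}"
  proof (rule boundary_identity[where L = ?L and N = N])
    show "?L holomorphic_on {z. 0 < Re z}"
      using conf_Re_pos[of _ m a b] by (intro holomorphic_intros conf_holomorphic) (force simp: complex_nonpos_Reals_iff)+
    show "((\<lambda>\<eta>. ?L (Complex \<eta> t)) \<longlongrightarrow> ?BV t) (at_right 0)" if "t \<notin> N" for t
      using that G0[OF that] by (intro tendsto_diff Ln_boundary tendsto_Ln) (auto simp: N_def)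
  next
    fix T :: real assume T: "0 < T"
    obtain K where K: "K \<ge> 0" "\<And>(\<eta>::real) (t::real). 0 < \<eta> \<Longrightarrow> \<eta> \<le> 1 \<Longrightarrow> \<bar>t\<bar> \<le> T \<Longrightarrow> t \<noteq> ?x \<Longrightarrow>
     norm (Ln (Complex \<eta> t - \<i> * of_real ?x)) \<le> K * (1 + \<bar>t - ?x\<bar> powr (-1/4))" using Ln_strip_bound[OF T, of ?x] by blast
    obtain K' where K': "K' \<ge> 0" "\<And>(\<eta>::real) (t::real). 0 < \<eta> \<Longrightarrow> \<eta> \<le> 1 \<Longrightarrow> \<bar>t\<bar> \<le> T \<Longrightarrow>
     norm (Ln (conf m a b (Complex \<eta> t))) \<le> K'" using conf_strip[OF ab T, of m] by blast
    show "\<exists>K\<ge>0. \<forall>(\<eta>::real) (t::real). 0 < \<eta> \<longrightarrow> \<eta> \<le> 1 \<longrightarrow> \<bar>t\<bar> \<le> T \<longrightarrow> t \<notin> N \<longrightarrow>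
     norm (?L (Complex \<eta> t)) \<le> K * (1 + (\<Sum>e\<in>N. \<bar>t - e\<bar> powr (-1/4)))"
    proof (intro exI[of _ "K + K'"] conjI allI impI)
      show "0 \<le> K + K'" using K K' by simp
      fix \<eta> t :: real assume h: "0 < \<eta>" "\<eta> \<le> 1" "\<bar>t\<bar> \<le> T" "t \<notin> N"
      let ?S = "\<Sum>e\<in>N. \<bar>t - e\<bar> powr (-1/4)"
      have S: "\<bar>t - ?x\<bar> powr (-1/4) \<le> ?S" "0 \<le> ?S"
        using fN by (intro member_le_sum sum_nonneg; auto simp: N_def)+
      have "norm (?L (Complex \<eta> t)) \<le> K * (1 + \<bar>t - ?x\<bar> powr (-1/4)) + K'"
        using h by (intro order_trans[OF norm_triangle_ineq4] add_mono K K') (auto simp: N_def)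
      also have "\<dots> \<le> K * (1 + ?S) + K' * (1 + ?S)"
      proof (intro add_mono mult_left_mono)
        have "K' * 1 \<le> K' * (1 + ?S)" using S K' by (intro mult_left_mono) auto
        then show "K' \<le> K' * (1 + ?S)" by simp
      qed (use S K in auto)
      finally show "norm (?L (Complex \<eta> t)) \<le> (K + K') * (1 + ?S)" by (simp only: distrib_right)
    qed
  next
    show "\<exists>R>0. \<exists>C\<ge>0. \<forall>z. 0 < Re z \<longrightarrow> R \<le> norm z \<longrightarrow> norm (?L z) \<le> C / norm z"
    proof (rule Ln_diff_decay[where ?R0.0 = "3 * b + \<bar>m\<bar>" and D = "6 * b"])
      fix z assume z: "0 < Re z" "3 * b + \<bar>m\<bar> \<le> norm z"
      have "norm z - \<bar>?x\<bar> \<le> norm (z - \<i> * of_real ?x)"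
        using norm_triangle_ineq2[of z "\<i> * of_real ?x"] by (simp add: norm_mult del: of_real_add)
      then have "2 * b \<le> norm (z - \<i> * of_real ?x)" using z ab by linarith
      then show "norm (conf m a b z / (z - \<i> * of_real ?x) - 1) \<le> 6 * b / norm (z - \<i> * of_real ?x)"
        by (rule conf_ratio[OF ab z(1)])
    qed (use ab conf_Re_pos in auto)
  next
    show "\<exists>R. \<forall>t. R \<le> \<bar>t\<bar> \<longrightarrow> Im (?BV t) = 0"
    proof (intro exI[of _ "\<bar>m\<bar> + b + 1"] allI impI)
      fix t assume "\<bar>m\<bar> + b + 1 \<le> \<bar>t\<bar>"
      then have tb: "b < \<bar>t - m\<bar>" by linarith
      then have "t \<notin> N" using ab by (auto simp: N_def)
      moreover have "sgn (t - ?x) = sgn (t - m)" using tb ab by (auto simp: sgn_if)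
      ultimately show "Im (?BV t) = 0" using G0(4) tb by simp
    qed
  qed (rule fN)
  have int: "(\<lambda>t. ln (conf_mod m a b (p j + t)) * dens c (p j + t)) absolutely_integrable_on {-1<..<1}" for j
  proof -
    obtain C where C: "arcsine_bounded C (\<lambda>t. dens c (p j + t))" using dens_arcsine_bounded by blast
    let ?lo = "sqrt (b\<^sup>2 - a\<^sup>2) / 2"
    define hi where "hi = \<bar>p j\<bar> + 1 + \<bar>m\<bar> + b"
    have "a\<^sup>2 < b\<^sup>2" using ab by (intro power_strict_mono) auto
    then have lo: "0 < ?lo" by simp
    have "\<bar>ln (conf_mod m a b (p j + t))\<bar> \<le> \<bar>ln ?lo\<bar> + \<bar>ln hi\<bar>" if "t \<in> {-1<..<1} - {}" for t
    proof -
      let ?\<tau> = "p j + t - m"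
      have s: "sqrt \<bar>?\<tau>\<^sup>2 - e\<^sup>2\<bar> \<le> hi" if "0 \<le> e" "e \<le> b" for e
      proof -
        have "\<bar>?\<tau>\<bar> + e \<le> hi" using \<open>t \<in> {-1<..<1} - {}\<close> that by (auto simp: hi_def)
        moreover have "\<bar>?\<tau>\<^sup>2 - e\<^sup>2\<bar> \<le> (\<bar>?\<tau>\<bar> + e)\<^sup>2"
        proof -
          have "\<bar>?\<tau>\<^sup>2 - e\<^sup>2\<bar> \<le> \<bar>?\<tau>\<bar>\<^sup>2 + e\<^sup>2" by (simp add: abs_le_iff)
          also have "\<dots> \<le> (\<bar>?\<tau>\<bar> + e)\<^sup>2" using that by (simp add: power2_sum)
          finally show ?thesis .
        qed
        then have "sqrt \<bar>?\<tau>\<^sup>2 - e\<^sup>2\<bar> \<le> \<bar>?\<tau>\<bar> + e" using that by (intro real_le_lsqrt) auto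
        ultimately show ?thesis by linarith
      qed
      have "sqrt (b\<^sup>2 - a\<^sup>2) \<le> hi"
      proof -
        have "sqrt (b\<^sup>2 - a\<^sup>2) \<le> sqrt (b\<^sup>2)" by (rule real_sqrt_le_mono) simp
        then show ?thesis using ab by (simp add: hi_def)
      qed
      moreover have "0 \<le> hi" using ab by (simp add: hi_def)
      ultimately have "conf_mod m a b (p j + t) \<le> hi"
        unfolding conf_mod_def using s[of a] s[of b] ab by auto
      moreover have "?lo \<le> conf_mod m a b (p j + t)" by (rule conf_mod_ge[OF ab])
      moreover have cp: "0 < conf_mod m a b (p j + t)" by (rule conf_mod_pos[OF ab])
      moreover have "0 < hi" using ab by (simp add: hi_def)
      ultimately have "ln ?lo \<le> ln (conf_mod m a b (p j + t))" "ln (conf_mod m a b (p j + t)) \<le> ln hi"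
        using lo by (simp_all only: ln_le_cancel_iff)
      then show ?thesis by linarith
    qed
    moreover have "(\<lambda>t. ln (conf_mod m a b (p j + t))) \<in> borel_measurable (lebesgue_on {-1<..<1})"
    proof -
      have "(\<lambda>t. ln (conf_mod m a b (p j + t))) \<in> borel_measurable borel" unfolding conf_mod_def by measurable
      then show ?thesis using measurable_restrict_space1 measurable_completion by (metis measurable_lborel2)
    qed
    ultimately show ?thesis by (intro arcsine_kernel_bounded(1)[OF C, where N = "{}" and K = "\<bar>ln ?lo\<bar> + \<bar>ln hi\<bar>"]) auto
  qed
  then show "(\<lambda>t. ln (conf_mod m a b (p j + t)) * dens c (p j + t)) absolutely_integrable_on {-1<..<1}" .
  define S where "S = (\<Sum>j\<in>UNIV. LINT t:{-1<..<1}|lebesgue. ln (conf_mod m a b (p j + t)) * dens c (p j + t))"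
  have Si: "\<forall>\<^sub>F R in at_top. ((\<lambda>t. dens c t * ln (conf_mod m a b t)) has_integral S) {-R..R}"
    unfolding S_def by (rule dens_split[of "\<lambda>t. ln (conf_mod m a b t)", OF int])
  have "\<forall>\<^sub>F R in at_top. R \<ge> \<bar>m\<bar> + b" by (rule eventually_ge_at_top)
  then have "\<forall>\<^sub>F R::real in at_top. pot c ?x = S"
    using bi dens_ln_has_integral[of c ?x] Si
  proof eventually_elim
    case (elim R)
    \<comment> \<open>Outside the bands the arguments of the two logarithms agree; on the bands
      \<open>slope\<close> vanishes; in the gap their difference is \<open>- pi / 2\<close>, and
      \<open>slope\<close> has integral 0 there.\<close>
    have g: "((\<lambda>t. slope c t * Im (?BV t)) has_integral 0) {-R..R}"
    proof (rule has_integral_spike_finite[OF fN])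
      have "((\<lambda>t. - pi / 2 * (if t \<in> {m - a..m + a} then slope c t else 0)) has_integral - pi / 2 * 0) {-R..R}"
        using gap elim ab by (intro has_integral_mult_right) (subst has_integral_restrict; auto)
      then show "((\<lambda>t. - pi / 2 * (if t \<in> {m - a..m + a} then slope c t else 0)) has_integral 0) {-R..R}"
        by (simp only: mult_zero_right)
      fix t assume "t \<in> {-R..R} - N"
      then have tN: "t \<notin> N" by auto
      note tab = N_iff[OF tN]
      consider "\<bar>t - m\<bar> < a" | "a < \<bar>t - m\<bar>" "\<bar>t - m\<bar> < b" | "b < \<bar>t - m\<bar>" using tab by linarith
      then show "slope c t * Im (?BV t) = - pi / 2 * (if t \<in> {m - a..m + a} then slope c t else 0)"
      proof cases
        case 1
        then have "t \<in> {m - a..m + a}" "sgn (t - ?x) = -1" using ab by (auto simp: sgn_if)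
        then show ?thesis using G0(5)[OF tN 1] by simp
      next
        case 2
        then show ?thesis using band[OF 2] by simp
      next
        case 3
        then have "t \<notin> {m - a..m + a}" using ab by auto
        moreover have "sgn (t - ?x) = sgn (t - m)" using 3 ab by (auto simp: sgn_if)
        ultimately have "(if t \<in> {m - a..m + a} then slope c t else 0) = 0" "Im (?BV t) = 0"
          using G0(4)[OF tN 3] by auto
        then show ?thesis by (simp only: mult_zero_right)
      qed
    qed
    have "((\<lambda>t. (dens c t * Re (?BV t) - slope c t * Im (?BV t)) + slope c t * Im (?BV t)) has_integral 0 + 0) {-R..R}"
      by (intro has_integral_add elim g)
    then have sum0: "((\<lambda>t. (dens c t * Re (?BV t) - slope c t * Im (?BV t)) + slope c t * Im (?BV t)) has_integral 0) {-R..R}"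
      by (simp only: add_0_right)
    have "((\<lambda>t. dens c t * ln \<bar>t - ?x\<bar> - dens c t * ln (conf_mod m a b t)) has_integral 0) {-R..R}"
    proof (rule has_integral_spike_finite[OF fN _ sum0])
      fix t assume "t \<in> {-R..R} - N"
      then have "t \<notin> N" by auto
      moreover from G0(2)[OF this] have "G0 t \<noteq> 0" by auto
      ultimately have "Re (Ln (G0 t)) = ln (conf_mod m a b t)" using G0(3) by simp
      then show "dens c t * ln \<bar>t - ?x\<bar> - dens c t * ln (conf_mod m a b t)
         = (dens c t * Re (?BV t) - slope c t * Im (?BV t)) + slope c t * Im (?BV t)"
        by (simp add: right_diff_distrib)
    qed
    moreover have "((\<lambda>t. dens c t * ln \<bar>t - ?x\<bar> - dens c t * ln (conf_mod m a b t)) has_integral pot c ?x - S) {-R..R}"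
      by (intro has_integral_diff elim)
    ultimately have "pot c ?x - S = 0" using has_integral_unique by blast
    then show ?case by simp
  qed
  then show "pot c ?x = S" by simp
qed

end

section \<open>The equilibrium density\<close>

lemma prod_linear_dvd:
  fixes q :: "real poly"
  assumes "finite M" "inj_on r M" "\<And>m. m \<in> M \<Longrightarrow> poly q (r m) = 0"
  shows "(\<Prod>m\<in>M. [:- r m, 1:]) dvd q"
  using assms
proof (induction M)
  case (insert x M)
  then have "(\<Prod>m\<in>M. [:- r m, 1:]) dvd q" by (auto simp: inj_on_insert)
  then obtain s where s: "q = (\<Prod>m\<in>M. [:- r m, 1:]) * s" by (elim dvdE)
  have "(\<Prod>m\<in>M. r x - r m) * poly s (r x) = 0"
    using insert.prems(2)[of x] unfolding s by (simp add: poly_prod)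
  moreover have "(\<Prod>m\<in>M. r x - r m) \<noteq> 0"
    using insert by (auto simp: inj_on_insert)
  ultimately have "poly s (r x) = 0" by simp
  then have "[:- r x, 1:] dvd s" by (simp add: poly_eq_0_iff_dvd)
  then have "[:- r x, 1:] * (\<Prod>m\<in>M. [:- r m, 1:]) dvd s * (\<Prod>m\<in>M. [:- r m, 1:])" by (rule mult_dvd_mono) simp
  then show ?case using insert.hyps s by (simp add: mult.commute)
qed simp

lemma set_lebesgue_integral_pos:
  fixes f :: "real \<Rightarrow> real"
  assumes f: "f absolutely_integrable_on {u<..<v}" and uv: "u < v"
    and pos: "\<And>t. t \<in> {u<..<v} \<Longrightarrow> 0 < f t"
  shows "0 < (LINT t:{u<..<v}|lebesgue. f t)"
proof -
  let ?g = "\<lambda>t. indicator {u<..<v} t *\<^sub>R f t"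
  have nn: "AE t in lebesgue. 0 \<le> ?g t" using pos by (intro AE_I2) (simp add: indicator_def less_imp_le)
  have "0 \<le> (LINT t|lebesgue. ?g t)" by (rule integral_nonneg_AE[OF nn])
  moreover have "(LINT t|lebesgue. ?g t) \<noteq> 0"
  proof
    assume "(LINT t|lebesgue. ?g t) = 0"
    then have "AE t in lebesgue. ?g t = 0"
      using integral_nonneg_eq_0_iff_AE[OF f[unfolded set_integrable_def] nn] by simp
    then have "AE t in lebesgue. t \<notin> {u<..<v}"
    proof eventually_elim
      case (elim t)
      show ?case
      proof
        assume "t \<in> {u<..<v}"
        then show False using elim pos[of t] by simp
      qed
    qed
    then have "{u<..<v} \<in> null_sets lebesgue" by (subst AE_iff_null_sets) auto
    then have "emeasure lebesgue {u<..<v} = 0" by auto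
    then show False using uv by simp
  qed
  ultimately show ?thesis unfolding set_lebesgue_integral_def by linarith
qed

context interval_system
begin

section \<open>Zeros of the numerator in the gaps and the sign of the density\<close>

definition numer_poly :: "('n \<Rightarrow> real) \<Rightarrow> real poly" where
  "numer_poly c = (\<Sum>k\<in>UNIV. smult (c k) (\<Prod>j\<in>UNIV - {k}. [:- p j, 1:]))"

lemma poly_numer_poly: "poly (numer_poly c) t = numer c t"
  by (simp add: numer_poly_def numer_def poly_sum poly_prod)

lemma degree_numer_poly: "degree (numer_poly c) \<le> CARD('n) - 1"
  unfolding numer_poly_def
proof (rule degree_sum_le)
  fix k :: 'n
  have "degree (smult (c k) (\<Prod>j\<in>UNIV - {k}. [:- p j, 1:])) \<le> degree (\<Prod>j\<in>UNIV - {k}. [:- p j, 1:])"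
    by (rule degree_smult_le)
  also have "\<dots> \<le> sum (degree \<circ> (\<lambda>j. [:- p j, 1:])) (UNIV - {k})" by (rule degree_prod_sum_le) simp
  also have "\<dots> = CARD('n) - 1" by (simp add: card_Diff_singleton)
  finally show "degree (smult (c k) (\<Prod>j\<in>UNIV - {k}. [:- p j, 1:])) \<le> CARD('n) - 1" .
qed simp

lemma numer_factor:
  fixes r :: "'n \<Rightarrow> real"
  assumes inj: "inj_on r (UNIV - {m0})" and root: "\<And>m. m \<noteq> m0 \<Longrightarrow> numer c (r m) = 0"
  obtains C where "\<And>t. numer c t = C * (\<Prod>m\<in>UNIV - {m0}. t - r m)"
proof (cases "numer_poly c = 0")
  case True
  then have "numer c t = 0" for t using poly_numer_poly[of c t] by simp
  then show ?thesis using that[of 0] by simp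
next
  case False
  let ?P = "\<Prod>m\<in>UNIV - {m0}. [:- r m, 1:]"
  have "?P dvd numer_poly c"
    by (rule prod_linear_dvd[OF _ inj]) (use root in \<open>auto simp: poly_numer_poly\<close>)
  then obtain s where s: "numer_poly c = ?P * s" by (elim dvdE)
  have "s \<noteq> 0" "?P \<noteq> 0" using False s by auto
  then have "degree (numer_poly c) = degree ?P + degree s" unfolding s by (rule degree_mult_eq[rotated])
  moreover have "degree ?P = CARD('n) - 1"
    by (subst degree_prod_eq_sum_degree) (auto simp: card_Diff_singleton)
  ultimately have "degree s = 0" using degree_numer_poly[of c] by linarith
  then obtain C where "s = [:C:]" by (rule degree_eq_zeroE)
  then have "numer c t = C * (\<Prod>m\<in>UNIV - {m0}. t - r m)" for t
    unfolding poly_numer_poly[symmetric] s by (simp add: poly_prod)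
  then show ?thesis by (rule that)
qed

text \<open>Lagrange interpolation: the numerator determines its coefficients, so it vanishes
  identically only for \<open>c = 0\<close>.\<close>

lemma numer_center: "numer c (p k) = c k * (\<Prod>j\<in>UNIV - {k}. p k - p j)"
proof -
  have "(\<Prod>j\<in>UNIV - {i}. p k - p j) = 0" if "i \<noteq> k" for i
    using that by (intro prod_zero) auto
  then have "numer c (p k) = (\<Sum>i\<in>UNIV. if i = k then c k * (\<Prod>j\<in>UNIV - {k}. p k - p j) else 0)"
    unfolding numer_def by (intro sum.cong) auto
  then show ?thesis by simp
qed

text \<open>A Rolle argument: \<open>slope\<close> has integral 0 over the gap between neighbours
  and is the numerator times a factor without zeros there, so without a root it would keep one
  strict sign. The open gap is used because the factor blows up at its ends.\<close>

lemma root_in_gap: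
  assumes lt: "p i < p m" and adj: "\<And>j. p j < p m \<Longrightarrow> p j \<le> p i" and pot: "pot c (p i) = pot c (p m)"
  shows "\<exists>r. p i + 1 < r \<and> r < p m - 1 \<and> numer c r = 0"
proof (rule ccontr)
  assume no: "\<not> ?thesis"
  let ?G = "{p i + 1<..<p m - 1}"
  have "\<bar>p i - p m\<bar> > 2" using sep[of i m] lt by auto
  then have ne: "p i + 1 < p m - 1" using lt by auto
  have far: "\<bar>t - p j\<bar> > 1 \<and> sgn (t - p j) = (if p j \<le> p i then 1 else -1)" if t: "t \<in> ?G" for t j
  proof (cases "p j \<le> p i")
    case True
    then show ?thesis using t by (auto simp: sgn_if)
  next
    case False
    then have "p m \<le> p j" using adj[of j] by linarith
    then show ?thesis using t False by (auto simp: sgn_if)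
  qed
  have slope: "slope c t = - (numer c t * (\<Prod>j\<in>UNIV. (if p j \<le> p i then 1 else -1) / sqrt \<bar>1 - (t - p j)\<^sup>2\<bar>))"
    if t: "t \<in> ?G" for t
  proof -
    have "\<not> inside t" unfolding inside_def using far[OF t] by (meson less_asym)
    moreover have "weight j t = (if p j \<le> p i then 1 else -1) / sqrt \<bar>1 - (t - p j)\<^sup>2\<bar>" for j
      unfolding weight_def using far[OF t, of j] by simp
    ultimately show ?thesis by (simp add: slope_def)
  qed
  have sq: "sqrt \<bar>1 - (t - p j)\<^sup>2\<bar> \<noteq> 0" if t: "t \<in> ?G" for t j
    using far[OF t, of j] abs_square_eq_1[of "t - p j"] by (auto simp: power2_eq_1_iff)
  have "continuous_on ?G (\<lambda>t. - (numer c t * (\<Prod>j\<in>UNIV. (if p j \<le> p i then 1 else -1) / sqrt \<bar>1 - (t - p j)\<^sup>2\<bar>)))"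
    unfolding numer_def using sq by (intro continuous_intros ballI) auto
  then have cont: "continuous_on ?G (slope c)" by (subst continuous_on_cong[OF refl slope])
  have nz: "slope c t \<noteq> 0" if t: "t \<in> ?G" for t
    using no t sq[OF t] unfolding slope[OF t] by auto
  have "connected (slope c ` ?G)" by (intro connected_continuous_image cont) simp
  then have ivt: "u \<in> slope c ` ?G \<Longrightarrow> v \<in> slope c ` ?G \<Longrightarrow> u \<le> x \<Longrightarrow> x \<le> v \<Longrightarrow> x \<in> slope c ` ?G" for u v x
    by (meson connected_iff_interval)
  have int: "(slope c has_integral 0) ?G"
  proof -
    have "pot c (p i + 1) = pot c (p i)" "pot c (p m - 1) = pot c (p m)" by (rule pot_constant[where j = i] pot_constant[where j = m]; simp)+
    then show ?thesis using slope_has_integral[OF ne, of c] pot by (simp add: has_integral_Icc_iff_Ioo)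
  qed
  obtain \<sigma> :: real where \<sigma>: "\<And>t. t \<in> ?G \<Longrightarrow> 0 < \<sigma> * slope c t"
  proof (cases "\<exists>t\<in>?G. slope c t > 0")
    case True
    then obtain t0 where t0: "t0 \<in> ?G" "slope c t0 > 0" by blast
    have "0 < slope c t" if "t \<in> ?G" for t
    proof (rule ccontr)
      assume "\<not> 0 < slope c t"
      then have "0 \<in> slope c ` ?G" using t0 that by (intro ivt[of "slope c t" "slope c t0" 0]) auto
      then show False using nz by auto
    qed
    then show ?thesis using that[of 1] by simp
  next
    case False
    then have "slope c t < 0" if "t \<in> ?G" for t using nz[OF that] that by force
    then show ?thesis using that[of "-1"] by simp
  qed
  have "((\<lambda>t. \<sigma> * slope c t) has_integral \<sigma> * 0) ?G" by (rule has_integral_mult_right[OF int])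
  then have hi: "((\<lambda>t. \<sigma> * slope c t) has_integral 0) ?G" by simp
  then have "(\<lambda>t. \<sigma> * slope c t) absolutely_integrable_on ?G"
    using \<sigma> by (intro nonnegative_absolutely_integrable_1) (auto simp: less_imp_le)
  from set_lebesgue_integral_pos[OF this ne \<sigma>] set_lebesgue_integral_eq_integral(2)[OF this]
  show False unfolding integral_unique[OF hi] by linarith
qed

text \<open>A potential that is constant on the whole set forces a zero of the numerator into each of the
  \<open>n - 1\<close> gaps. This accounts for all zeros, so the density has no sign change.\<close>

lemma dens_one_sign:
  assumes pot: "\<And>i j. pot c (p i) = pot c (p j)"
  obtains C P where "\<And>k t. \<bar>t\<bar> < 1 \<Longrightarrow> 0 < P k t \<and> dens c (p k + t) = C * P k t" "C = 0 \<Longrightarrow> \<forall>k. c k = 0"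
proof -
  have inj_p: "p i \<noteq> p j" if "i \<noteq> j" for i j using sep[OF that] by auto
  have fin: "finite (range p)" by simp
  obtain m0 where m0: "\<And>j. p m0 \<le> p j"
    using Min_in[OF fin] Min_le[OF fin] by (metis UNIV_I empty_iff imageE image_eqI rangeI)
  \<comment> \<open>The left neighbour. Each gap is labelled by the interval to its right, so the
    labels are all indices except the leftmost one, \<open>m0\<close>.\<close>
  have "\<exists>i. p i < p m \<and> (\<forall>j. p j < p m \<longrightarrow> p j \<le> p i)" if "m \<noteq> m0" for m
  proof -
    let ?S = "p ` {j. p j < p m}"
    have "p m0 < p m" using m0[of m] inj_p[OF that] by linarith
    then have "?S \<noteq> {}" by auto
    then have "Max ?S \<in> ?S" by (intro Max_in) auto
    then obtain i where "p i < p m" "Max ?S = p i" by auto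
    moreover have "p j \<le> Max ?S" if "p j < p m" for j using that by (intro Max_ge) auto
    ultimately show ?thesis by auto
  qed
  then obtain prev where prev: "\<And>m. m \<noteq> m0 \<Longrightarrow> p (prev m) < p m" "\<And>m j. m \<noteq> m0 \<Longrightarrow> p j < p m \<Longrightarrow> p j \<le> p (prev m)"
    by metis
  have "\<exists>r. p (prev m) + 1 < r \<and> r < p m - 1 \<and> numer c r = 0" if "m \<noteq> m0" for m
    by (rule root_in_gap[OF prev(1)[OF that] prev(2)[OF that] pot])
  then obtain r where r: "\<And>m. m \<noteq> m0 \<Longrightarrow> p (prev m) + 1 < r m" "\<And>m. m \<noteq> m0 \<Longrightarrow> r m < p m - 1" "\<And>m. m \<noteq> m0 \<Longrightarrow> numer c (r m) = 0"
    by metis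
  have r_less: "r m < r m'" if "m \<noteq> m0" "m' \<noteq> m0" "p m < p m'" for m m'
    using r(2)[OF that(1)] r(1)[OF that(2)] prev(2)[OF that(2,3)] by linarith
  have inj_r: "inj_on r (UNIV - {m0})"
  proof (rule inj_onI, rule ccontr)
    fix m m' assume h: "m \<in> UNIV - {m0}" "m' \<in> UNIV - {m0}" "r m = r m'" "m \<noteq> m'"
    then have "p m < p m' \<or> p m' < p m" using inj_p[of m m'] by linarith
    then show False using r_less[of m m'] r_less[of m' m] h by auto
  qed
  obtain C where C: "\<And>t. numer c t = C * (\<Prod>m\<in>UNIV - {m0}. t - r m)"
    by (rule numer_factor[OF inj_r r(3)]) blast+
  \<comment> \<open>Each root is paired with the weight of the interval to the right of its gap:
    seen from interval \<open>k\<close>, both factors of a pair are positive for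
    \<open>p m \<le> p k\<close> and both negative otherwise.\<close>
  define P where "P k t = weight m0 (p k + t) * (\<Prod>m\<in>UNIV - {m0}. (p k + t - r m) * weight m (p k + t))" for k t
  show thesis
  proof (rule that[of P C])
    fix k t assume t: "\<bar>t\<bar> < (1::real)"
    let ?t = "p k + t"
    have "\<bar>?t - p k\<bar> < 1" using t by simp
    note un = inside_unique[OF this]
    have wpos: "0 < weight j ?t" if "p j \<le> p k" for j
    proof (cases "j = k")
      case True
      have "t\<^sup>2 < 1" using t by (simp add: abs_square_less_1)
      then show ?thesis using True t by (simp add: weight_def)
    next
      case False
      then have "sgn (p k - p j) = 1" using that inj_p[of j k] by (simp add: sgn_if)
      then show ?thesis using weight_off(1,2)[of t j k] t False by simp
    qed
    have wneg: "weight j ?t < 0" if "p k < p j" for j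
    proof -
      have jk: "j \<noteq> k" using that by auto
      have "sgn (p k - p j) = -1" using that by (simp add: sgn_if)
      then show ?thesis using weight_off(1,2)[of t j k] t jk by simp
    qed
    have "0 < (?t - r m) * weight m ?t" if m: "m \<noteq> m0" for m
    proof (cases "p m \<le> p k")
      case True
      have "r m < ?t" using r(2)[OF m] True t by (auto simp: abs_less_iff)
      then show ?thesis using wpos[OF True] by simp
    next
      case False
      then have km: "p k < p m" by simp
      have "?t < r m" using r(1)[OF m] prev(2)[OF m km] t by (auto simp: abs_less_iff)
      then show ?thesis using wneg[OF km] by (simp add: mult_neg_neg)
    qed
    then have "0 < (\<Prod>m\<in>UNIV - {m0}. (?t - r m) * weight m ?t)" by (intro prod_pos) auto
    then have "0 < P k t" unfolding P_def using wpos[OF m0] by simp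
    moreover have "dens c ?t = C * P k t"
    proof -
      have "inside ?t" unfolding inside_def using \<open>\<bar>?t - p k\<bar> < 1\<close> by blast
      then have "dens c ?t = numer c ?t * (\<Prod>j\<in>UNIV. weight j ?t)" by (simp add: dens_def)
      also have "(\<Prod>j\<in>UNIV. weight j ?t) = weight m0 ?t * (\<Prod>m\<in>UNIV - {m0}. weight m ?t)" by (rule prod.remove) auto
      finally show ?thesis unfolding C P_def prod.distrib by (simp only: mult_ac)
    qed
    ultimately show "0 < P k t \<and> dens c ?t = C * P k t" ..
  next
    assume "C = 0"
    then have "c k * (\<Prod>j\<in>UNIV - {k}. p k - p j) = 0" for k using C numer_center[of c k] by simp
    moreover have "(\<Prod>j\<in>UNIV - {k}. p k - p j) \<noteq> 0" for k using inj_p by (auto simp: prod_zero_iff)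
    ultimately show "\<forall>k. c k = 0" by (metis mult_eq_0_iff)
  qed
qed

text \<open>Multiplication by the unknown constant \<open>C\<close> of the density treats both signs
  at once: the integrand becomes \<open>C * C\<close> times a positive function.\<close>

lemma weighted_mass_nonzero:
  assumes pot: "\<And>i j. pot c (p i) = pot c (p j)" and c: "c k \<noteq> 0"
    and w: "\<And>j t. \<bar>t\<bar> < 1 \<Longrightarrow> 0 < w j t" "\<And>j. (\<lambda>t. w j t * dens c (p j + t)) absolutely_integrable_on {-1<..<1}"
  shows "(\<Sum>j\<in>UNIV. LINT t:{-1<..<1}|lebesgue. w j t * dens c (p j + t)) \<noteq> 0"
proof -
  obtain C P where P: "\<And>k t. \<bar>t\<bar> < 1 \<Longrightarrow> 0 < P k t \<and> dens c (p k + t) = C * P k t" "C = 0 \<Longrightarrow> \<forall>k. c k = 0"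
    by (rule dens_one_sign[OF pot]) blast
  have C: "C \<noteq> 0" using P(2) c by blast
  have "0 < (LINT t:{-1<..<1}|lebesgue. C * (w j t * dens c (p j + t)))" for j
  proof (rule set_lebesgue_integral_pos)
    show "(-1::real) < 1" by simp
    show "(\<lambda>t. C * (w j t * dens c (p j + t))) absolutely_integrable_on {-1<..<1}"
      by (intro set_integrable_mult_right w(2))
    fix t :: real assume "t \<in> {-1<..<1}"
    then have t: "\<bar>t\<bar> < 1" by (simp add: abs_less_iff)
    have "C * (w j t * dens c (p j + t)) = (C * C) * (w j t * P j t)" using P(1)[OF t, of j] by simp
    moreover have "0 < C * C" using C by (simp add: zero_less_mult_iff) linarith
    then have "0 < (C * C) * (w j t * P j t)"
      by (rule mult_pos_pos[OF _ mult_pos_pos[OF w(1)[OF t] conjunct1[OF P(1)[OF t]]]])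
    ultimately show "0 < C * (w j t * dens c (p j + t))" by (simp only:)
  qed
  then have "0 < (\<Sum>j\<in>UNIV. LINT t:{-1<..<1}|lebesgue. C * (w j t * dens c (p j + t)))" by (intro sum_pos) auto
  also have "\<dots> = C * (\<Sum>j\<in>UNIV. LINT t:{-1<..<1}|lebesgue. w j t * dens c (p j + t))"
    by (simp add: sum_distrib_left)
  finally show ?thesis by auto
qed

text \<open>The logarithmic kernel changes sign, so one-signedness of the density says nothing
  directly. After the exchange of kernels the weight \<open>ln (conf_mod m a b t)\<close> has one
  sign on the whole of \<open>E\<close>, and the potential is a nonzero weighted mass.\<close>

lemma pot_nonzero:
  assumes pot: "\<And>i j. pot c (p i) = pot c (p j)" and c: "c k \<noteq> 0"
  shows "pot c (p k) \<noteq> 0"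
proof (cases "\<exists>j. j \<noteq> k")
  case True
  then obtain j where jk: "j \<noteq> k" by blast
  obtain i l where il: "p i < p l"
    using sep[OF jk] by (metis abs_zero diff_self less_linear not_less_iff_gr_or_eq zero_less_numeral)
  have s: "\<bar>p i - p l\<bar> > 2" using sep[of i l] il by auto
  define m where "m = (p i + p l) / 2"
  define a where "a = (p l - p i) / 2 - 1"
  define b where "b = (p l - p i) / 2 + 1"
  have ab: "0 \<le> a" "a < b" using s il by (auto simp: a_def b_def)
  have e: "m - a = p i + 1" "m + a = p l - 1" "m + b = p l + 1" "m - b = p i - 1"
    by (auto simp: m_def a_def b_def field_simps)
  have band: "slope c t = 0" if "a < \<bar>t - m\<bar>" "\<bar>t - m\<bar> < b" for t
  proof -
    have "\<bar>t - p i\<bar> < 1 \<or> \<bar>t - p l\<bar> < 1" using that e by linarith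
    then show ?thesis using slope_inside by blast
  qed
  \<comment> \<open>Further intervals may lie between \<open>i\<close> and \<open>l\<close>. Only
    the total integral of \<open>slope\<close> across the gap has to vanish, and it is a difference
    of two equal potentials.\<close>
  have "pot c (p i + 1) = pot c (p i)" "pot c (p l - 1) = pot c (p l)" by (rule pot_constant[where j = i] pot_constant[where j = l]; simp)+
  then have "(slope c has_integral 0) {p i + 1..p l - 1}"
    using slope_has_integral[of "p i + 1" "p l - 1" c] pot[of i l] s il by simp
  then have gap: "(slope c has_integral 0) {m - a..m + a}" by (simp only: e)
  have cf: "pot c (m + b) = (\<Sum>j\<in>UNIV. LINT t:{-1<..<1}|lebesgue. ln (conf_mod m a b (p j + t)) * dens c (p j + t))"
    "(\<lambda>t. ln (conf_mod m a b (p j + t)) * dens c (p j + t)) absolutely_integrable_on {-1<..<1}" for j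
    by (rule pot_eq_conf[OF ab _ gap]; rule band; assumption)+
  have pos: "0 < ln (conf_mod m a b t)" for t
  proof -
    \<comment> \<open>The capacity is \<open>sqrt (2 * (p l - p i)) / 2\<close>, which exceeds 1
      exactly when the centres are more than 2 apart.\<close>
    have "b\<^sup>2 - a\<^sup>2 = 2 * (p l - p i)" by (simp add: a_def b_def power2_eq_square field_simps)
    then have "sqrt (2\<^sup>2) < sqrt (b\<^sup>2 - a\<^sup>2)" using s il by (intro real_sqrt_less_mono) auto
    then have "1 < sqrt (b\<^sup>2 - a\<^sup>2) / 2" by simp
    then show ?thesis using conf_mod_ge[OF ab, of m t] by (intro ln_gt_zero) linarith
  qed
  have "pot c (m + b) \<noteq> 0"
    unfolding cf(1) 
    by (rule weighted_mass_nonzero[where w = "\<lambda>j t. ln (conf_mod m a b (p j + t))", OF pot c _ cf(2)]) (rule pos)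
  moreover have "pot c (m + b) = pot c (p l)" unfolding e by (rule pot_constant[where j = l]) auto
  ultimately show ?thesis using pot[of l k] by simp
next
  case False
  then have only: "j = k" for j by blast
  define m where "m = p k"
  have ab: "(0::real) \<le> 0" "(0::real) < 1" by auto
  have band: "slope c t = 0" if "0 < \<bar>t - m\<bar>" "\<bar>t - m\<bar> < 1" for t
    using that slope_inside[of t k] by (simp add: m_def)
  have gap: "(slope c has_integral 0) {m - 0..m + 0}" using has_integral_refl(2)[of "slope c" m] by simp
  have cf: "pot c (m + 1) = (\<Sum>j\<in>UNIV. LINT t:{-1<..<1}|lebesgue. ln (conf_mod m 0 1 (p j + t)) * dens c (p j + t))"
    "(\<lambda>t. ln (conf_mod m 0 1 (p j + t)) * dens c (p j + t)) absolutely_integrable_on {-1<..<1}" for j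
    by (rule pot_eq_conf[OF ab _ gap]; rule band; assumption)+
  have half: "conf_mod m 0 1 (p j + t) = 1 / 2" if "\<bar>t\<bar> < 1" for j t
    using that only[of j] by (simp add: conf_mod_def m_def)
  \<comment> \<open>Here the capacity is 1/2, its logarithm is negative, and the weight is its
    opposite.\<close>
  have "(\<Sum>j\<in>UNIV. LINT t:{-1<..<1}|lebesgue. (- ln (conf_mod m 0 1 (p j + t))) * dens c (p j + t)) \<noteq> 0"
  proof (rule weighted_mass_nonzero[OF pot c])
    show "0 < - ln (conf_mod m 0 1 (p j + t))" if "\<bar>t\<bar> < 1" for j t using half[OF that, of j] by (simp add: ln_div)
    show "(\<lambda>t. - ln (conf_mod m 0 1 (p j + t)) * dens c (p j + t)) absolutely_integrable_on {- 1<..<1}" for j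
      using set_integrable_mult_right[OF cf(2), of "-1" j] by simp
  qed
  then have "pot c (m + 1) \<noteq> 0" unfolding cf(1) by (simp add: set_integral_uminus[OF cf(2)] sum_negf)
  moreover have "pot c (m + 1) = pot c (p k)" unfolding m_def by (rule pot_constant[where j = k]) auto
  ultimately show ?thesis by simp
qed

section \<open>Linear algebra for the boundary constants\<close>

lemma dens_add: "dens (\<lambda>k. c k + c' k) t = dens c t + dens c' t"
  by (simp add: dens_def numer_def distrib_right sum.distrib)

lemma dens_scale: "dens (\<lambda>k. a * c k) t = a * dens c t"
  by (simp add: dens_def numer_def sum_distrib_left mult.assoc)

lemma pot_add: "pot (\<lambda>k. c k + c' k) x = pot c x + pot c' x"
  unfolding pot_def dens_add distrib_left
  by (simp only: set_integral_add(2)[OF pot_integrable pot_integrable] sum.distrib)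

lemma pot_scale: "pot (\<lambda>k. a * c k) x = a * pot c x"
  unfolding pot_def dens_scale by (simp add: mult.left_commute sum_distrib_left)

text \<open>Besides solvability the total mass must not vanish, since its reciprocal is the constant
  in the expansion; this is the sign argument once more, with weight 1.\<close>

lemma equilibrium_density:
  obtains c where "\<And>x i. \<bar>x - p i\<bar> \<le> 1 \<Longrightarrow> pot c x = 1"
    "(\<Sum>j\<in>UNIV. LINT t:{-1<..<1}|lebesgue. dens c (p j + t)) \<noteq> 0"
proof -
  define T :: "real ^ 'n \<Rightarrow> real ^ 'n" where "T v = (\<chi> i. pot (\<lambda>k. v $ k) (p i))" for v
  have lin: "linear T"
    by (rule linearI) (auto simp: T_def vec_eq_iff pot_add pot_scale)
  have "inj T"
  proof (subst linear_injective_0[OF lin], intro allI impI)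
    fix v assume "T v = 0"
    then have z: "pot (\<lambda>k. v $ k) (p i) = 0" for i by (simp add: T_def vec_eq_iff)
    show "v = 0"
    proof (rule ccontr)
      assume "v \<noteq> 0"
      then obtain k where "v $ k \<noteq> 0" by (auto simp: vec_eq_iff)
      then show False using pot_nonzero[of "\<lambda>k. v $ k" k] z by simp
    qed
  qed
  then have "surj T" by (rule linear_injective_imp_surjective[OF lin]) simp
  then obtain v where v: "T v = (\<chi> i. 1)" by (metis surjD)
  define c where "c = (\<lambda>k. v $ k)"
  have c1: "pot c (p i) = 1" for i using v by (simp add: T_def vec_eq_iff c_def)
  obtain k where k: "c k \<noteq> 0"
  proof (rule ccontr)
    assume "\<not> thesis"
    then have "c = (\<lambda>k. 0 * c k)" using that by auto
    then have "pot c (p undefined) = 0 * pot c (p undefined)" by (metis pot_scale)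
    then show False using c1[of undefined] by simp
  qed
  show thesis
  proof (rule that)
    show "pot c x = 1" if "\<bar>x - p i\<bar> \<le> 1" for x i
      using pot_constant[OF that, of "p i" c] c1[of i] by simp
    show "(\<Sum>j\<in>UNIV. LINT t:{-1<..<1}|lebesgue. dens c (p j + t)) \<noteq> 0"
    proof -
      have "(\<lambda>t. dens c (p j + t)) absolutely_integrable_on {-1<..<1}" for j
        using dens_arcsine_bounded[of c j] arcsine_integrable by blast
      then show ?thesis using weighted_mass_nonzero[of c k "\<lambda>_ _. 1"] c1 k by simp
    qed
  qed
qed

end

section \<open>The mixed problem on the disk\<close>

text \<open>One application of l'Hopital's rule leaves a symmetric quotient of \<open>g'\<close>,
  the mean of two ordinary difference quotients at 0; these converge because \<open>g'\<close> is
  differentiable at 0.\<close>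

lemma symmetric_second_difference:
  fixes g g' :: "real \<Rightarrow> real"
  assumes \<delta>: "0 < \<delta>" and g: "\<And>t. \<bar>t\<bar> < \<delta> \<Longrightarrow> (g has_real_derivative g' t) (at t)"
    and g': "(g' has_real_derivative A) (at 0)"
  shows "((\<lambda>t. (g t + g (- t) - 2 * g 0) / t\<^sup>2) \<longlongrightarrow> A) (at_right 0)"
proof (rule lhopital_right_0[where f' = "\<lambda>t. g' t - g' (- t)" and g' = "\<lambda>t. 2 * t"])
  have ev: "\<forall>\<^sub>F t in at_right (0::real). t \<in> {0<..<\<delta>}" by (rule eventually_at_right_real[OF \<delta>])
  have c0: "isCont g 0" using g[of 0] \<delta> by (intro DERIV_isCont) auto
  have "((\<lambda>t. g t + g (- t) - 2 * g 0) \<longlongrightarrow> g 0 + g 0 - 2 * g 0) (at 0)"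
    using c0 by (intro tendsto_intros isCont_tendsto_compose[of _ g]) (auto simp: isCont_def intro!: tendsto_eq_intros)
  then have "((\<lambda>t. g t + g (- t) - 2 * g 0) \<longlongrightarrow> 0) (at 0)" by simp
  then show "((\<lambda>t. g t + g (- t) - 2 * g 0) \<longlongrightarrow> 0) (at_right 0)"
    by (rule tendsto_within_subset) simp
  show "((\<lambda>t::real. t\<^sup>2) \<longlongrightarrow> 0) (at_right 0)" by (auto intro!: tendsto_eq_intros)
  show "\<forall>\<^sub>F t in at_right (0::real). t\<^sup>2 \<noteq> 0" using ev by eventually_elim auto
  show "\<forall>\<^sub>F t in at_right (0::real). 2 * t \<noteq> 0" using ev by eventually_elim auto
  show "\<forall>\<^sub>F t in at_right 0. ((\<lambda>t. g t + g (- t) - 2 * g 0) has_real_derivative g' t - g' (- t)) (at t)"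
    using ev
  proof eventually_elim
    case (elim t)
    have "((\<lambda>t. g (- t)) has_real_derivative g' (- t) * (- 1)) (at t)"
      using elim by (intro DERIV_chain2[where f = g and g = uminus] g) (auto intro!: derivative_eq_intros)
    then show ?case using g[of t] elim by (auto intro!: derivative_eq_intros)
  qed
  show "\<forall>\<^sub>F t in at_right (0::real). ((\<lambda>t. t\<^sup>2) has_real_derivative 2 * t) (at t)"
    by (intro always_eventually allI) (auto intro!: derivative_eq_intros)
  have q: "((\<lambda>t. (g' t - g' 0) / t) \<longlongrightarrow> A) (at 0)" using g' by (simp add: has_field_derivative_iff)
  have "filterlim uminus (at 0) (at (0::real))"
    by (auto simp: filterlim_at eventually_at_filter intro!: tendsto_eq_intros)
  from filterlim_compose[OF q this]
  have "((\<lambda>t. (g' (- t) - g' 0) / (- t)) \<longlongrightarrow> A) (at 0)" .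
  from tendsto_add[OF q this] have "((\<lambda>t. ((g' t - g' 0) / t + (g' (- t) - g' 0) / (- t)) / 2) \<longlongrightarrow> (A + A) / 2) (at 0)"
    by (intro tendsto_divide tendsto_const) auto
  then have lim: "((\<lambda>t. ((g' t - g' 0) / t + (g' (- t) - g' 0) / (- t)) / 2) \<longlongrightarrow> A) (at_right 0)"
    by (intro tendsto_within_subset[where S = UNIV and T = "{0<..}"]) auto
  have eq: "((g' t - g' 0) / t + (g' (- t) - g' 0) / (- t)) / 2 = (g' t - g' (- t)) / (2 * t)" for t
    by (cases "t = 0") (auto simp: field_simps)
  show "((\<lambda>t. (g' t - g' (- t)) / (2 * t)) \<longlongrightarrow> A) (at_right 0)" using lim unfolding eq .
qed

lemma partial_deriv_has_derivative:
  fixes f :: "'a::euclidean_space \<Rightarrow> real"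
  assumes "f differentiable_on S" "open S" "y \<in> S"
  shows "((\<lambda>s. f (y + s *\<^sub>R b)) has_real_derivative partial_deriv b f y) (at 0)"
proof -
  have "f differentiable (at y)" using assms by (metis differentiable_on_def at_within_open)
  then have "f differentiable (at (y + 0 *\<^sub>R b))" by simp
  moreover have "(\<lambda>s::real. y + s *\<^sub>R b) differentiable (at 0)" by (intro derivative_intros)
  ultimately have "(f \<circ> (\<lambda>s. y + s *\<^sub>R b)) differentiable (at 0)" by (intro differentiable_chain_at) auto
  then have "(\<lambda>s. f (y + s *\<^sub>R b)) differentiable (at 0)" by (simp add: o_def)
  then show ?thesis unfolding partial_deriv_def by (simp add: DERIV_deriv_iff_real_differentiable)
qed

lemma second_difference_partial_deriv:
  fixes f :: "'a::euclidean_space \<Rightarrow> real"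
  assumes f: "f differentiable_on S" "partial_deriv b f differentiable_on S" and S: "open S" "x \<in> S"
  shows "((\<lambda>t. (f (x + t *\<^sub>R b) + f (x - t *\<^sub>R b) - 2 * f x) / t\<^sup>2) \<longlongrightarrow> partial_deriv b (partial_deriv b f) x) (at_right 0)"
proof -
  obtain e where e: "0 < e" "ball x e \<subseteq> S" using S openE by blast
  define \<delta> where "\<delta> = e / (norm b + 1)"
  have nb: "0 < norm b + 1" by (smt (verit) norm_ge_zero)
  have \<delta>: "0 < \<delta>" using e nb by (simp add: \<delta>_def)
  have inS: "x + t *\<^sub>R b \<in> S" if "\<bar>t\<bar> < \<delta>" for t
  proof -
    have "\<bar>t\<bar> * (norm b + 1) < e" using that nb by (simp add: \<delta>_def pos_less_divide_eq)
    moreover have "\<bar>t\<bar> * norm b \<le> \<bar>t\<bar> * (norm b + 1)" by (intro mult_left_mono) auto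
    ultimately have "x + t *\<^sub>R b \<in> ball x e" by (simp add: dist_norm)
    then show ?thesis using e by blast
  qed
  have "((\<lambda>t. ((\<lambda>t. f (x + t *\<^sub>R b)) t + (\<lambda>t. f (x + t *\<^sub>R b)) (- t) - 2 * (\<lambda>t. f (x + t *\<^sub>R b)) 0) / t\<^sup>2) \<longlongrightarrow>
      partial_deriv b (partial_deriv b f) x) (at_right 0)"
  proof (rule symmetric_second_difference[OF \<delta>, where g' = "\<lambda>t. partial_deriv b f (x + t *\<^sub>R b)"])
    fix t :: real assume t: "\<bar>t\<bar> < \<delta>"
    have "((\<lambda>s. f ((x + t *\<^sub>R b) + s *\<^sub>R b)) has_real_derivative partial_deriv b f (x + t *\<^sub>R b)) (at 0)"
      by (rule partial_deriv_has_derivative[OF f(1) S(1) inS[OF t]])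
    then have "((\<lambda>s. (\<lambda>t. f (x + t *\<^sub>R b)) (s + t)) has_real_derivative partial_deriv b f (x + t *\<^sub>R b)) (at 0)"
      by (simp add: algebra_simps)
    then show "((\<lambda>t. f (x + t *\<^sub>R b)) has_real_derivative partial_deriv b f (x + t *\<^sub>R b)) (at t)"
      using DERIV_shift[of "\<lambda>t. f (x + t *\<^sub>R b)" _ 0 t] by simp
  next
    show "((\<lambda>t. partial_deriv b f (x + t *\<^sub>R b)) has_real_derivative partial_deriv b (partial_deriv b f) x) (at 0)"
      by (rule partial_deriv_has_derivative[OF f(2) S])
  qed
  then show ?thesis by simp
qed

lemma cross_diff_laplacian:
  assumes u: "C2_on u (ball 0 1)" and x: "x \<in> ball 0 1"
  shows "((\<lambda>t. cross_diff u x t / t\<^sup>2) \<longlongrightarrow> laplacian u x) (at_right 0)"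
proof -
  have B: "Basis = {(1, 0), (0, 1) :: real \<times> real}" by (auto simp: Basis_prod_def)
  have d: "u differentiable_on ball 0 1" "\<And>b. b \<in> Basis \<Longrightarrow> partial_deriv b u differentiable_on ball 0 1"
    using u by (auto simp: C2_on_def C1_on_def)
  have "((\<lambda>t. (u (x + t *\<^sub>R (1, 0)) + u (x - t *\<^sub>R (1, 0)) - 2 * u x) / t\<^sup>2
      + (u (x + t *\<^sub>R (0, 1)) + u (x - t *\<^sub>R (0, 1)) - 2 * u x) / t\<^sup>2)
      \<longlongrightarrow> partial_deriv (1, 0) (partial_deriv (1, 0) u) x + partial_deriv (0, 1) (partial_deriv (0, 1) u) x) (at_right 0)"
    by (intro tendsto_add second_difference_partial_deriv[OF d(1) d(2) open_ball x]) (auto simp: B)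
  moreover have "laplacian u x = partial_deriv (1, 0) (partial_deriv (1, 0) u) x + partial_deriv (0, 1) (partial_deriv (0, 1) u) x"
    unfolding laplacian_def B by simp
  moreover have "cross_diff u x t / t\<^sup>2 = (u (x + t *\<^sub>R (1, 0)) + u (x - t *\<^sub>R (1, 0)) - 2 * u x) / t\<^sup>2
      + (u (x + t *\<^sub>R (0, 1)) + u (x - t *\<^sub>R (0, 1)) - 2 * u x) / t\<^sup>2" for t
    unfolding cross_diff_def add_divide_distrib[symmetric] by simp
  ultimately show ?thesis by simp
qed

section \<open>Comparison of the solution with the potential of the arcs\<close>

lemma disk_principle_abs:
  assumes cont: "continuous_on (cball 0 1) w"
    and harm: "\<And>x. x \<in> ball 0 1 \<Longrightarrow> ((\<lambda>t. cross_diff w x t / t\<^sup>2) \<longlongrightarrow> 0) (at_right 0)"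
    and nd: "\<And>x. x \<in> sphere 0 1 - G \<Longrightarrow> has_normal_derivative w x 0 x"
    and arc: "norm e = 1" "r > 0" "\<And>x. x \<in> sphere 0 1 - G \<Longrightarrow> r \<le> norm (x - e)"
    and G: "\<And>x. x \<in> G \<Longrightarrow> \<bar>w x - m\<bar> \<le> K"
    and x: "x \<in> cball 0 1"
  shows "\<bar>w x - m\<bar> \<le> K"
proof -
  have "m - K \<le> w x"
  proof (rule disk_minimum_principle[OF cont harm nd arc _ x])
    show "m - K \<le> w y" if "y \<in> G" for y using G[OF that] by linarith
  qed
  moreover have "- m - K \<le> (- 1) * w x"
  proof (rule disk_minimum_principle[where w = "\<lambda>x. (- 1) * w x", OF _ _ _ arc _ x])
    show "continuous_on (cball 0 1) (\<lambda>x. - 1 * w x)" by (intro continuous_intros cont)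
    show "((\<lambda>t. cross_diff (\<lambda>x. - 1 * w x) y t / t\<^sup>2) \<longlongrightarrow> 0) (at_right 0)" if "y \<in> ball 0 1" for y
      using tendsto_mult_left[OF harm[OF that], of "- 1"] unfolding cross_diff_cmult by simp
    show "has_normal_derivative (\<lambda>x. - 1 * w x) y 0 y" if "y \<in> sphere 0 1 - G" for y
      using has_normal_derivative_cmult[OF nd[OF that], of "- 1"] by simp
    show "- m - K \<le> - 1 * w y" if "y \<in> G" for y using G[OF that] by linarith
  qed
  ultimately show ?thesis by linarith
qed

text \<open>Supplies the radius for the barrier: a circle point off the arc has an angle between
  \<open>\<epsilon>\<close> and \<open>2 * pi - \<epsilon>\<close> from the centre, and the chord
  \<open>2 * sin (t / 2)\<close> is smallest at the two ends of this range.\<close>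

lemma boundary_arc_neighbourhood:
  assumes \<epsilon>: "0 < \<epsilon>" "\<epsilon> \<le> 1" and x: "norm x = 1" "x \<notin> boundary_arc s \<epsilon>"
  shows "2 * sin (\<epsilon> / 2) \<le> norm (x - circle_point s)"
proof -
  obtain a b where ab: "x = (a, b)" by (cases x)
  have n: "a\<^sup>2 + b\<^sup>2 = 1" using x(1) norm_Pair_power2[of a b] by (simp add: ab)
  \<comment> \<open>Rotation by \<open>- s\<close>: the rotated coordinates are the cosine and sine
    of the angle from the arc's centre.\<close>
  have "(a * cos s + b * sin s)\<^sup>2 + (b * cos s - a * sin s)\<^sup>2 = (a\<^sup>2 + b\<^sup>2) * ((sin s)\<^sup>2 + (cos s)\<^sup>2)"
    by algebra
  also have "\<dots> = 1" using n by simp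
  finally obtain t where t: "0 \<le> t" "t \<le> 2 * pi" "a * cos s + b * sin s = cos t" "b * cos s - a * sin s = sin t"
    using sincos_total_2pi_le by blast
  have cs: "cos s * cos s + sin s * sin s = 1" using sin_cos_squared_add2[of s] by (simp add: power2_eq_square)
  have "cos (s + t) = a * (cos s * cos s + sin s * sin s)"
    unfolding cos_add t(3,4)[symmetric] by algebra
  moreover have "sin (s + t) = b * (cos s * cos s + sin s * sin s)"
    unfolding sin_add t(3,4)[symmetric] by algebra
  ultimately have xt: "x = circle_point (s + t)" unfolding cs by (simp add: ab circle_point_def)
  have "\<epsilon> \<le> t"
  proof (rule ccontr)
    assume "\<not> \<epsilon> \<le> t"
    then have "x \<in> boundary_arc s \<epsilon>" unfolding xt boundary_arc_def using t \<epsilon> by (intro imageI) auto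
    then show False using x by simp
  qed
  moreover have "t \<le> 2 * pi - \<epsilon>"
  proof (rule ccontr)
    assume "\<not> t \<le> 2 * pi - \<epsilon>"
    moreover have "x = circle_point (s + t - 2 * pi)" unfolding xt circle_point_def by (simp add: sin_diff cos_diff)
    ultimately have "x \<in> boundary_arc s \<epsilon>" unfolding boundary_arc_def using t \<epsilon> by (auto intro!: image_eqI)
    then show False using x by simp
  qed
  ultimately have "sin (\<epsilon> / 2) \<le> sin (t / 2)"
  proof (cases "t \<le> pi")
    case True
    then show ?thesis using \<open>\<epsilon> \<le> t\<close> \<epsilon> pi_gt_zero by (intro sin_monotone_2pi_le) linarith+
  next
    case False
    have "sin (\<epsilon> / 2) \<le> sin (pi - t / 2)"
      using \<open>t \<le> 2 * pi - \<epsilon>\<close> False \<epsilon> pi_gt_zero by (intro sin_monotone_2pi_le) linarith+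
    then show ?thesis by simp
  qed
  moreover have "0 \<le> sin (t / 2)" using t by (intro sin_ge_zero) auto
  ultimately show ?thesis unfolding xt norm_circle_point_diff by simp
qed

lemma absorbing_part_point:
  assumes "0 < \<epsilon>" "t \<in> {-1<..<1}"
  shows "circle_point (s $ j + \<epsilon> * t) \<in> absorbing_part \<epsilon> s"
proof -
  have "\<epsilon> * \<bar>t\<bar> < \<epsilon> * 1" using assms by (intro mult_strict_left_mono) auto
  then have "\<bar>\<epsilon> * t\<bar> < \<epsilon>" using assms by (simp add: abs_mult)
  then have "s $ j + \<epsilon> * t \<in> {s $ j - \<epsilon><..<s $ j + \<epsilon>}" by (auto simp: abs_less_iff)
  then show ?thesis unfolding absorbing_part_def boundary_arc_def by blast
qed

text \<open>The unit mass of \<open>\<psi>\<close> makes the normal derivative 1/2 of its potential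
  cancel the -1/2 of the quadratic term. In the factor \<open>1 + 1 / c\<close>, the 1 is the error
  on the arcs, spread over the disk by the minimum principle, and \<open>1 / c\<close> comes from
  replacing the potential by logarithms at \<open>x\<close>.\<close>

lemma mixed_solution_far_field:
  fixes s :: "real ^ 'n::finite" and p :: "'n \<Rightarrow> real"
  assumes \<epsilon>: "0 < \<epsilon>" "\<epsilon> * (B + 1) \<le> 1" and B: "\<And>i j. \<bar>p i - p j\<bar> + 1 \<le> B"
    and s: "\<And>i j. s $ i - s $ j = (p i - p j) * \<epsilon>"
    and sol: "mixed_solution (absorbing_part \<epsilon> s) u"
    and \<psi>: "\<And>j. arcsine_bounded C (\<psi> j)"
    and mass: "(\<Sum>j\<in>UNIV. LINT t:{-1<..<1}|lebesgue. \<psi> j t) = 1"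
    and pot: "\<And>i \<sigma>. \<bar>\<sigma>\<bar> < 1 \<Longrightarrow> (\<Sum>j\<in>UNIV. LINT t:{-1<..<1}|lebesgue. ln \<bar>(p i - p j + \<sigma>) - t\<bar> * \<psi> j t) = A"
    and c: "0 < c" and x: "x \<in> ball 0 1" "c \<le> infdist x (absorbing_part \<epsilon> s)"
  shows "\<bar>u x - (- ln \<epsilon> - A + (\<Sum>i\<in>UNIV. Phi_disk x (circle_point (s $ i))) / real CARD('n))\<bar>
    \<le> real CARD('n) * (240 * (B + 1) * C) * (1 + 1 / c) * \<epsilon>"
proof -
  let ?\<Gamma> = "absorbing_part \<epsilon> s"
  let ?n = "real CARD('n)"
  define K where "K = 240 * (B + 1) * C"
  have B1: "1 \<le> B" using B[of undefined undefined] by simp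
  have "\<epsilon> * 1 \<le> \<epsilon> * (B + 1)" using \<epsilon>(1) B1 by (intro mult_left_mono) auto
  then have \<epsilon>1: "\<epsilon> \<le> 1" using \<epsilon> by linarith
  have C: "0 \<le> C" using \<psi>[of undefined] by (simp add: arcsine_bounded_def)
  have K: "0 \<le> K" using B1 C by (simp add: K_def)
  define m where "m j = (LINT t:{-1<..<1}|lebesgue. \<psi> j t)" for j
  define P where "P x = (\<Sum>j\<in>UNIV. arc_potential \<epsilon> (s $ j) (\<psi> j) x)" for x
  define w where "w x = u x - (1/4) * (1 - (norm x)\<^sup>2) - P x" for x
  have u: "continuous_on (cball 0 1) u" "C2_on u (ball 0 1)" "\<And>x. x \<in> ball 0 1 \<Longrightarrow> laplacian u x = -1"
    "\<And>x. x \<in> ?\<Gamma> \<Longrightarrow> u x = 0" "\<And>x. x \<in> sphere 0 1 - closure ?\<Gamma> \<Longrightarrow> has_normal_derivative u x 0 x"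
    using sol by (auto simp: mixed_solution_def)
  have pt: "circle_point (s $ j + \<epsilon> * t) \<in> ?\<Gamma>" if "t \<in> {-1<..<1}" for t j
    using absorbing_part_point[OF \<epsilon>(1) that] .
  have shift: "s $ i + \<epsilon> * \<sigma> = s $ j + \<epsilon> * (p i - p j + \<sigma>)" for i j \<sigma>
    using s[of i j] by (simp add: algebra_simps)
  have Gs: "?\<Gamma> \<subseteq> sphere 0 1" by (auto simp: absorbing_part_def boundary_arc_def)
  then have cGs: "closure ?\<Gamma> \<subseteq> cball 0 1" by (intro closure_minimal) auto
  have Pc: "continuous_on S P" for S
    unfolding P_def by (intro continuous_on_sum arc_potential_continuous[OF \<psi> \<epsilon>(1) \<epsilon>1])
  have wc: "continuous_on (cball 0 1) w"
    unfolding w_def by (intro continuous_intros u(1) Pc)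
  have wh: "((\<lambda>t. cross_diff w y t / t\<^sup>2) \<longlongrightarrow> 0) (at_right 0)" if y: "y \<in> ball 0 1" for y
  proof -
    have Pcd: "cross_diff P y t = (\<Sum>j\<in>UNIV. cross_diff (arc_potential \<epsilon> (s $ j) (\<psi> j)) y t)" for t
      unfolding cross_diff_def P_def by (simp add: sum.distrib sum_subtractf sum_distrib_left)
    have "((\<lambda>t. cross_diff u y t / t\<^sup>2 + 1 - (\<Sum>j\<in>UNIV. cross_diff (arc_potential \<epsilon> (s $ j) (\<psi> j)) y t / t\<^sup>2))
        \<longlongrightarrow> laplacian u y + 1 - (\<Sum>j\<in>(UNIV::'n set). 0)) (at_right 0)"
      by (intro tendsto_intros tendsto_sum cross_diff_laplacian u(2) y arc_potential_cross_diff[OF \<psi> \<epsilon>(1) \<epsilon>1 y])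
    then have l: "((\<lambda>t. cross_diff u y t / t\<^sup>2 + 1 - (\<Sum>j\<in>UNIV. cross_diff (arc_potential \<epsilon> (s $ j) (\<psi> j)) y t / t\<^sup>2)) \<longlongrightarrow> 0) (at_right 0)"
      using u(3)[OF y] by simp
    have c1: "cross_diff (\<lambda>x. (1/4) * (1 - (norm x)\<^sup>2)) y t = - t\<^sup>2" for t
    proof -
      have "cross_diff (\<lambda>x. 1 - (norm x)\<^sup>2) y t = - (4 * t\<^sup>2)"
        unfolding cross_diff_diff cross_diff_norm_power2 by (simp add: cross_diff_def)
      then show ?thesis unfolding cross_diff_cmult by simp
    qed
    have "\<forall>\<^sub>F t in at_right (0::real). cross_diff u y t / t\<^sup>2 + 1 - (\<Sum>j\<in>UNIV. cross_diff (arc_potential \<epsilon> (s $ j) (\<psi> j)) y t / t\<^sup>2)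
        = cross_diff w y t / t\<^sup>2"
      using eventually_at_right_less[of "0::real"]
    proof eventually_elim
      case (elim t)
      have "cross_diff w y t = cross_diff u y t + t\<^sup>2 - (\<Sum>j\<in>UNIV. cross_diff (arc_potential \<epsilon> (s $ j) (\<psi> j)) y t)"
        unfolding w_def cross_diff_diff c1 Pcd by simp
      then show ?case using elim by (simp add: diff_divide_distrib add_divide_distrib sum_divide_distrib)
    qed
    from Lim_transform_eventually[OF l this] show ?thesis .
  qed
  have wn: "has_normal_derivative w y 0 y" if y: "y \<in> sphere 0 1 - closure ?\<Gamma>" for y
  proof -
    have ny: "norm y = 1" using y by simp
    have ne: "closure ?\<Gamma> \<noteq> {}" using pt[of 0] closure_subset by fastforce
    define r where "r = infdist y (closure ?\<Gamma>)"
    have r: "0 < r" unfolding r_def using y ne by (intro infdist_pos_not_in_closed) auto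
    have rl: "r \<le> norm (y - circle_point (s $ j + \<epsilon> * t))" if "t \<in> {-1<..<1}" for t j
      unfolding r_def dist_norm[symmetric] using pt[OF that] closure_subset by (intro infdist_le) blast
    have hP: "has_normal_derivative P y (\<Sum>j\<in>UNIV. m j / 2) y"
    proof -
      have "((\<lambda>t. \<Sum>j\<in>UNIV. arc_potential \<epsilon> (s $ j) (\<psi> j) (y + t *\<^sub>R y)) has_real_derivative (\<Sum>j\<in>UNIV. m j / 2)) (at_left 0)"
        using arc_potential_normal_derivative[OF \<psi> \<epsilon>(1) \<epsilon>1 ny r rl]
        unfolding has_normal_derivative_def m_def by (intro DERIV_sum) auto
      then show ?thesis unfolding has_normal_derivative_def P_def .
    qed
    have half: "(\<Sum>j\<in>UNIV. m j / 2) = 1 / 2" using mass by (simp add: m_def sum_divide_distrib[symmetric])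
    have hq: "has_normal_derivative (\<lambda>x. (1/4) * (1 - (norm x)\<^sup>2)) y ((1/4) * (0 - 2)) y"
      by (intro has_normal_derivative_cmult has_normal_derivative_diff has_normal_derivative_norm_power2 ny)
         (simp add: has_normal_derivative_def)
    show ?thesis
      using has_normal_derivative_diff[OF has_normal_derivative_diff[OF u(5)[OF y] hq] hP]
      unfolding half w_def[abs_def] by simp
  qed
  \<comment> \<open>On the arcs \<open>u\<close> and the quadratic term both vanish, so
    \<open>w = - P\<close>. A point of arc \<open>i\<close> is seen from the centre of arc
    \<open>j\<close> at the offset \<open>p i - p j + \<sigma>\<close> in units of
    \<open>\<epsilon>\<close>.\<close>
  have wG: "\<bar>w y - (- ln \<epsilon> - A)\<bar> \<le> ?n * K * \<epsilon>" if y: "y \<in> ?\<Gamma>" for y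
  proof -
    obtain i t where t: "y = circle_point t" "t \<in> {s $ i - \<epsilon><..<s $ i + \<epsilon>}"
      using y by (auto simp: absorbing_part_def boundary_arc_def)
    define \<sigma> where "\<sigma> = (t - s $ i) / \<epsilon>"
    have \<sigma>: "\<bar>\<sigma>\<bar> < 1" "t = s $ i + \<epsilon> * \<sigma>" using t \<epsilon> by (auto simp: \<sigma>_def abs_less_iff field_simps)
    let ?J = "\<lambda>j. LINT t:{-1<..<1}|lebesgue. ln \<bar>(p i - p j + \<sigma>) - t\<bar> * \<psi> j t"
    have "\<bar>arc_potential \<epsilon> (s $ j) (\<psi> j) y - (ln \<epsilon> * m j + ?J j)\<bar> \<le> K * \<epsilon>" for j
    proof -
      let ?a = "p i - p j + \<sigma>"
      have aB: "\<bar>?a\<bar> + 1 \<le> B + 1" using B[of i j] \<sigma> by linarith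
      have "\<epsilon> * (\<bar>?a\<bar> + 1) \<le> \<epsilon> * (B + 1)" using aB \<epsilon> by (intro mult_left_mono) auto
      then have le: "\<epsilon> * (\<bar>?a\<bar> + 1) \<le> 1" using \<epsilon> by linarith
      have y': "y = circle_point (s $ j + \<epsilon> * ?a)" unfolding t(1) \<sigma>(2) shift[of i \<sigma> j] ..
      have "\<bar>arc_potential \<epsilon> (s $ j) (\<psi> j) y - (ln \<epsilon> * m j + ?J j)\<bar> \<le> 240 * (\<epsilon> * (\<bar>?a\<bar> + 1)) * C"
        unfolding y' m_def by (rule arc_potential_near[OF \<psi> \<epsilon>(1) \<epsilon>1 le])
      also have "\<dots> \<le> 240 * (\<epsilon> * (B + 1)) * C"
        using aB \<epsilon> C by (intro mult_right_mono mult_left_mono) auto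
      finally show ?thesis by (simp add: K_def mult_ac)
    qed
    then have "(\<Sum>j\<in>UNIV. \<bar>arc_potential \<epsilon> (s $ j) (\<psi> j) y - (ln \<epsilon> * m j + ?J j)\<bar>) \<le> (\<Sum>j\<in>(UNIV::'n set). K * \<epsilon>)"
      by (rule sum_mono)
    then have "\<bar>\<Sum>j\<in>UNIV. arc_potential \<epsilon> (s $ j) (\<psi> j) y - (ln \<epsilon> * m j + ?J j)\<bar> \<le> ?n * (K * \<epsilon>)"
      by (intro order_trans[OF sum_abs]) simp
    moreover have "(\<Sum>j\<in>UNIV. arc_potential \<epsilon> (s $ j) (\<psi> j) y - (ln \<epsilon> * m j + ?J j)) = P y - (ln \<epsilon> + A)"
    proof -
      have "(\<Sum>j\<in>UNIV. ln \<epsilon> * m j) = ln \<epsilon>" using mass by (simp add: m_def sum_distrib_left[symmetric])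
      then show ?thesis by (simp add: P_def sum_subtractf sum.distrib pot[OF \<sigma>(1), of i])
    qed
    moreover have "w y = - P y" using u(4)[OF y] Gs y by (auto simp: w_def)
    ultimately show ?thesis by (simp add: mult.assoc abs_minus_commute)
  qed
  \<comment> \<open>The normal derivative is prescribed only off the closure, so the endpoints of
    the arcs must count as Dirichlet points; continuity of \<open>w\<close> carries the bound to
    them.\<close>
  have wcG: "\<bar>w y - (- ln \<epsilon> - A)\<bar> \<le> ?n * K * \<epsilon>" if "y \<in> closure ?\<Gamma>" for y
  proof -
    have "norm (w y - (- ln \<epsilon> - A)) \<le> ?n * K * \<epsilon>"
      by (rule continuous_on_closure_norm_le[where s = ?\<Gamma> and f = "\<lambda>y. w y - (- ln \<epsilon> - A)"])
         (use that wG in \<open>auto intro!: continuous_intros continuous_on_subset[OF wc cGs]\<close>)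
    then show ?thesis by simp
  qed
  have w_all: "\<bar>w x - (- ln \<epsilon> - A)\<bar> \<le> ?n * K * \<epsilon>"
  proof (rule disk_principle_abs[OF wc wh wn _ _ _ wcG])
    show "norm (circle_point (s $ undefined)) = 1" by simp
    show "0 < 2 * sin (\<epsilon> / 2)" using \<epsilon> \<epsilon>1 pi_gt3 by (intro mult_pos_pos sin_gt_zero) auto
    show "2 * sin (\<epsilon> / 2) \<le> norm (y - circle_point (s $ undefined))" if "y \<in> sphere 0 1 - closure ?\<Gamma>" for y
    proof (rule boundary_arc_neighbourhood[OF \<epsilon>(1) \<epsilon>1])
      show "y \<notin> boundary_arc (s $ undefined) \<epsilon>"
        using that closure_subset[of ?\<Gamma>] by (auto simp: absorbing_part_def)
    qed (use that in auto)
    show "x \<in> cball 0 1" using x by simp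
  qed
  define l where "l i = ln (norm (x - circle_point (s $ i)))" for i
  have far: "c \<le> norm (x - circle_point (s $ j + \<epsilon> * t))" if "t \<in> {-1<..<1}" for t j
    using x(2) infdist_le[OF pt[OF that], of x j] by (simp add: dist_norm)
  have Pl: "\<bar>P x - l i\<bar> \<le> ?n * (K * \<epsilon> / c)" for i
  proof -
    have "\<bar>arc_potential \<epsilon> (s $ j) (\<psi> j) x - l i * m j\<bar> \<le> K * \<epsilon> / c" for j
    proof -
      let ?a = "p i - p j"
      have si: "s $ i = s $ j + \<epsilon> * ?a" using shift[of i 0 j] by simp
      have "c \<le> norm (x - circle_point (s $ i))" using far[of 0 i] by simp
      then have "\<bar>arc_potential \<epsilon> (s $ j) (\<psi> j) x - l i * m j\<bar> \<le> 240 * (\<epsilon> * (\<bar>?a\<bar> + 1) / c) * C"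
        unfolding l_def m_def si by (intro arc_potential_far[OF \<psi> \<epsilon>(1) \<epsilon>1 c far]) auto
      also have "\<dots> \<le> 240 * (\<epsilon> * (B + 1) / c) * C"
        using B[of i j] \<epsilon> C c by (intro mult_right_mono mult_left_mono divide_right_mono) auto
      finally show ?thesis by (simp add: K_def mult_ac)
    qed
    then have "(\<Sum>j\<in>UNIV. \<bar>arc_potential \<epsilon> (s $ j) (\<psi> j) x - l i * m j\<bar>) \<le> (\<Sum>j\<in>(UNIV::'n set). K * \<epsilon> / c)"
      by (rule sum_mono)
    then have "\<bar>\<Sum>j\<in>UNIV. arc_potential \<epsilon> (s $ j) (\<psi> j) x - l i * m j\<bar> \<le> ?n * (K * \<epsilon> / c)"
      by (intro order_trans[OF sum_abs]) simp
    moreover have "(\<Sum>j\<in>UNIV. arc_potential \<epsilon> (s $ j) (\<psi> j) x - l i * m j) = P x - l i"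
      using mass by (simp add: P_def m_def sum_subtractf sum_distrib_left[symmetric])
    ultimately show ?thesis by simp
  qed
  \<comment> \<open>Every single logarithm \<open>l i\<close> approximates \<open>P x\<close> to the
    same order, hence so does their mean.\<close>
  have n0: "0 < ?n" by simp
  have "\<bar>\<Sum>i\<in>UNIV. (P x - l i)\<bar> \<le> (\<Sum>i\<in>(UNIV::'n set). ?n * (K * \<epsilon> / c))"
    by (intro order_trans[OF sum_abs] sum_mono Pl)
  then have "\<bar>(\<Sum>i\<in>UNIV. (P x - l i)) / ?n\<bar> \<le> ?n * (K * \<epsilon> / c)"
    using n0 by (simp add: pos_divide_le_eq mult.commute)
  moreover have "(\<Sum>i\<in>UNIV. (P x - l i)) / ?n = P x - (\<Sum>i\<in>UNIV. l i) / ?n"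
    by (simp add: sum_subtractf diff_divide_distrib)
  ultimately have avg: "\<bar>P x - (\<Sum>i\<in>UNIV. l i) / ?n\<bar> \<le> ?n * (K * \<epsilon> / c)" by simp
  have Phi: "(\<Sum>i\<in>UNIV. Phi_disk x (circle_point (s $ i))) / ?n = (\<Sum>i\<in>UNIV. l i) / ?n + (1/4) * (1 - (norm x)\<^sup>2)"
    by (simp add: Phi_disk_def l_def sum.distrib add_divide_distrib)
  have "u x - (- ln \<epsilon> - A + (\<Sum>i\<in>UNIV. Phi_disk x (circle_point (s $ i))) / ?n)
     = (w x - (- ln \<epsilon> - A)) + (P x - (\<Sum>i\<in>UNIV. l i) / ?n)"
    unfolding Phi w_def by simp
  then have "\<bar>u x - (- ln \<epsilon> - A + (\<Sum>i\<in>UNIV. Phi_disk x (circle_point (s $ i))) / ?n)\<bar> \<le> ?n * K * \<epsilon> + ?n * (K * \<epsilon> / c)"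
    using w_all avg by linarith
  also have "\<dots> = ?n * K * (1 + 1 / c) * \<epsilon>" by (simp add: algebra_simps)
  finally show ?thesis by (simp only: K_def)
qed

lemma arcsine_bounded_mono:
  assumes "arcsine_bounded C \<psi>" "C \<le> C'"
  shows "arcsine_bounded C' \<psi>"
proof -
  have "\<bar>\<psi> t\<bar> \<le> C' / sqrt (1 - t\<^sup>2)" if t: "t \<in> {-1<..<1}" for t
  proof -
    have "\<bar>t\<bar> \<le> 1" using t by (simp add: abs_le_iff)
    then have "C / sqrt (1 - t\<^sup>2) \<le> C' / sqrt (1 - t\<^sup>2)"
      using assms(2) by (intro divide_right_mono) (auto simp: abs_square_le_1)
    moreover have "\<bar>\<psi> t\<bar> \<le> C / sqrt (1 - t\<^sup>2)" using assms(1) t unfolding arcsine_bounded_def by blast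
    ultimately show ?thesis by linarith
  qed
  then show ?thesis using assms by (auto simp: arcsine_bounded_def)
qed

lemma arcsine_bounded_divide:
  assumes "arcsine_bounded C \<psi>"
  shows "arcsine_bounded (C / \<bar>M\<bar>) (\<lambda>t. \<psi> t / M)"
  unfolding arcsine_bounded_def
proof (intro conjI ballI)
  show "(\<lambda>t. \<psi> t / M) \<in> borel_measurable (lebesgue_on {-1<..<1})"
    using assms by (intro borel_measurable_divide) (auto simp: arcsine_bounded_def)
  show "0 \<le> C / \<bar>M\<bar>" using assms by (simp add: arcsine_bounded_def)
  fix t :: real assume "t \<in> {-1<..<1}"
  then have "\<bar>\<psi> t\<bar> / \<bar>M\<bar> \<le> (C / sqrt (1 - t\<^sup>2)) / \<bar>M\<bar>"
    using assms by (intro divide_right_mono) (auto simp: arcsine_bounded_def)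
  then show "\<bar>\<psi> t / M\<bar> \<le> C / \<bar>M\<bar> / sqrt (1 - t\<^sup>2)" by (simp add: divide_divide_eq_left mult.commute)
qed

theorem theorem3p6:
  fixes d :: "real ^ 'n::finite ^ 'n"
    and s :: "real \<Rightarrow> real ^ 'n"
    and u :: "real \<Rightarrow> real \<times> real \<Rightarrow> real"
  assumes "\<And>i j. i \<noteq> j \<Longrightarrow> \<bar>d $ i $ j\<bar> > 2"
    and "\<forall>\<^sub>F \<epsilon> in at_right 0. \<forall>i j. s \<epsilon> $ i - s \<epsilon> $ j = d $ i $ j * \<epsilon>"
    and "\<forall>\<^sub>F \<epsilon> in at_right 0. mixed_solution (absorbing_part \<epsilon> (s \<epsilon>)) (u \<epsilon>)"
    and "c > 0"
  shows "\<exists>C. \<forall>\<^sub>F \<epsilon> in at_right 0. \<forall>x\<in>ball 0 1.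
           infdist x (absorbing_part \<epsilon> (s \<epsilon>)) \<ge> c \<longrightarrow>
           \<bar>u \<epsilon> x - (- ln \<epsilon> - 1 / (\<Sum>i\<in>UNIV. log_alpha d $ i)
                      + (\<Sum>i\<in>UNIV. Phi_disk x (circle_point (s \<epsilon> $ i))) / real CARD('n))\<bar>
             \<le> C * \<epsilon>"
proof -
  \<comment> \<open>Positions are read off one fixed column of \<open>d\<close>. That all entries
    are differences of positions has to be derived: it follows from the existence of centres
    \<open>s \<epsilon>\<close> for one positive \<open>\<epsilon>\<close>.\<close>
  define p where "p i = d $ i $ undefined" for i
  have d: "d $ i $ j = p i - p j" for i j
  proof -
    have "\<forall>\<^sub>F \<epsilon> in at_right (0::real). d $ i $ j = p i - p j"
      using assms(2) eventually_at_right_less[of "0::real"]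
    proof eventually_elim
      case (elim \<epsilon>)
      have "d $ i $ j * \<epsilon> = (s \<epsilon> $ i - s \<epsilon> $ undefined) - (s \<epsilon> $ j - s \<epsilon> $ undefined)"
        using elim by (metis diff_diff_eq2 diff_add_cancel add_diff_cancel_right')
      also have "\<dots> = (p i - p j) * \<epsilon>" using elim by (simp add: p_def left_diff_distrib)
      finally show ?case using elim by simp
    qed
    then show ?thesis by simp
  qed
  interpret interval_system p
    by unfold_locales (use assms(1) in \<open>simp add: d\<close>)
  obtain e where e: "\<And>x i. \<bar>x - p i\<bar> \<le> 1 \<Longrightarrow> pot e x = 1"
    "(\<Sum>j\<in>UNIV. LINT t:{-1<..<1}|lebesgue. dens e (p j + t)) \<noteq> 0"
    using equilibrium_density by blast
  define M where "M = (\<Sum>j\<in>UNIV. LINT t:{-1<..<1}|lebesgue. dens e (p j + t))"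
  define \<Psi> where "\<Psi> t = (\<chi> j. dens e (p j + t))" for t
  obtain C0 where C0: "\<And>j. arcsine_bounded (C0 j) (\<lambda>t. dens e (p j + t))"
    using dens_arcsine_bounded by metis
  define C where "C = (\<Sum>j\<in>UNIV. C0 j)"
  have C: "arcsine_bounded C (\<lambda>t. dens e (p j + t))" for j
  proof (rule arcsine_bounded_mono[OF C0])
    have "0 \<le> C0 i" for i using C0[of i] by (simp add: arcsine_bounded_def)
    then show "C0 j \<le> C" unfolding C_def by (intro member_le_sum) auto
  qed
  have \<alpha>: "(\<Sum>i\<in>UNIV. log_alpha d $ i) = M"
  proof -
    have "log_matrix_op d \<Psi> = (\<lambda>s\<in>{-1..1}. \<chi> i. 1)"
    proof
      fix s :: real
      have "(\<Sum>j\<in>UNIV. log_op (d $ i $ j) (\<lambda>t. \<Psi> t $ j) s) = 1" if "s \<in> {-1..1}" for i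
      proof -
        have eq: "d $ i $ j + s - t = (p i + s - p j) - t" for j t by (simp add: d)
        have "(\<Sum>j\<in>UNIV. log_op (d $ i $ j) (\<lambda>t. \<Psi> t $ j) s) = pot e (p i + s)"
          unfolding log_op_def pot_def \<Psi>_def by (simp only: eq vec_lambda_beta)
        also have "\<dots> = 1" using that by (intro e(1)[of _ i]) (auto simp: abs_le_iff)
        finally show ?thesis .
      qed
      then show "log_matrix_op d \<Psi> s = (\<lambda>s\<in>{-1..1}. \<chi> i. 1) s"
        by (simp add: log_matrix_op_def vec_eq_iff)
    qed
    moreover have "arcsine_bounded C (\<lambda>t. \<Psi> t $ j)" for j using C by (simp add: \<Psi>_def)
    ultimately have "(\<Sum>i\<in>UNIV. log_alpha d $ i) = (\<Sum>j\<in>UNIV. LINT t:{-1<..<1}|lebesgue. \<Psi> t $ j)"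
      by (intro sum_log_alpha) (auto simp: d)
    then show ?thesis by (simp add: M_def \<Psi>_def)
  qed
  have M: "M \<noteq> 0" using e(2) by (simp add: M_def)
  define \<psi> where "\<psi> j t = dens e (p j + t) / M" for j t
  have \<psi>: "arcsine_bounded (C / \<bar>M\<bar>) (\<psi> j)" for j
    unfolding \<psi>_def by (rule arcsine_bounded_divide[OF C])
  have mass: "(\<Sum>j\<in>UNIV. LINT t:{-1<..<1}|lebesgue. \<psi> j t) = 1"
    using M by (simp add: \<psi>_def sum_divide_distrib[symmetric] M_def)
  have pot: "(\<Sum>j\<in>UNIV. LINT t:{-1<..<1}|lebesgue. ln \<bar>(p i - p j + \<sigma>) - t\<bar> * \<psi> j t) = 1 / M"
    if "\<bar>\<sigma>\<bar> < 1" for i \<sigma>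
  proof -
    have a: "p i - p j + \<sigma> = p i + \<sigma> - p j" for j by simp
    have "(\<Sum>j\<in>UNIV. LINT t:{-1<..<1}|lebesgue. ln \<bar>(p i - p j + \<sigma>) - t\<bar> * \<psi> j t) = pot e (p i + \<sigma>) / M"
      unfolding \<psi>_def a pot_def sum_divide_distrib by simp
    then show ?thesis using e(1)[of "p i + \<sigma>" i] that by simp
  qed
  define B where "B = (\<Sum>i\<in>UNIV. \<Sum>j\<in>UNIV. \<bar>p i - p j\<bar>) + 1"
  have B: "\<bar>p i - p j\<bar> + 1 \<le> B" for i j
  proof -
    have "\<bar>p i - p j\<bar> \<le> (\<Sum>j\<in>UNIV. \<bar>p i - p j\<bar>)" by (intro member_le_sum) auto
    also have "\<dots> \<le> (\<Sum>i\<in>UNIV. \<Sum>j\<in>UNIV. \<bar>p i - p j\<bar>)" by (intro member_le_sum) (auto intro: sum_nonneg)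
    finally show ?thesis by (simp add: B_def)
  qed
  have B1: "0 < B + 1" using B[of undefined undefined] by simp
  \<comment> \<open>Keeps the arc length between any two points of the arcs below 1, the range in
    which chords are compared with arc lengths.\<close>
  have small: "\<forall>\<^sub>F \<epsilon> in at_right (0::real). \<epsilon> \<in> {0<..<1 / (B + 1)}"
    by (rule eventually_at_right_real) (use B1 in simp)
  show ?thesis
  proof (intro exI)
    show "\<forall>\<^sub>F \<epsilon> in at_right 0. \<forall>x\<in>ball 0 1.
           infdist x (absorbing_part \<epsilon> (s \<epsilon>)) \<ge> c \<longrightarrow>
           \<bar>u \<epsilon> x - (- ln \<epsilon> - 1 / (\<Sum>i\<in>UNIV. log_alpha d $ i)
                      + (\<Sum>i\<in>UNIV. Phi_disk x (circle_point (s \<epsilon> $ i))) / real CARD('n))\<bar>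
             \<le> (real CARD('n) * (240 * (B + 1) * (C / \<bar>M\<bar>)) * (1 + 1 / c)) * \<epsilon>"
      using assms(2,3) small
    proof eventually_elim
      case (elim \<epsilon>)
      have \<epsilon>: "0 < \<epsilon>" "\<epsilon> * (B + 1) \<le> 1" using elim B1 by (auto simp: pos_less_divide_eq)
      have s: "s \<epsilon> $ i - s \<epsilon> $ j = (p i - p j) * \<epsilon>" for i j using elim d by simp
      show ?case unfolding \<alpha>
        by (intro ballI impI mixed_solution_far_field[OF \<epsilon> B s elim(2) \<psi> mass pot assms(4)])
    qed
  qed
qed

end
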